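(* Let $p,q\in(1,\infty)$ satisfy $p\ne q$, and let $(\mathcal{E}_p,\mathcal{F}_p)$ and $(\mathcal{E}_q,\mathcal{F}_q)$ be the canonical $p$- and $q$-resistance forms on the Sierpiński gasket $K$. Then for any $u\in\mathcal{F}_p$ and any $v\in\mathcal{F}_q$, the $p$-energy measure $\mu^p_{\langle u\rangle}$ of $u$ and the $q$-energy measure $\mu^q_{\langle v\rangle}$ of $v$ are mutually singular: $\mu^p_{\langle u\rangle}\perp\mu^q_{\langle v\rangle}$.
   Context: The following is for an arbitrary $p\in(1,\infty)$ (and is applied also with $q$ in place of $p$). $\|x\|_{\ell^s}=(\sum_k|x_k|^s)^{1/s}$ for $s\in(0,\infty)$, $\|x\|_{\ell^\infty}=\max_k|x_k|$; $\mathbf 1_X$ is the constant function $1$ on $X$; $\sup\emptyset:=0$. $p$-resistance forms. A $p$-resistance form on a non-empty set $X$ is a pair $(\mathcal{E},\mathcal{F})$ of a linear subspace $\mathcal{F}\subset\mathbb{R}^X$ and $\mathcal{E}:\mathcal{F}\to[0,\infty)$ such that: (RF1) $\mathcal{E}^{1/p}$ is a seminorm and $\{\mathcal{E}=0\}=\mathbb{R}\mathbf 1_X$; (RF2) $(\mathcal{F}/\mathbb{R}\mathbf 1_X,\mathcal{E}^{1/p})$ is a Banach space; (RF3) $\mathcal{F}$ separates points of $X$; (RF4) $\sup\{|u(x)-u(y)|^p/\mathcal{E}(u)\mid u\in\mathcal{F}\setminus\mathbb{R}\mathbf 1_X\}<\infty$ for all $x,y\in X$; (RF5) if $s\in(0,p]$,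 $r\in[p,\infty]$, $m,n\in\mathbb{N}$ and $T:\mathbb{R}^m\to\mathbb{R}^n$ satisfies $T(0)=0$ and $\|T(x)-T(y)\|_{\ell^r}\le\|x-y\|_{\ell^s}$ for all $x,y$, then for $u\in\mathcal{F}^m$, $T(u)\in\mathcal{F}^n$ and $\|(\mathcal{E}(T_k(u))^{1/p})_k\|_{\ell^r}\le\|(\mathcal{E}(u_j)^{1/p})_j\|_{\ell^s}$. On a finite set $X$ one necessarily has $\mathcal{F}=\mathbb{R}^X$ and only $\mathcal{E}$ is mentioned. Trace: for $\emptyset\neq B\subset X$ and $u\in\mathcal{F}|_B$, $\mathcal{E}|_B(u):=\inf\{\mathcal{E}(v)\mid v\in\mathcal{F},v|_B=u\}$. Sierpiński gasket. $S=\{1,2,3\}$; $V_0=\{q_1,q_2,q_3\}\subset\mathbb{R}^2$ is the vertex set of an equilateral triangle; $f_i(x)=q_i+\frac12(x-q_i)$; $K$ is the unique non-empty compact subset of $\mathbb{R}^2$ with $K=\bigcup_{i\in S}f_i(K)$, with the Euclidean metric; $F_i:=f_i|_K$. $W_n=S^n$ ($W_0=\{\emptyset\}$), $W_*=\bigcup_{n\ge0}W_n$, $|w|=n$ for $w\in W_n$, $F_w=F_{w_1}\circ\cdots\circ F_{w_n}$ ($F_\emptyset=\mathrm{id}_K$), $K_w=F_w(K)$, $V_n=\bigcup_{w\in W_n}F_w(V_0)$. $\mathcal{G}_{\mathrm{sym}}$ is the isometry group of $K$. Canonical form. For a $p$-resistance form $\mathcal{E}$ on $V_0$, $\rho>0$,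 $n\ge0$, put $\mathcal{R}_{\rho,n}(\mathcal{E})(u)=\sum_{w\in W_n}\rho^n\mathcal{E}(u\circ F_w|_{V_0})$, $u\in\mathbb{R}^{V_n}$. There is a unique $\rho_p\in(0,\infty)$ for which some $p$-resistance form $\mathcal{E}$ on $V_0$ satisfies $\mathcal{R}_{\rho_p,1}(\mathcal{E})|_{V_0}=\mathcal{E}$; fix such a form $\mathcal{E}_p^{(0)}$ that is also $\mathcal{G}_{\mathrm{sym}}$-invariant ($\mathcal{E}_p^{(0)}(u\circ g|_{V_0})=\mathcal{E}_p^{(0)}(u)$ for $g\in\mathcal{G}_{\mathrm{sym}}$), which exists (it is unique up to constant multiples). Put $\mathcal{E}_p^{(n)}=\mathcal{R}_{\rho_p,n}(\mathcal{E}_p^{(0)})$; for $u\in C(K)$ the sequence $\mathcal{E}_p^{(n)}(u|_{V_n})$ is non-decreasing in $n$. Define $\mathcal{F}_p=\{u\in C(K)\mid\lim_n\mathcal{E}_p^{(n)}(u|_{V_n})<\infty\}$ and $\mathcal{E}_p(u)=\lim_n\mathcal{E}_p^{(n)}(u|_{V_n})$. Then $(\mathcal{E}_p,\mathcal{F}_p)$ is a $p$-resistance form on $K$, the canonical $p$-resistance form, and $\mathcal{E}_p(u)=\sum_{i\in S}\rho_p\mathcal{E}_p(u\circ F_i)$. Energy measures. For $u\in\mathcal{F}_p$, $\mu^p_{\langle u\rangle}$ is the unique Borel measure on $K$ such that $\mu^p_{\langle u\rangle}(K_w)=\rho_p^{|w|}\mathcal{E}_p(u\circ F_w)$ for any $w\in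 W_*$ (existence and uniqueness are known). *)

theory Defs
  imports "HOL-Analysis.Analysis"
begin

section \<open>\<open>p\<close>-resistance forms\<close>

text \<open>
  The space of real functions on \<open>X\<close> is represented by the extensional functions on \<open>X\<close>
  (undefined off \<open>X\<close>); vectors with \<open>n\<close> entries are the case \<open>X = {..<n}\<close>, so entries are
  indexed from 0. A functional on a space \<open>F\<close> of functions is a total Isabelle function of which
  only the values on \<open>F\<close> are ever used.
\<close>

abbreviation real_funs :: "'a set \<Rightarrow> ('a \<Rightarrow> real) set" where
  "real_funs X \<equiv> X \<rightarrow>\<^sub>E UNIV"

definition fun_subspace :: "'a set \<Rightarrow> ('a \<Rightarrow> real) set \<Rightarrow> bool" where
  "fun_subspace X F \<longleftrightarrow> F \<subseteq> real_funs X \<and> (\<lambda>x\<in>X. 0) \<in> F \<and>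
     (\<forall>u\<in>F. \<forall>v\<in>F. (\<lambda>x\<in>X. u x + v x) \<in> F) \<and> (\<forall>c. \<forall>u\<in>F. (\<lambda>x\<in>X. c * u x) \<in> F)"

definition fun_seminorm :: "'a set \<Rightarrow> ('a \<Rightarrow> real) set \<Rightarrow> (('a \<Rightarrow> real) \<Rightarrow> real) \<Rightarrow> bool" where
  "fun_seminorm X F N \<longleftrightarrow> (\<forall>u\<in>F. 0 \<le> N u) \<and>
     (\<forall>c. \<forall>u\<in>F. N (\<lambda>x\<in>X. c * u x) = \<bar>c\<bar> * N u) \<and>
     (\<forall>u\<in>F. \<forall>v\<in>F. N (\<lambda>x\<in>X. u x + v x) \<le> N u + N v)"

definition const_funs :: "'a set \<Rightarrow> ('a \<Rightarrow> real) set" where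
  "const_funs X = range (\<lambda>c. \<lambda>x\<in>X. c)"

definition quotient_by_consts :: "'a set \<Rightarrow> ('a \<Rightarrow> real) set \<Rightarrow> ('a \<Rightarrow> real) set set" where
  "quotient_by_consts X F =
     F // {(u, v). u \<in> F \<and> v \<in> F \<and> (\<lambda>x\<in>X. u x - v x) \<in> const_funs X}"

text \<open>
  The distance induced on the quotient by a seminorm \<open>N\<close> that vanishes exactly on the constants.
  Since the locale \<open>Metric_space\<close> demands symmetry and nonnegativity of the distance on the whole
  type, it is set to 0 off the quotient.
\<close>

definition quotient_dist ::
  "'a set \<Rightarrow> ('a \<Rightarrow> real) set \<Rightarrow> (('a \<Rightarrow> real) \<Rightarrow> real) \<Rightarrow> ('a \<Rightarrow> real) set \<Rightarrow> ('a \<Rightarrow> real) set \<Rightarrow> real" where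
  "quotient_dist X F N A B =
     (if A \<in> quotient_by_consts X F \<and> B \<in> quotient_by_consts X F
      then THE r. \<exists>u\<in>A. \<exists>v\<in>B. r = N (\<lambda>x\<in>X. u x - v x) else 0)"

text \<open>The \<open>r\<close>-norm of the vector of the first \<open>n\<close> entries of \<open>x\<close>, for \<open>0 < r \<le> \<infinity>\<close> and \<open>n \<ge> 1\<close>.\<close>

definition lnorm :: "ereal \<Rightarrow> nat \<Rightarrow> (nat \<Rightarrow> real) \<Rightarrow> real" where
  "lnorm r n x =
     (if r = \<infinity> then Max ((\<lambda>k. \<bar>x k\<bar>) ` {..<n})
      else (\<Sum>k<n. \<bar>x k\<bar> powr real_of_ereal r) powr (1 / real_of_ereal r))"

definition generalized_contraction_property ::
  "real \<Rightarrow> 'a set \<Rightarrow> ('a \<Rightarrow> real) set \<Rightarrow> (('a \<Rightarrow> real) \<Rightarrow> real) \<Rightarrow> bool" where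
  "generalized_contraction_property p X F E \<longleftrightarrow>
     (\<forall>(s::real) (r::ereal) (m::nat) (n::nat) T.
        0 < s \<and> s \<le> p \<and> ereal p \<le> r \<and> 1 \<le> m \<and> 1 \<le> n \<and>
        T \<in> real_funs {..<m} \<rightarrow> real_funs {..<n} \<and>
        T (\<lambda>j\<in>{..<m}. 0) = (\<lambda>k\<in>{..<n}. 0) \<and>
        (\<forall>x\<in>real_funs {..<m}. \<forall>y\<in>real_funs {..<m}.
           lnorm r n (\<lambda>k. T x k - T y k) \<le> lnorm (ereal s) m (\<lambda>j. x j - y j))
        \<longrightarrow>
        (\<forall>u. (\<forall>j<m. u j \<in> F) \<longrightarrow>
           (let Tu = (\<lambda>k. \<lambda>x\<in>X. T (\<lambda>j\<in>{..<m}. u j x) k) in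
              (\<forall>k<n. Tu k \<in> F) \<and>
              lnorm r n (\<lambda>k. E (Tu k) powr (1 / p)) \<le> lnorm (ereal s) m (\<lambda>j. E (u j) powr (1 / p)))))"

definition resistance_form ::
  "real \<Rightarrow> 'a set \<Rightarrow> ('a \<Rightarrow> real) set \<Rightarrow> (('a \<Rightarrow> real) \<Rightarrow> real) \<Rightarrow> bool" where
  "resistance_form p X F E \<longleftrightarrow>
     X \<noteq> {} \<and> fun_subspace X F \<and> (\<forall>u\<in>F. 0 \<le> E u) \<and>
     fun_seminorm X F (\<lambda>u. E u powr (1 / p)) \<and>
     {u \<in> F. E u = 0} = const_funs X \<and>
     Metric_space.mcomplete (quotient_by_consts X F) (quotient_dist X F (\<lambda>u. E u powr (1 / p))) \<and>
     (\<forall>x\<in>X. \<forall>y\<in>X. x \<noteq> y \<longrightarrow> (\<exists>u\<in>F. u x \<noteq> u y)) \<and>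
     (\<forall>x\<in>X. \<forall>y\<in>X. bdd_above ((\<lambda>u. \<bar>u x - u y\<bar> powr p / E u) ` (F - const_funs X))) \<and>
     generalized_contraction_property p X F E"

lemma Metric_space_quotient_by_consts:
  assumes F: "fun_subspace X F" and N: "fun_seminorm X F N"
    and ker: "{u \<in> F. N u = 0} = const_funs X"
  shows "Metric_space (quotient_by_consts X F) (quotient_dist X F N)"
proof -
  define R where "R = {(u, v). u \<in> F \<and> v \<in> F \<and> (\<lambda>x\<in>X. u x - v x) \<in> const_funs X}"
  define D where "D u v = N (\<lambda>x\<in>X. u x - v x)" for u v
  have diff: "(\<lambda>x\<in>X. u x - v x) \<in> F" if "u \<in> F" "v \<in> F" for u v
  proof -
    have *: "(\<lambda>x\<in>X. u x + (\<lambda>x\<in>X. (-1) * v x) x) \<in> F"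
      using F that unfolding fun_subspace_def by blast
    have "(\<lambda>x\<in>X. u x + (\<lambda>x\<in>X. (-1) * v x) x) = (\<lambda>x\<in>X. u x - v x)"
      by (auto simp: fun_eq_iff)
    with * show ?thesis by simp
  qed
  have D_nonneg: "0 \<le> D u v" if "u \<in> F" "v \<in> F" for u v
    using N diff[OF that] by (simp add: D_def fun_seminorm_def)
  have D_sym: "D u v = D v u" if "u \<in> F" "v \<in> F" for u v
  proof -
    have "N (\<lambda>x\<in>X. (-1) * (\<lambda>x\<in>X. u x - v x) x) = \<bar>-1\<bar> * N (\<lambda>x\<in>X. u x - v x)"
      using N diff[OF that] unfolding fun_seminorm_def by blast
    moreover have "(\<lambda>x\<in>X. (-1) * (\<lambda>x\<in>X. u x - v x) x) = (\<lambda>x\<in>X. v x - u x)"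
      by (auto simp: fun_eq_iff)
    ultimately show ?thesis by (simp add: D_def)
  qed
  have D_tri: "D u w \<le> D u v + D v w" if "u \<in> F" "v \<in> F" "w \<in> F" for u v w
  proof -
    have "N (\<lambda>x\<in>X. (\<lambda>x\<in>X. u x - v x) x + (\<lambda>x\<in>X. v x - w x) x) \<le> D u v + D v w"
      using N diff that unfolding fun_seminorm_def D_def by blast
    moreover have "(\<lambda>x\<in>X. (\<lambda>x\<in>X. u x - v x) x + (\<lambda>x\<in>X. v x - w x) x) = (\<lambda>x\<in>X. u x - w x)"
      by (auto simp: fun_eq_iff)
    ultimately show ?thesis by (simp add: D_def)
  qed
  have R_iff: "(u, v) \<in> R \<longleftrightarrow> u \<in> F \<and> v \<in> F \<and> D u v = 0" for u v
    using ker diff unfolding R_def D_def by blast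
  have D_refl: "D u u = 0" if "u \<in> F" for u
  proof -
    have "(\<lambda>x\<in>X. u x - u x) \<in> const_funs X" by (auto simp: const_funs_def)
    then show ?thesis using ker by (auto simp: D_def)
  qed
  have eq: "equiv F R"
  proof (rule equivI)
    show "R \<subseteq> F \<times> F" by (auto simp: R_def)
    show "refl_on F R" by (auto simp: refl_on_def R_iff D_refl)
    show "sym R" by (auto simp: sym_def R_iff D_sym)
    show "trans R"
      unfolding trans_def R_iff by (metis D_nonneg D_tri add_0 order_antisym)
  qed
  have Q: "quotient_by_consts X F = F // R" by (simp add: quotient_by_consts_def R_def)
  have dist_eq: "quotient_dist X F N (R `` {u}) (R `` {v}) = D u v" if u: "u \<in> F" and v: "v \<in> F" for u v
  proof -
    have "r = D u v" if "u' \<in> R `` {u}" "v' \<in> R `` {v}" "r = D u' v'" for u' v' r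
    proof -
      have *: "u' \<in> F" "v' \<in> F" "D u u' = 0" "D v v' = 0" using that by (auto simp: R_iff)
      have "D u v \<le> D u u' + (D u' v' + D v' v)" "D u' v' \<le> D u' u + (D u v + D v v')"
        using D_tri[of u u' v] D_tri[of u' v' v] D_tri[of u' u v'] D_tri[of u v v'] u v *(1,2)
        by linarith+
      then show ?thesis using * that(3) D_sym u v by fastforce
    qed
    moreover have "u \<in> R `` {u}" "v \<in> R `` {v}" using u v by (auto simp: R_iff D_refl)
    ultimately have "(THE r. \<exists>u'\<in>R `` {u}. \<exists>v'\<in>R `` {v}. r = D u' v') = D u v"
      by (intro the_equality) blast+
    then show ?thesis
      using u v by (simp add: quotient_dist_def Q quotientI D_def)
  qed
  show ?thesis
  proof
    fix A B C
    show "0 \<le> quotient_dist X F N A B"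
    proof (cases "A \<in> F // R \<and> B \<in> F // R")
      case True
      then show ?thesis using dist_eq D_nonneg by (metis quotientE)
    qed (auto simp: quotient_dist_def Q)
    show "quotient_dist X F N A B = quotient_dist X F N B A"
    proof (cases "A \<in> F // R \<and> B \<in> F // R")
      case True
      then show ?thesis using dist_eq D_sym by (metis quotientE)
    qed (auto simp: quotient_dist_def Q)
    assume "A \<in> quotient_by_consts X F" "B \<in> quotient_by_consts X F"
    then obtain u v where uv: "u \<in> F" "A = R `` {u}" "v \<in> F" "B = R `` {v}"
      unfolding Q by (auto elim!: quotientE)
    show "quotient_dist X F N A B = 0 \<longleftrightarrow> A = B"
      using uv dist_eq R_iff by (simp add: eq_equiv_class_iff[OF eq])
    assume "C \<in> quotient_by_consts X F"
    then obtain w where "w \<in> F" "C = R `` {w}" unfolding Q by (auto elim!: quotientE)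
    then show "quotient_dist X F N A C \<le> quotient_dist X F N A B + quotient_dist X F N B C"
      using uv dist_eq D_tri by simp
  qed
qed

definition trace_form ::
  "('a \<Rightarrow> real) set \<Rightarrow> (('a \<Rightarrow> real) \<Rightarrow> real) \<Rightarrow> 'a set \<Rightarrow> ('a \<Rightarrow> real) \<Rightarrow> real" where
  "trace_form F E B u = Inf {E v | v. v \<in> F \<and> restrict v B = u}"


section \<open>The Sierpinski gasket\<close>

text \<open>The vertices are \<open>a 1\<close>, \<open>a 2\<close>, \<open>a 3\<close>; other values of \<open>a\<close> are irrelevant.\<close>

definition equilateral_triangle :: "(nat \<Rightarrow> real^2) \<Rightarrow> bool" where
  "equilateral_triangle a \<longleftrightarrow>
     a 1 \<noteq> a 2 \<and> dist (a 1) (a 2) = dist (a 2) (a 3) \<and> dist (a 2) (a 3) = dist (a 3) (a 1)"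

definition alphabet :: "nat set" where
  "alphabet = {1, 2, 3}"

definition words :: "nat \<Rightarrow> nat list set" where
  "words n = {w. length w = n \<and> set w \<subseteq> alphabet}"

definition contraction :: "(nat \<Rightarrow> real^2) \<Rightarrow> nat \<Rightarrow> real^2 \<Rightarrow> real^2" where
  "contraction a i x = a i + (1/2) *\<^sub>R (x - a i)"

definition word_map :: "(nat \<Rightarrow> real^2) \<Rightarrow> nat list \<Rightarrow> real^2 \<Rightarrow> real^2" where
  "word_map a w = foldr (\<lambda>i g. contraction a i \<circ> g) w id"

text \<open>The three conditions determine \<open>K\<close> uniquely.\<close>

definition is_gasket :: "(nat \<Rightarrow> real^2) \<Rightarrow> (real^2) set \<Rightarrow> bool" where
  "is_gasket a K \<longleftrightarrow> K \<noteq> {} \<and> compact K \<and> K = (\<Union>i\<in>alphabet. contraction a i ` K)"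

definition vertices :: "(nat \<Rightarrow> real^2) \<Rightarrow> nat \<Rightarrow> (real^2) set" where
  "vertices a n = (\<Union>w\<in>words n. word_map a w ` (a ` alphabet))"

definition isometry_group :: "'a::metric_space set \<Rightarrow> ('a \<Rightarrow> 'a) set" where
  "isometry_group K = {g. bij_betw g K K \<and> (\<forall>x\<in>K. \<forall>y\<in>K. dist (g x) (g y) = dist x y)}"


section \<open>Canonical forms and energy measures\<close>

definition renorm ::
  "(nat \<Rightarrow> real^2) \<Rightarrow> real \<Rightarrow> nat \<Rightarrow> ((real^2 \<Rightarrow> real) \<Rightarrow> real) \<Rightarrow> (real^2 \<Rightarrow> real) \<Rightarrow> real" where
  "renorm a \<rho> n E u =
     (\<Sum>w\<in>words n. \<rho> ^ n * E (restrict (u \<circ> word_map a w) (vertices a 0)))"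

text \<open>
  \<open>E0\<close> is a symmetric \<open>p\<close>-resistance form on the vertices of the triangle that is fixed by
  renormalization with scaling factor \<open>\<rho>\<close>. For each \<open>p > 1\<close> this determines \<open>\<rho>\<close> uniquely, and
  \<open>E0\<close> up to a constant multiple.
\<close>

definition canonical_data ::
  "(nat \<Rightarrow> real^2) \<Rightarrow> (real^2) set \<Rightarrow> real \<Rightarrow> real \<Rightarrow> ((real^2 \<Rightarrow> real) \<Rightarrow> real) \<Rightarrow> bool" where
  "canonical_data a K p \<rho> E0 \<longleftrightarrow>
     0 < \<rho> \<and> resistance_form p (vertices a 0) (real_funs (vertices a 0)) E0 \<and>
     (\<forall>u\<in>real_funs (vertices a 0).
        trace_form (real_funs (vertices a 1)) (renorm a \<rho> 1 E0) (vertices a 0) u = E0 u) \<and>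
     (\<forall>g\<in>isometry_group K. \<forall>u\<in>real_funs (vertices a 0).
        E0 (restrict (u \<circ> g) (vertices a 0)) = E0 u)"

text \<open>
  The sequence of level-\<open>n\<close> energies of a continuous function is nondecreasing, so that its limit
  in \<open>[0, \<infinity>]\<close> is finite if and only if the sequence converges in the reals.
\<close>

definition canonical_domain ::
  "(nat \<Rightarrow> real^2) \<Rightarrow> (real^2) set \<Rightarrow> real \<Rightarrow> ((real^2 \<Rightarrow> real) \<Rightarrow> real) \<Rightarrow> (real^2 \<Rightarrow> real) set" where
  "canonical_domain a K \<rho> E0 =
     {u \<in> real_funs K. continuous_on K u \<and>
        convergent (\<lambda>n. renorm a \<rho> n E0 (restrict u (vertices a n)))}"

definition canonical_form ::
  "(nat \<Rightarrow> real^2) \<Rightarrow> real \<Rightarrow> ((real^2 \<Rightarrow> real) \<Rightarrow> real) \<Rightarrow> (real^2 \<Rightarrow> real) \<Rightarrow> real" where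
  "canonical_form a \<rho> E0 u = lim (\<lambda>n. renorm a \<rho> n E0 (restrict u (vertices a n)))"

text \<open>For \<open>u\<close> in the domain there is exactly one such measure.\<close>

definition is_energy_measure ::
  "(nat \<Rightarrow> real^2) \<Rightarrow> (real^2) set \<Rightarrow> real \<Rightarrow> ((real^2 \<Rightarrow> real) \<Rightarrow> real) \<Rightarrow> (real^2 \<Rightarrow> real) \<Rightarrow>
     (real^2) measure \<Rightarrow> bool" where
  "is_energy_measure a K \<rho> E0 u \<mu> \<longleftrightarrow>
     sets \<mu> = sets (restrict_space borel K) \<and>
     (\<forall>n. \<forall>w\<in>words n. emeasure \<mu> (word_map a w ` K) =
        ennreal (\<rho> ^ length w * canonical_form a \<rho> E0 (restrict (u \<circ> word_map a w) K)))"

definition mutually_singular :: "'a measure \<Rightarrow> 'a measure \<Rightarrow> bool" where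
  "mutually_singular \<mu> \<nu> \<longleftrightarrow> sets \<mu> = sets \<nu> \<and>
     (\<exists>A\<in>sets \<mu>. emeasure \<mu> A = 0 \<and> emeasure \<nu> (space \<nu> - A) = 0)"

end

theory Submission
  imports Defs
begin

text \<open>
  In terms of vertex values a form on \<open>V\<^sub>0\<close> is a function \<open>E\<close> on triples, and the cells of a
  harmonic function are the iterates of the three maps \<open>H i\<close> extending boundary values harmonically.
  Let \<open>r = \<rho> powr (- 1 / (p - 1))\<close> (\<open>lam\<close> below). Near a vertex with nonzero flux every harmonic
  function is asymptotic to a multiple of the symmetric one with values \<open>(0, 1, 1)\<close>, which is scaled
  by \<open>r\<close> at each step. On cell 2 of the symmetric function, flux conservation forces the
  antisymmetric values \<open>(r, 1, (1 + r) / 2)\<close>, and conservation of flux along the blow-up at the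
  first vertex of that cell shows that the fraction of the cell's energy carried by the \<open>n\<close>-th subcell
  at this vertex is asymptotic to \<open>r ^ (n + 1) * 2 powr (- 1 / (p - 1)) / (1 - r)\<close>. Hence the energy
  distribution of the symmetric function determines first \<open>r\<close> and then \<open>p\<close>, so a \<open>p\<close>-harmonic and
  a \<open>q\<close>-harmonic function never have proportional energy measures. By compactness the Hellinger
  affinity of two such measures drops by a definite factor over a bounded number of levels. Since a
  function of finite energy is nearly harmonic on cells carrying most of its energy, the affinities
  of the two energy measures at level \<open>n\<close> tend to 0, which is mutual singularity.
\<close>

section \<open>Two-point inequalities\<close>

text \<open>For exponents other than 2 the harmonic functions do not form a linear space, and
  neither the harmonic extension nor \<rho> is given by a formula; so no matrix products are
  available, and the scaling factors for p and q cannot simply be compared. What remains is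
  homogeneity, the comparison principle and conservation of flux, where the flux at a vertex is the
  derivative of the energy with respect to the value there. Flux is homogeneous of degree p - 1.
  This is the origin of the factor \<open>2 powr (- 1 / (p - 1))\<close>: by symmetry the flux of
  the symmetric function splits evenly between cells 2 and 3, and halving a flux multiplies the
  amplitude by exactly this power. It tells p from q even if both have the same r.
  Differentiability, strict convexity and submodularity of the form on three vertices are all drawn
  from the contraction property, applied to suitable maps of the plane into itself. The Hellinger
  affinity is the right measure of overlap because, by Cauchy-Schwarz, it cannot increase when cells
  are subdivided, so a loss by a fixed factor at ever higher levels drives it to 0.\<close>

lemma powr_subadditive:
  fixes x y \<alpha> :: real
  assumes "0 \<le> x" "0 \<le> y" "0 < \<alpha>" "\<alpha> \<le> 1"
  shows "(x + y) powr \<alpha> \<le> x powr \<alpha> + y powr \<alpha>"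
proof (cases "x + y = 0")
  case False
  define s where "s = x + y"
  have s: "s > 0" using False assms s_def by auto
  have *: "z / s \<le> (z / s) powr \<alpha>" if "0 \<le> z" "z \<le> s" for z
    using powr_mono'[of \<alpha> 1 "z / s"] that s assms by simp
  have "1 = x / s + y / s" using s by (simp add: s_def add_divide_distrib[symmetric])
  also have "\<dots> \<le> (x / s) powr \<alpha> + (y / s) powr \<alpha>"
    using *[of x] *[of y] assms s_def by simp
  also have "\<dots> = (x powr \<alpha> + y powr \<alpha>) / s powr \<alpha>"
    by (simp add: powr_divide add_divide_distrib)
  finally show ?thesis using s by (simp add: s_def[symmetric] pos_le_divide_eq)
qed (use assms in auto)

text \<open>Up to the factor p, the difference for \<alpha> = p - 1 is the derivative of (1 + b)^p +
  (1 - b)^p, so a linear lower bound integrates to a quadratic one. For \<alpha> < 1 the concave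
  power lies below its tangent at 1, which is the inequality of Young used here.\<close>

lemma powr_sym_diff_lower:
  fixes b \<alpha> :: real
  assumes "0 \<le> b" "b < 1" "0 < \<alpha>"
  shows "min \<alpha> 1 * b \<le> (1 + b) powr \<alpha> - (1 - b) powr \<alpha>"
proof (cases "\<alpha> \<ge> 1")
  case True
  have "1 + b \<le> (1 + b) powr \<alpha>"
    using powr_mono[of 1 \<alpha> "1 + b"] assms True by simp
  moreover have "(1 - b) powr \<alpha> \<le> 1 - b"
    using powr_mono'[of 1 \<alpha> "1 - b"] assms True by auto
  ultimately show ?thesis using True assms by simp
next
  case False
  have "(1 - b) powr \<alpha> \<le> 1 - \<alpha> * b"
    using Youngs_inequality_0[of \<alpha> "1 - \<alpha>" "1 - b" 1] False assms by (simp add: algebra_simps)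
  moreover have "1 \<le> (1 + b) powr \<alpha>" using assms by (simp add: ge_one_powr_ge_zero)
  ultimately show ?thesis using False by simp
qed

text \<open>The exponent \<open>min \<alpha> 1\<close> reflects two regimes: for \<alpha> \<ge> 1
  the mean value theorem gives a linear bound, whereas for \<alpha> < 1 the derivative is unbounded
  as b tends to 1 and subadditivity of the power gives the order b^\<alpha>.\<close>

lemma powr_sym_diff_upper:
  fixes b \<alpha> :: real
  assumes "0 \<le> b" "b < 1" "0 < \<alpha>"
  shows "(1 + b) powr \<alpha> - (1 - b) powr \<alpha> \<le> 2 powr (\<alpha> + 1) * max \<alpha> 1 * b powr (min \<alpha> 1)"
proof (cases "\<alpha> \<ge> 1")
  case True
  show ?thesis
  proof (cases "b = 0")
    case False
    have "\<exists>z. 1 - b < z \<and> z < 1 + b \<and>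
        (1 + b) powr \<alpha> - (1 - b) powr \<alpha> = ((1 + b) - (1 - b)) * (\<alpha> * z powr (\<alpha> - 1))"
      by (rule MVT2) (use False assms in \<open>auto intro!: has_real_derivative_powr\<close>)
    then obtain z where z: "1 - b < z" "z < 1 + b"
      and eq: "(1 + b) powr \<alpha> - (1 - b) powr \<alpha> = 2 * b * (\<alpha> * z powr (\<alpha> - 1))"
      by auto
    have "z powr (\<alpha> - 1) \<le> 2 powr (\<alpha> - 1)" using z assms True by (intro powr_mono2) auto
    also have "2 powr (\<alpha> - 1) \<le> (2::real) powr \<alpha>" by simp
    finally have "2 * b * (\<alpha> * z powr (\<alpha> - 1)) \<le> 2 * b * (\<alpha> * 2 powr \<alpha>)"
      using assms by (intro mult_left_mono) auto
    then show ?thesis using eq True assms by (simp add: powr_add algebra_simps)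
  qed simp
next
  case False
  have "(1 + b) powr \<alpha> \<le> (1 - b) powr \<alpha> + (2 * b) powr \<alpha>"
    using powr_subadditive[of "1 - b" "2 * b" \<alpha>] assms False by (simp add: add.commute)
  moreover have "(2 * b) powr \<alpha> = 2 powr \<alpha> * b powr \<alpha>" by (simp add: powr_mult)
  moreover have "2 powr \<alpha> * b powr \<alpha> \<le> 2 powr (\<alpha> + 1) * b powr \<alpha>"
    by (intro mult_right_mono) auto
  ultimately show ?thesis using False by simp
qed

text \<open>Both bounds hold with equality at b = 0 and follow by comparing derivatives on [0, 1].
  The factor \<open>min p 2\<close> produced by differentiating the power exceeds 1 and is dropped
  in C.\<close>

lemma powr_sym_sum_bounds:
  fixes p :: real
  assumes p: "1 < p"
  obtains c C where "0 < c" "0 < C"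
    "\<And>b. \<bar>b\<bar> \<le> 1 \<Longrightarrow> 2 + c * b\<^sup>2 \<le> \<bar>1 + b\<bar> powr p + \<bar>1 - b\<bar> powr p"
    "\<And>b. \<bar>b\<bar> \<le> 1 \<Longrightarrow> \<bar>1 + b\<bar> powr p + \<bar>1 - b\<bar> powr p \<le> 2 + C * \<bar>b\<bar> powr min p 2"
proof -
  define s where "s = min p 2"
  define \<alpha> where "\<alpha> = p - 1"
  define c where "c = p * min \<alpha> 1 / 2"
  define C where "C = p * (2 powr (\<alpha> + 1) * max \<alpha> 1)"
  have s: "s - 1 = min \<alpha> 1" "1 < s" and \<alpha>: "\<alpha> > 0" using p by (auto simp: s_def \<alpha>_def)
  have c: "0 < c" "0 < C" using p \<alpha> by (auto simp: c_def C_def)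
  have D: "((\<lambda>b. (1 + b) powr p + (1 - b) powr p) has_real_derivative
        p * ((1 + b) powr \<alpha> - (1 - b) powr \<alpha>)) (at b)" if "0 < b" "b < 1" for b
    unfolding \<alpha>_def using that
    by (auto intro!: derivative_eq_intros has_real_derivative_powr simp: \<alpha>_def algebra_simps)
  have cont: "continuous_on {0..x} (\<lambda>b. (1 + b) powr p + (1 - b) powr p)" if "x \<le> 1" for x
    using p that by (intro continuous_intros continuous_on_powr') auto
  have lo: "2 + c * x\<^sup>2 \<le> (1 + x) powr p + (1 - x) powr p" if "0 \<le> x" "x \<le> 1" for x
  proof -
    have "((1 + 0) powr p + (1 - 0) powr p) - c * 0\<^sup>2 \<le> ((1 + x) powr p + (1 - x) powr p) - c * x\<^sup>2"
    proof (rule DERIV_nonneg_imp_increasing_open[OF that(1)])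
      fix b assume b: "0 < b" "b < x"
      have "((\<lambda>b. ((1 + b) powr p + (1 - b) powr p) - c * b\<^sup>2) has_real_derivative
          p * ((1 + b) powr \<alpha> - (1 - b) powr \<alpha>) - c * (2 * b)) (at b)"
        using b that by (auto intro!: derivative_eq_intros has_real_derivative_powr simp: \<alpha>_def algebra_simps)
      moreover have "p * (min \<alpha> 1 * b) \<le> p * ((1 + b) powr \<alpha> - (1 - b) powr \<alpha>)"
        using powr_sym_diff_lower[of b \<alpha>] b that \<alpha> p by (intro mult_left_mono) auto
      moreover have "c * (2 * b) = p * (min \<alpha> 1 * b)" by (simp add: c_def)
      ultimately show "\<exists>y. ((\<lambda>b. ((1 + b) powr p + (1 - b) powr p) - c * b\<^sup>2) has_real_derivative y) (at b) \<and> 0 \<le> y"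
        by (intro exI conjI) auto
    qed (intro continuous_intros cont that)
    then show ?thesis by simp
  qed
  have hi: "(1 + x) powr p + (1 - x) powr p \<le> 2 + C * x powr s" if "0 \<le> x" "x \<le> 1" for x
  proof -
    have "C * 0 powr s - ((1 + 0) powr p + (1 - 0) powr p) \<le> C * x powr s - ((1 + x) powr p + (1 - x) powr p)"
    proof (rule DERIV_nonneg_imp_increasing_open[OF that(1)])
      fix b assume b: "0 < b" "b < x"
      have "((\<lambda>b. C * b powr s - ((1 + b) powr p + (1 - b) powr p)) has_real_derivative
          C * (s * b powr (s - 1)) - p * ((1 + b) powr \<alpha> - (1 - b) powr \<alpha>)) (at b)"
        using b that by (auto intro!: derivative_eq_intros has_real_derivative_powr simp: \<alpha>_def algebra_simps)
      moreover have "p * ((1 + b) powr \<alpha> - (1 - b) powr \<alpha>) \<le> p * (2 powr (\<alpha> + 1) * max \<alpha> 1 * b powr (s - 1))"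
        using powr_sym_diff_upper[of b \<alpha>] b that \<alpha> p s by (intro mult_left_mono) auto
      moreover have "p * (2 powr (\<alpha> + 1) * max \<alpha> 1 * b powr (s - 1)) \<le> C * (s * b powr (s - 1))"
        using mult_right_mono[of 1 s "C * b powr (s - 1)"] s c p \<alpha> by (simp add: C_def ac_simps zero_le_mult_iff)
      ultimately show "\<exists>y. ((\<lambda>b. C * b powr s - ((1 + b) powr p + (1 - b) powr p)) has_real_derivative y) (at b) \<and> 0 \<le> y"
        by (intro exI conjI) auto
    qed (use s in \<open>intro continuous_intros cont that continuous_on_powr'; auto\<close>)
    then show ?thesis by simp
  qed
  show ?thesis
  proof (rule that[OF c])
    fix b :: real assume b: "\<bar>b\<bar> \<le> 1"
    have "\<bar>1 + b\<bar> powr p + \<bar>1 - b\<bar> powr p = (1 + \<bar>b\<bar>) powr p + (1 - \<bar>b\<bar>) powr p"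
      using b by (cases "b \<ge> 0") auto
    then show "2 + c * b\<^sup>2 \<le> \<bar>1 + b\<bar> powr p + \<bar>1 - b\<bar> powr p"
      "\<bar>1 + b\<bar> powr p + \<bar>1 - b\<bar> powr p \<le> 2 + C * \<bar>b\<bar> powr min p 2"
      using lo[of "\<bar>b\<bar>"] hi[of "\<bar>b\<bar>"] b by (auto simp: s_def)
  qed
qed

text \<open>After division by 2 this says that the map taking (x, y) to 2^(-1/p) (x + \<epsilon> y,
  x - \<epsilon> y) is a contraction from the l^s norm with s = min p 2 to the l^p norm; it makes
  the form differentiable in \<open>form_smooth\<close>.\<close>

lemma two_point_smoothness:
  fixes p :: real
  assumes p: "1 < p"
  obtains \<epsilon> where "0 < \<epsilon>"
    "\<And>x y. \<bar>x + \<epsilon> * y\<bar> powr p + \<bar>x - \<epsilon> * y\<bar> powr p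
       \<le> 2 * (\<bar>x\<bar> powr min p 2 + \<bar>y\<bar> powr min p 2) powr (p / min p 2)"
proof -
  obtain c C where c: "0 < c" and C: "0 < C"
    and lo: "\<And>b. \<bar>b\<bar> \<le> 1 \<Longrightarrow> 2 + c * b\<^sup>2 \<le> \<bar>1 + b\<bar> powr p + \<bar>1 - b\<bar> powr p"
    and hi: "\<And>b. \<bar>b\<bar> \<le> 1 \<Longrightarrow> \<bar>1 + b\<bar> powr p + \<bar>1 - b\<bar> powr p \<le> 2 + C * \<bar>b\<bar> powr min p 2"
    by (rule powr_sym_sum_bounds[OF p]) (rule that)
  define s where "s = min p 2"
  \<comment> \<open>The bound 1/2 keeps \<open>x + \<epsilon> * y\<close> and
    \<open>x - \<epsilon> * y\<close> at most |y| in size when |x| < \<epsilon> |y|; the other entry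
    gives \<open>C * \<epsilon> powr s \<le> 2\<close> for the opposite case.\<close>
  define \<epsilon> where "\<epsilon> = min (1 / 2) ((2 / C) powr (1 / s))"
  have s: "1 < s" "1 \<le> p / s" using p by (auto simp: s_def)
  have \<epsilon>: "0 < \<epsilon>" "\<epsilon> \<le> 1 / 2" using C by (auto simp: \<epsilon>_def)
  have "\<epsilon> powr s \<le> ((2 / C) powr (1 / s)) powr s" using \<epsilon> s by (intro powr_mono2) (auto simp: \<epsilon>_def)
  also have "\<dots> = 2 / C" using s C by (simp add: powr_powr)
  finally have C\<epsilon>: "C * \<epsilon> powr s \<le> 2" using C by (simp add: field_simps)
  show ?thesis
  proof (rule that[OF \<epsilon>(1)])
    fix x y :: real
    show "\<bar>x + \<epsilon> * y\<bar> powr p + \<bar>x - \<epsilon> * y\<bar> powr p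
       \<le> 2 * (\<bar>x\<bar> powr min p 2 + \<bar>y\<bar> powr min p 2) powr (p / min p 2)"
    proof (cases "\<epsilon> * \<bar>y\<bar> \<le> \<bar>x\<bar>")
      case le: True
      show ?thesis
      proof (cases "x = 0")
        case True then show ?thesis using le \<epsilon> by (auto simp: mult_le_0_iff)
      next
        case False
        define b where "b = \<epsilon> * y / x"
        define \<tau> where "\<tau> = (\<bar>y\<bar> / \<bar>x\<bar>) powr s"
        have b1: "\<bar>b\<bar> \<le> 1" using le False \<epsilon> by (simp add: b_def abs_mult)
        have bs: "\<bar>b\<bar> powr s = \<epsilon> powr s * \<tau>" using \<epsilon> by (simp add: b_def \<tau>_def abs_mult powr_mult powr_divide)
        have e: "\<bar>x + \<epsilon> * y\<bar> = \<bar>x\<bar> * \<bar>1 + b\<bar>" "\<bar>x - \<epsilon> * y\<bar> = \<bar>x\<bar> * \<bar>1 - b\<bar>"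
          using False by (simp_all add: abs_mult[symmetric] b_def distrib_left right_diff_distrib)
        have "\<bar>1 + b\<bar> powr p + \<bar>1 - b\<bar> powr p \<le> 2 + C * \<bar>b\<bar> powr s" using hi[OF b1] by (simp add: s_def)
        also have "\<dots> \<le> 2 * (1 + \<tau>)"
          using mult_right_mono[OF C\<epsilon>, of \<tau>] by (simp add: bs \<tau>_def algebra_simps)
        also have "1 + \<tau> \<le> (1 + \<tau>) powr (p / s)"
          using powr_mono[of 1 "p / s" "1 + \<tau>"] s by (simp add: \<tau>_def)
        finally have "\<bar>x\<bar> powr p * (\<bar>1 + b\<bar> powr p + \<bar>1 - b\<bar> powr p) \<le> \<bar>x\<bar> powr p * (2 * (1 + \<tau>) powr (p / s))"
          by (intro mult_left_mono) auto
        also have "\<dots> = 2 * (\<bar>x\<bar> powr s * (1 + \<tau>)) powr (p / s)"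
          using s by (simp add: powr_mult powr_powr)
        also have "\<bar>x\<bar> powr s * (1 + \<tau>) = \<bar>x\<bar> powr s + \<bar>y\<bar> powr s"
          using False by (simp add: \<tau>_def powr_divide algebra_simps)
        finally show ?thesis unfolding e s_def by (simp add: powr_mult algebra_simps)
      qed
    next
      case False
      have *: "\<bar>z\<bar> powr p \<le> (\<bar>y\<bar> powr s + \<bar>x\<bar> powr s) powr (p / s)" if "\<bar>z\<bar> \<le> 2 * (\<epsilon> * \<bar>y\<bar>)" for z
      proof -
        have "\<bar>z\<bar> \<le> \<bar>y\<bar>" using that \<epsilon> mult_right_mono[of \<epsilon> "1/2" "\<bar>y\<bar>"] by simp
        then have "\<bar>z\<bar> powr p \<le> \<bar>y\<bar> powr p" using p by (intro powr_mono2) auto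
        also have "\<dots> = (\<bar>y\<bar> powr s) powr (p / s)" using s by (simp add: powr_powr)
        also have "\<dots> \<le> (\<bar>y\<bar> powr s + \<bar>x\<bar> powr s) powr (p / s)" using s p by (intro powr_mono2) auto
        finally show ?thesis .
      qed
      have "\<bar>\<epsilon> * y\<bar> = \<epsilon> * \<bar>y\<bar>" using \<epsilon> by (simp add: abs_mult)
      then have "\<bar>x + \<epsilon> * y\<bar> \<le> 2 * (\<epsilon> * \<bar>y\<bar>)" "\<bar>x - \<epsilon> * y\<bar> \<le> 2 * (\<epsilon> * \<bar>y\<bar>)"
        using False by linarith+
      from *[OF this(1)] *[OF this(2)] show ?thesis by (simp add: s_def add.commute)
    qed
  qed
qed

text \<open>The counterpart of the smoothness inequality: up to the factor 2^(1/p), a pair is sent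
  contractively from l^p to l^r, with r = max p 2, to its half sum and a small multiple of its half
  difference. It supplies strict convexity in \<open>form_strict\<close>.\<close>

lemma two_point_convexity:
  fixes p :: real
  assumes p: "1 < p"
  obtains \<epsilon> where "0 < \<epsilon>"
    "\<And>a b. (\<bar>a\<bar> powr max p 2 + \<epsilon> * \<bar>b\<bar> powr max p 2) powr (p / max p 2)
       \<le> (\<bar>a + b\<bar> powr p + \<bar>a - b\<bar> powr p) / 2"
proof -
  obtain c C where c: "0 < c" and C: "0 < C"
    and lo: "\<And>b. \<bar>b\<bar> \<le> 1 \<Longrightarrow> 2 + c * b\<^sup>2 \<le> \<bar>1 + b\<bar> powr p + \<bar>1 - b\<bar> powr p"
    and hi: "\<And>b. \<bar>b\<bar> \<le> 1 \<Longrightarrow> \<bar>1 + b\<bar> powr p + \<bar>1 - b\<bar> powr p \<le> 2 + C * \<bar>b\<bar> powr min p 2"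
    by (rule powr_sym_sum_bounds[OF p]) (rule that)
  define r where "r = max p 2"
  \<comment> \<open>The entry c / 2 comes from halving the quadratic bound; \<epsilon> \<le> 1 lets
    a and b be exchanged when |b| > |a|, since this only increases the left-hand side.\<close>
  define \<epsilon> where "\<epsilon> = min 1 (c / 2)"
  have r: "2 \<le> r" "0 < p / r" "p / r \<le> 1" using p by (auto simp: r_def)
  have \<epsilon>: "0 < \<epsilon>" "\<epsilon> \<le> 1" "\<epsilon> \<le> c / 2" using c by (auto simp: \<epsilon>_def)
  have main: "(\<bar>a\<bar> powr r + \<epsilon> * \<bar>b\<bar> powr r) powr (p / r) \<le> (\<bar>a + b\<bar> powr p + \<bar>a - b\<bar> powr p) / 2"
    if ab: "\<bar>b\<bar> \<le> \<bar>a\<bar>" for a b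
  proof (cases "a = 0")
    case True then show ?thesis using ab by simp
  next
    case False
    define t where "t = b / a"
    have t1: "\<bar>t\<bar> \<le> 1" using ab False by (simp add: t_def)
    have e: "\<bar>a + b\<bar> = \<bar>a\<bar> * \<bar>1 + t\<bar>" "\<bar>a - b\<bar> = \<bar>a\<bar> * \<bar>1 - t\<bar>"
      using False by (simp_all add: abs_mult[symmetric] t_def distrib_left right_diff_distrib)
    have "(1 + \<epsilon> * \<bar>t\<bar> powr r) powr (p / r) \<le> 1 + \<epsilon> * \<bar>t\<bar> powr r"
      using powr_mono[of "p / r" 1 "1 + \<epsilon> * \<bar>t\<bar> powr r"] r \<epsilon> by simp
    also have "\<dots> \<le> 1 + \<epsilon> * t\<^sup>2"
      using powr_mono'[of 2 r "\<bar>t\<bar>"] r t1 \<epsilon> by simp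
    also have "1 + \<epsilon> * t\<^sup>2 \<le> 1 + c / 2 * t\<^sup>2" using \<epsilon> by (intro add_left_mono mult_right_mono) auto
    also have "\<dots> \<le> (\<bar>1 + t\<bar> powr p + \<bar>1 - t\<bar> powr p) / 2" using lo[OF t1] by simp
    finally have bd: "(1 + \<epsilon> * \<bar>t\<bar> powr r) powr (p / r) \<le> (\<bar>1 + t\<bar> powr p + \<bar>1 - t\<bar> powr p) / 2" .
    have "\<bar>b\<bar> powr r = \<bar>a\<bar> powr r * \<bar>t\<bar> powr r" using False by (simp add: t_def powr_mult[symmetric])
    then have "(\<bar>a\<bar> powr r + \<epsilon> * \<bar>b\<bar> powr r) powr (p / r) = (\<bar>a\<bar> powr r * (1 + \<epsilon> * \<bar>t\<bar> powr r)) powr (p / r)"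
      by (simp add: algebra_simps)
    also have "\<dots> = \<bar>a\<bar> powr p * (1 + \<epsilon> * \<bar>t\<bar> powr r) powr (p / r)"
      using r by (simp add: powr_mult powr_powr)
    also have "\<dots> \<le> \<bar>a\<bar> powr p * ((\<bar>1 + t\<bar> powr p + \<bar>1 - t\<bar> powr p) / 2)"
      by (intro mult_left_mono bd) auto
    finally show ?thesis unfolding e by (simp add: powr_mult algebra_simps)
  qed
  show ?thesis
  proof (rule that[OF \<epsilon>(1)])
    fix a b :: real
    show "(\<bar>a\<bar> powr max p 2 + \<epsilon> * \<bar>b\<bar> powr max p 2) powr (p / max p 2)
       \<le> (\<bar>a + b\<bar> powr p + \<bar>a - b\<bar> powr p) / 2"
    proof (cases "\<bar>b\<bar> \<le> \<bar>a\<bar>")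
      case True then show ?thesis using main by (simp add: r_def)
    next
      case False
      have "\<bar>a\<bar> powr r \<le> \<bar>b\<bar> powr r" using False r by (intro powr_mono2) auto
      then have "0 \<le> (1 - \<epsilon>) * (\<bar>b\<bar> powr r - \<bar>a\<bar> powr r)" using \<epsilon> by simp
      then have "\<bar>a\<bar> powr r + \<epsilon> * \<bar>b\<bar> powr r \<le> \<bar>b\<bar> powr r + \<epsilon> * \<bar>a\<bar> powr r" by (simp add: algebra_simps)
      then have "(\<bar>a\<bar> powr r + \<epsilon> * \<bar>b\<bar> powr r) powr (p / r) \<le> (\<bar>b\<bar> powr r + \<epsilon> * \<bar>a\<bar> powr r) powr (p / r)"
        using r \<epsilon> by (intro powr_mono2) auto
      also have "\<dots> \<le> (\<bar>b + a\<bar> powr p + \<bar>b - a\<bar> powr p) / 2" using main[of a b] False by simp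
      finally show ?thesis by (simp add: r_def abs_minus_commute add.commute)
    qed
  qed
qed

lemma powr_convex_nonneg:
  fixes p :: real
  assumes "1 \<le> p"
  shows "convex_on {0..} (\<lambda>x. x powr p)"
proof (rule convex_onI)
  fix t a b :: real assume t: "0 < t" "t < 1" and ab: "a \<in> {0..}" "b \<in> {0..}"
  have tp: "t powr p \<le> t" "(1 - t) powr p \<le> 1 - t" using t assms powr_le_one_le by auto
  consider "a = 0" | "b = 0" | "0 < a" "0 < b" using ab by force
  then show "((1 - t) *\<^sub>R a + t *\<^sub>R b) powr p \<le> (1 - t) * a powr p + t * b powr p"
  proof cases
    case 3
    then show ?thesis using convex_onD[OF powr_convex[OF assms], of t a b] t by simp
  qed (use tp in \<open>auto simp: powr_mult mult_right_mono\<close>)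
qed simp

text \<open>If the two pairs are ordered alike, nothing changes. If they are ordered oppositely,
  sorting replaces the two differences by numbers with the same sum lying between them, and
  convexity decreases the sum of powers. So (min, max) is admissible in the contraction
  property.\<close>

lemma min_max_powr_contraction:
  fixes x y x' y' p :: real
  assumes p: "1 < p"
  shows "\<bar>min x y - min x' y'\<bar> powr p + \<bar>max x y - max x' y'\<bar> powr p
    \<le> \<bar>x - x'\<bar> powr p + \<bar>y - y'\<bar> powr p"
proof -
  have cvx: "convex_on UNIV (\<lambda>t::real. \<bar>t\<bar> powr p)"
  proof (rule convex_onI)
    fix t a b :: real assume t: "0 < t" "t < 1"
    have "\<bar>(1 - t) * a + t * b\<bar> powr p \<le> ((1 - t) * \<bar>a\<bar> + t * \<bar>b\<bar>) powr p"
      using t p abs_triangle_ineq[of "(1 - t) * a" "t * b"] by (intro powr_mono2) (auto simp: abs_mult)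
    also have "\<dots> \<le> (1 - t) * \<bar>a\<bar> powr p + t * \<bar>b\<bar> powr p"
      using convex_onD[OF powr_convex_nonneg[of p], of t "\<bar>a\<bar>" "\<bar>b\<bar>"] t p by simp
    finally show "\<bar>(1 - t) *\<^sub>R a + t *\<^sub>R b\<bar> powr p \<le> (1 - t) * \<bar>a\<bar> powr p + t * \<bar>b\<bar> powr p" by simp
  qed simp
  have key: "\<bar>u\<bar> powr p + \<bar>w\<bar> powr p \<le> \<bar>a\<bar> powr p + \<bar>b\<bar> powr p"
    if ab: "a \<le> u" "u \<le> b" "u + w = a + b" for a b u w :: real
  proof (cases "a = b")
    case True then show ?thesis using that by simp
  next
    case False
    define t where "t = (u - a) / (b - a)"
    have t: "0 \<le> t" "t \<le> 1" using ab False by (auto simp: t_def)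
    have "t * (b - a) = u - a" using False by (simp add: t_def)
    then have u: "u = (1 - t) * a + t * b" and w: "w = (1 - t) * b + t * a"
      using ab by (auto simp: algebra_simps)
    have "\<bar>u\<bar> powr p \<le> (1 - t) * \<bar>a\<bar> powr p + t * \<bar>b\<bar> powr p"
      using convex_onD[OF cvx t, of a b] by (simp add: u)
    moreover have "\<bar>w\<bar> powr p \<le> (1 - t) * \<bar>b\<bar> powr p + t * \<bar>a\<bar> powr p"
      using convex_onD[OF cvx t, of b a] by (simp add: w)
    ultimately show ?thesis by (simp add: algebra_simps)
  qed
  consider "x \<le> y" "x' \<le> y'" | "x \<le> y" "y' \<le> x'" | "y \<le> x" "x' \<le> y'" | "y \<le> x" "y' \<le> x'" by linarith
  then show ?thesis
  proof cases
    case 2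
    then show ?thesis using key[of "x - x'" "x - y'" "y - y'" "y - x'"] by (simp add: min_absorb1 min_absorb2 max_absorb1 max_absorb2)
  next
    case 3
    then show ?thesis using key[of "y - y'" "y - x'" "x - x'" "x - y'"] by (simp add: min_absorb1 min_absorb2 max_absorb1 max_absorb2)
  qed (auto simp: min_def max_def)
qed

section \<open>Forms on three vertices\<close>

text \<open>Triples list the values at the three vertices. \<open>E_strict\<close> is strict
  convexity modulo constants. \<open>E_smooth\<close> bounds second differences by a power s > 1 of
  the step, which together with convexity means differentiability along every line.
  \<open>E_bound\<close> for one pair covers all pairs because the two transpositions generate every
  permutation.\<close>

locale vertex_form =
  fixes p :: real and E :: "real \<times> real \<times> real \<Rightarrow> real"
  assumes p_gt_1: "1 < p"
    and E_nonneg: "0 \<le> E x"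
    and E_scale: "E (c *\<^sub>R x) = \<bar>c\<bar> powr p * E x"
    and E_convex: "convex_on UNIV E"
    and E_shift: "E (x + (c, c, c)) = E x"
    and E_bound: "\<exists>C. \<forall>x y z. \<bar>x - y\<bar> powr p \<le> C * E (x, y, z)"
    and E_strict: "E (x - y) \<noteq> 0 \<Longrightarrow> E ((1 / 2) *\<^sub>R (x + y)) < (E x + E y) / 2"
    and E_smooth: "\<exists>M s. 1 < s \<and>
      (\<forall>t\<in>{0..1}. E (x + t *\<^sub>R y) + E (x - t *\<^sub>R y) \<le> 2 * E x + M * t powr s)"
    and E_submodular: "E (min x1 y1, min x2 y2, min x3 y3) + E (max x1 y1, max x2 y2, max x3 y3)
      \<le> E (x1, x2, x3) + E (y1, y2, y3)"
    and E_swap12: "E (x2, x1, x3) = E (x1, x2, x3)"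
    and E_swap23: "E (x1, x3, x2) = E (x1, x2, x3)"
begin

lemma E_swap13: "E (x3, x2, x1) = E (x1, x2, x3)"
  by (metis E_swap12 E_swap23)

lemma E_const [simp]: "E (c, c, c) = 0"
  using E_shift[of 0 c] E_scale[of 0 0] p_gt_1 by (simp add: zero_prod_def)

lemma E_zero_iff: "E (x, y, z) = 0 \<longleftrightarrow> x = y \<and> y = z"
proof
  assume *: "E (x, y, z) = 0"
  obtain C where C: "\<And>x y z. \<bar>x - y\<bar> powr p \<le> C * E (x, y, z)" using E_bound by blast
  have "E (y, z, x) = 0" using * by (metis E_swap12 E_swap23)
  then have "\<bar>x - y\<bar> powr p \<le> 0" "\<bar>y - z\<bar> powr p \<le> 0"
    using C[of x y z] C[of y z x] * by simp_all
  then show "x = y \<and> y = z" by simp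
qed auto

lemma E_minus: "E (- x) = E x"
  using E_scale[of "-1" x] by simp

lemma continuous_E: "continuous_on UNIV E"
  by (rule convex_on_continuous[OF open_UNIV E_convex])

lemma tendsto_E: "(f \<longlongrightarrow> l) F \<Longrightarrow> ((\<lambda>n. E (f n)) \<longlongrightarrow> E l) F"
  by (rule continuous_on_tendsto_compose[OF continuous_E]) auto

section \<open>Directional derivatives of the energy\<close>

definition D :: "real \<times> real \<times> real \<Rightarrow> real \<times> real \<times> real \<Rightarrow> real" where
  "D x y = deriv (\<lambda>t. E (x + t *\<^sub>R y)) 0"

lemma D_unique: "((\<lambda>t. E (x + t *\<^sub>R y)) has_real_derivative d) (at 0) \<Longrightarrow> D x y = d"
  unfolding D_def by (rule DERIV_imp_deriv)

text \<open>By convexity all right-hand slopes at x lie above all left-hand ones; R is the infimum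
  of the former. By \<open>E_smooth\<close> the slopes for t and - t differ by at most
  \<open>M * t powr (s - 1)\<close>, which tends to 0 because s > 1, so R is a two-sided
  derivative.\<close>

lemma D_properties:
  shows has_derivative_D: "((\<lambda>t. E (x + t *\<^sub>R y)) has_real_derivative D x y) (at 0)"
    and D_le_slope: "0 < t \<Longrightarrow> D x y \<le> (E (x + t *\<^sub>R y) - E x) / t"
proof -
  define f where "f t = E (x + t *\<^sub>R y)" for t
  define R where "R = (INF t\<in>{0<..}. (f t - f 0) / t)"
  have slope: "(f 0 - f (- t')) / t' \<le> (f t - f 0) / t" if t: "0 < t" "0 < t'" for t t'
  proof -
    define k where "k = t' / (t + t')"
    have k: "0 \<le> k" "k \<le> 1" using t by (auto simp: k_def)
    have "(1 - k) * (- t') + k * t = 0" using t by (simp add: k_def field_simps)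
    then have "(1 - k) *\<^sub>R (x + (- t') *\<^sub>R y) + k *\<^sub>R (x + t *\<^sub>R y) = x"
      by (simp add: algebra_simps flip: scaleR_add_left)
    then have "f 0 \<le> (1 - k) * f (- t') + k * f t"
      using convex_onD[OF E_convex k, of "x + (- t') *\<^sub>R y" "x + t *\<^sub>R y"] by (simp add: f_def)
    then have "(t + t') * f 0 \<le> (t + t') * ((1 - k) * f (- t') + k * f t)"
      using t by (intro mult_left_mono) auto
    also have "\<dots> = ((t + t') * (1 - k)) * f (- t') + ((t + t') * k) * f t" by (simp add: algebra_simps)
    also have "(t + t') * (1 - k) = t" using t by (simp add: k_def field_simps)
    also have "(t + t') * k = t'" using t by (simp add: k_def field_simps)
    finally show ?thesis using t by (simp add: field_simps)
  qed
  have bdd: "bdd_below ((\<lambda>t. (f t - f 0) / t) ` {0<..})"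
    by (rule bdd_belowI2[of _ "(f 0 - f (-1)) / 1"]) (use slope[of _ 1] in auto)
  have R_le: "R \<le> (f t - f 0) / t" if "0 < t" for t
    unfolding R_def using that by (intro cINF_lower bdd) auto
  have R_ge: "(f 0 - f (- t)) / t \<le> R" if "0 < t" for t
    unfolding R_def using that slope by (intro cINF_greatest) auto
  obtain M s where s: "1 < s"
    and *: "\<forall>t\<in>{0..1}. E (x + t *\<^sub>R y) + E (x - t *\<^sub>R y) \<le> 2 * E x + M * t powr s"
    using E_smooth[of x y] by blast
  have M: "f t + f (- t) \<le> 2 * f 0 + M * t powr s" if "0 \<le> t" "t \<le> 1" for t
    using * that by (simp add: f_def)
  have near: "norm ((f h - f 0) / h - R) \<le> M * \<bar>h\<bar> powr (s - 1)" if h: "\<bar>h\<bar> \<le> 1" "h \<noteq> 0" for h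
  proof -
    define t where "t = \<bar>h\<bar>"
    have t: "0 < t" "t \<le> 1" using h by (auto simp: t_def)
    have "(f t - f 0) / t - (f 0 - f (- t)) / t = (f t + f (- t) - 2 * f 0) / t"
      by (simp add: diff_divide_distrib add_divide_distrib)
    also have "\<dots> \<le> M * t powr s / t" using M[of t] t by (intro divide_right_mono) auto
    also have "\<dots> = M * t powr (s - 1)" using t by (simp add: powr_diff)
    finally have "(f t - f 0) / t - (f 0 - f (- t)) / t \<le> M * t powr (s - 1)" .
    moreover have "(f h - f 0) / h = (f t - f 0) / t \<or> (f h - f 0) / h = (f 0 - f (- t)) / t"
      using h minus_divide_divide[of "f h - f 0" h] by (cases "h > 0") (simp_all add: t_def)
    ultimately show ?thesis using R_le[OF t(1)] R_ge[OF t(1)] by (auto simp: t_def[symmetric])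
  qed
  have "((\<lambda>h. M * \<bar>h\<bar> powr (s - 1)) \<longlongrightarrow> M * 0) (at 0)"
    by (intro tendsto_mult tendsto_const tendsto_zero_powrI[where b = "s - 1"])
       (use s in \<open>auto intro!: tendsto_eq_intros\<close>)
  then have "((\<lambda>h. M * \<bar>h\<bar> powr (s - 1)) \<longlongrightarrow> 0) (at 0)" by simp
  then have "((\<lambda>h. (f h - f 0) / h - R) \<longlongrightarrow> 0) (at 0)"
    by (rule Lim_null_comparison[rotated, where g = "\<lambda>h. M * \<bar>h\<bar> powr (s - 1)"])
       (rule eventually_at[THEN iffD2], rule exI[of _ 1], use near in simp)
  then have A: "(f has_real_derivative R) (at 0)"
    by (simp add: has_field_derivative_iff LIM_zero_iff)
  then have "D x y = R" unfolding D_def f_def[symmetric] by (rule DERIV_imp_deriv)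
  then show "((\<lambda>t. E (x + t *\<^sub>R y)) has_real_derivative D x y) (at 0)"
    "0 < t \<Longrightarrow> D x y \<le> (E (x + t *\<^sub>R y) - E x) / t"
    using A R_le[of t] by (simp_all add: f_def[symmetric]) (simp add: f_def)
qed

lemma gradient_inequality: "E x + D x y \<le> E (x + y)"
  using D_le_slope[of 1 x y] by simp

lemma D_eqI: 
  assumes "\<And>t. E (x + t *\<^sub>R y) = c * E (x' + t *\<^sub>R y')"
  shows "D x y = c * D x' y'"
  using assms has_derivative_D[of x' y'] by (intro D_unique) (auto intro!: derivative_eq_intros)

lemma D_scale_dir: "D x (c *\<^sub>R y) = c * D x y"
proof -
  have "((\<lambda>t. E (x + (c * t) *\<^sub>R y)) has_real_derivative D x y * c) (at 0)"
    by (rule DERIV_chain2[where f = "\<lambda>s. E (x + s *\<^sub>R y)"])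
       (use has_derivative_D[of x y] in \<open>auto intro!: derivative_eq_intros\<close>)
  then show ?thesis by (intro D_unique) (simp add: mult.commute)
qed

lemma D_minus_dir: "D x (- y) = - D x y"
  using D_scale_dir[of x "-1" y] by simp

text \<open>Midpoint convexity says that g has its minimum 0 at 0, so its derivative vanishes there.
  Differentiability along lines thus already yields linearity in the direction.\<close>

lemma D_add_dir: "D x (y + z) = D x y + D x z"
proof -
  define g where "g t = (E (x + t *\<^sub>R (2 *\<^sub>R y)) + E (x + t *\<^sub>R (2 *\<^sub>R z))) / 2 - E (x + t *\<^sub>R (y + z))" for t
  have "(g has_real_derivative ((D x (2 *\<^sub>R y) + D x (2 *\<^sub>R z)) / 2 - D x (y + z))) (at 0)"
    unfolding g_def by (intro DERIV_diff DERIV_cdivide DERIV_add has_derivative_D)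
  then have "(D x (2 *\<^sub>R y) + D x (2 *\<^sub>R z)) / 2 - D x (y + z) = 0"
  proof (rule DERIV_local_min[of _ _ _ 1])
    show "\<forall>t. \<bar>0 - t\<bar> < 1 \<longrightarrow> g 0 \<le> g t"
    proof safe
      fix t :: real
      have "E (x + t *\<^sub>R (y + z)) \<le> (1 - 1/2) * E (x + t *\<^sub>R (2 *\<^sub>R y)) + 1/2 * E (x + t *\<^sub>R (2 *\<^sub>R z))"
        using convex_onD[OF E_convex, of "1/2" "x + t *\<^sub>R (2 *\<^sub>R y)" "x + t *\<^sub>R (2 *\<^sub>R z)"]
        by (simp add: algebra_simps flip: scaleR_add_left)
      then show "g 0 \<le> g t" by (simp add: g_def)
    qed
  qed simp
  then show ?thesis by (simp add: D_scale_dir)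
qed

lemma D_coords: "D x (a, b, c) = a * D x (1, 0, 0) + b * D x (0, 1, 0) + c * D x (0, 0, 1)"
proof -
  have "(a, b, c) = a *\<^sub>R (1, 0, 0) + b *\<^sub>R (0, 1, 0) + c *\<^sub>R (0, 0, 1 :: real)" by simp
  then show ?thesis by (simp only: D_add_dir D_scale_dir)
qed

lemma D_const_dir: "D x (c, c, c) = 0"
  using E_shift[of x] by (intro D_unique) simp

lemma D_sum: "D x (1, 0, 0) + D x (0, 1, 0) + D x (0, 0, 1) = 0"
  using D_coords[of x 1 1 1] D_const_dir[of x 1] by simp

lemma D_shift: "D (x + (c, c, c)) y = D x y"
  using D_eqI[of "x + (c, c, c)" y 1 x y] E_shift[of "x + _ *\<^sub>R y" c] by (simp add: algebra_simps)

lemma D_scale: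
  assumes "0 < c"
  shows "D (c *\<^sub>R x) y = c powr (p - 1) * D x y"
proof -
  have "D (c *\<^sub>R x) y = c powr p * D x ((1 / c) *\<^sub>R y)"
    using assms E_scale[of c "x + _ *\<^sub>R (1 / c) *\<^sub>R y"] by (intro D_eqI) (simp add: algebra_simps)
  then show ?thesis using assms by (simp add: D_scale_dir powr_diff)
qed

lemma D_minus: "D (- x) y = - D x y"
  using D_eqI[of "- x" y 1 x "- y"] E_minus[of "x - _ *\<^sub>R y"] by (simp add: D_minus_dir algebra_simps)

text \<open>Euler's identity for a function homogeneous of degree p. It is what converts fluxes into
  energies.\<close>

lemma D_self: "D x x = p * E x"
proof (rule D_unique)
  have "((\<lambda>t. (1 + t) powr p * E x) has_real_derivative p * E x) (at 0)"
    by (auto intro!: derivative_eq_intros has_real_derivative_powr)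
  then show "((\<lambda>t. E (x + t *\<^sub>R x)) has_real_derivative p * E x) (at 0)"
  proof (rule DERIV_cong_ev[THEN iffD1, rotated -1, OF _ refl _ refl])
    have "\<forall>\<^sub>F t in nhds 0. (t::real) \<in> {-1<..<1}" by (intro eventually_nhds_in_open) auto
    then show "\<forall>\<^sub>F t in nhds 0. (1 + t) powr p * E x = E (x + t *\<^sub>R x)"
    proof eventually_elim
      case (elim t)
      then show ?case using E_scale[of "1 + t" x] by (simp add: scaleR_add_left)
    qed
  qed
qed

lemma D_swap12: "D (x2, x1, x3) (y2, y1, y3) = D (x1, x2, x3) (y1, y2, y3)"
  using D_eqI[of "(x2, x1, x3)" "(y2, y1, y3)" 1 "(x1, x2, x3)" "(y1, y2, y3)"] by (simp add: E_swap12)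

lemma D_swap23: "D (x1, x3, x2) (y1, y3, y2) = D (x1, x2, x3) (y1, y2, y3)"
  using D_eqI[of "(x1, x3, x2)" "(y1, y3, y2)" 1 "(x1, x2, x3)" "(y1, y2, y3)"] by (simp add: E_swap23)

lemma D_swap13: "D (x3, x2, x1) (y3, y2, y1) = D (x1, x2, x3) (y1, y2, y3)"
  using D_eqI[of "(x3, x2, x1)" "(y3, y2, y1)" 1 "(x1, x2, x3)" "(y1, y2, y3)"] by (simp add: E_swap13)

lemma D_const [simp]: "D (c, c, c) y = 0"
proof -
  have "D (c, c, c) y = D 0 y" using D_shift[of 0 c y] by (simp add: zero_prod_def)
  moreover have "D 0 y = - D 0 y" using D_minus[of 0 y] by simp
  ultimately show ?thesis by simp
qed

text \<open>By convexity \<open>D x y\<close> is the infimum of the right-hand slopes, each of which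
  is continuous in x. Applied to y and - y, this gives continuity in
  \<open>tendsto_D\<close>.\<close>

lemma D_upper_semicontinuous:
  assumes X: "X \<longlonglongrightarrow> x" and "D x y < b"
  shows "\<forall>\<^sub>F n in sequentially. D (X n) y < b"
proof -
  have "((\<lambda>t. (E (x + t *\<^sub>R y) - E x) / t) \<longlongrightarrow> D x y) (at_right 0)"
    using has_derivative_D[of x y] by (simp add: has_field_derivative_iff filterlim_at_split)
  then have "\<forall>\<^sub>F t in at_right 0. (E (x + t *\<^sub>R y) - E x) / t < b \<and> 0 < t"
    using assms(2) by (intro eventually_conj order_tendstoD(2)) (auto simp: eventually_at_right_less)
  then obtain t where t: "0 < t" "(E (x + t *\<^sub>R y) - E x) / t < b"
    using eventually_happens[of _ "at_right (0::real)"] by (auto simp: trivial_limit_at_right_real)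
  have "(\<lambda>n. (E (X n + t *\<^sub>R y) - E (X n)) / t) \<longlonglongrightarrow> (E (x + t *\<^sub>R y) - E x) / t"
    using t by (intro tendsto_intros tendsto_E X) auto
  then have "\<forall>\<^sub>F n in sequentially. (E (X n + t *\<^sub>R y) - E (X n)) / t < b"
    using t(2) by (rule order_tendstoD)
  then show ?thesis by (rule eventually_mono) (rule le_less_trans[OF D_le_slope[OF t(1)]])
qed

lemma tendsto_D:
  assumes "X \<longlonglongrightarrow> x"
  shows "(\<lambda>n. D (X n) y) \<longlonglongrightarrow> D x y"
proof (rule order_tendstoI)
  fix b assume "D x y < b"
  then show "\<forall>\<^sub>F n in sequentially. D (X n) y < b" by (rule D_upper_semicontinuous[OF assms])
next
  fix b assume "b < D x y"
  then have "\<forall>\<^sub>F n in sequentially. D (X n) (- y) < - b"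
    by (intro D_upper_semicontinuous[OF assms]) (simp add: D_minus_dir)
  then show "\<forall>\<^sub>F n in sequentially. b < D (X n) y" by eventually_elim (simp add: D_minus_dir)
qed

text \<open>The first coordinate minimizes the energy, and so does its mirror image
  \<open>x2 + x3 - x1\<close>; by strict convexity they agree.\<close>

lemma D1_zero:
  assumes "D (x1, x2, x3) (1, 0, 0) = 0"
  shows "x1 = (x2 + x3) / 2"
proof (rule ccontr)
  assume ne: "x1 \<noteq> (x2 + x3) / 2"
  define s where "s = x2 + x3"
  have "E (s - x1, x2, x3) = E (- (x1, x3, x2) + (s, s, s))" by (simp add: s_def)
  also have "\<dots> = E (x1, x2, x3)" by (simp only: E_shift E_minus E_swap23)
  finally have same: "E (s - x1, x2, x3) = E (x1, x2, x3)" .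
  have "(x1, x2, x3) - (s - x1, x2, x3) = (2 * x1 - s, 0, 0)" by (simp add: zero_prod_def)
  moreover have "E (2 * x1 - s, 0, 0) \<noteq> 0" using ne by (simp add: E_zero_iff s_def field_simps)
  ultimately have "E ((x1, x2, x3) - (s - x1, x2, x3)) \<noteq> 0" by metis
  from E_strict[OF this] have "E (s / 2, x2, x3) < E (x1, x2, x3)" by (simp add: same)
  moreover have "E (x1, x2, x3) \<le> E ((x1, x2, x3) + (s / 2 - x1) *\<^sub>R (1, 0, 0))"
    using gradient_inequality[of "(x1, x2, x3)" "(s / 2 - x1) *\<^sub>R (1, 0, 0)"] assms
    by (simp only: D_scale_dir)
  ultimately show False by simp
qed

end

section \<open>Harmonic extension\<close>

text \<open>The last two axioms say that E is the trace on the three vertices of the level-1 energy,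
  with a, b, c the values at the midpoints of the sides 12, 13, 23. The infimum is expressed by
  approximation; that it is attained is \<open>minimizer_exists\<close>.\<close>

locale renorm_form = vertex_form +
  fixes \<rho> :: real
  assumes rho_pos: "0 < \<rho>"
    and renorm_le: "E (x1, x2, x3) \<le> \<rho> * (E (x1, a, b) + E (a, x2, c) + E (b, c, x3))"
    and renorm_approx: "0 < \<epsilon> \<Longrightarrow>
      \<exists>a b c. \<rho> * (E (x1, a, b) + E (a, x2, c) + E (b, c, x3)) < E (x1, x2, x3) + \<epsilon>"
begin

text \<open>The second argument lists the values at the midpoints opposite to the vertices 3, 2, 1.\<close>

definition total :: "real \<times> real \<times> real \<Rightarrow> real \<times> real \<times> real \<Rightarrow> real" where
  "total x m = (case x of (x1, x2, x3) \<Rightarrow> case m of (a, b, c) \<Rightarrow>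
     E (x1, a, b) + E (a, x2, c) + E (b, c, x3))"

lemma total_simp [simp]: "total (x1, x2, x3) (a, b, c) = E (x1, a, b) + E (a, x2, c) + E (b, c, x3)"
  by (simp add: total_def)

lemma E_le_total: "E x \<le> \<rho> * total x m"
  by (cases x; cases m) (simp add: renorm_le)

lemma E_oscillation:
  obtains C where "0 < C" "\<And>x y z L. E (x, y, z) \<le> L \<Longrightarrow>
    \<bar>x - y\<bar> \<le> (C * L) powr (1 / p) \<and> \<bar>x - z\<bar> \<le> (C * L) powr (1 / p) \<and> \<bar>y - z\<bar> \<le> (C * L) powr (1 / p)"
proof -
  obtain C where C: "\<And>x y z. \<bar>x - y\<bar> powr p \<le> C * E (x, y, z)" using E_bound by blast
  define C' where "C' = max 1 C"
  have C': "0 < C'" by (simp add: C'_def)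
  have *: "\<bar>x - y\<bar> \<le> (C' * L) powr (1 / p)" if "E (x, y, z) \<le> L" for x y z L
  proof -
    have "\<bar>x - y\<bar> powr p \<le> C * E (x, y, z)" by (rule C)
    also have "\<dots> \<le> C' * E (x, y, z)" by (intro mult_right_mono E_nonneg) (simp add: C'_def)
    also have "\<dots> \<le> C' * L" using that C' by simp
    finally have "(\<bar>x - y\<bar> powr p) powr (1 / p) \<le> (C' * L) powr (1 / p)"
      using p_gt_1 by (intro powr_mono2) auto
    then show ?thesis using p_gt_1 by (simp add: powr_powr)
  qed
  show ?thesis
    using *[of _ _ _] *[of _ "_" _] by (intro that[OF C']) (metis E_swap12 E_swap23 *)
qed

lemma continuous_total: "continuous_on UNIV (total x)"
proof (cases x)
  case (fields x1 x2 x3)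
  have "total x = (\<lambda>m. E (x1, fst m, fst (snd m)) + E (fst m, x2, snd (snd m)) + E (fst (snd m), snd (snd m), x3))"
    by (auto simp: fields total_def split: prod.splits)
  moreover have cE: "continuous_on UNIV (\<lambda>m. E (f m))" if "continuous_on UNIV f" for f :: "real \<times> real \<times> real \<Rightarrow> _"
    using continuous_on_compose2[OF continuous_E that] by simp
  ultimately show ?thesis by (simp only:) (intro continuous_on_add cE; intro continuous_intros)
qed

lemma tendsto_total:
  assumes "(f \<longlongrightarrow> x) F" "(g \<longlongrightarrow> m) F"
  shows "((\<lambda>n. total (f n) (g n)) \<longlongrightarrow> total x m) F"
proof -
  have *: "total x m = E (fst x, fst m, fst (snd m)) + E (fst m, fst (snd x), snd (snd m)) + E (fst (snd m), snd (snd m), snd (snd x))" for x m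
    by (auto simp: total_def split: prod.splits)
  show ?thesis unfolding * by (intro tendsto_intros tendsto_E assms)
qed

lemma total_bound:
  obtains C where "0 < C" "\<And>x1 x2 x3 a b c L. \<rho> * total (x1, x2, x3) (a, b, c) \<le> L \<Longrightarrow>
    \<bar>x1 - a\<bar> \<le> (C * L) powr (1 / p) \<and> \<bar>x1 - b\<bar> \<le> (C * L) powr (1 / p) \<and> \<bar>x2 - c\<bar> \<le> (C * L) powr (1 / p)"
proof -
  obtain C where C: "0 < C" and osc: "\<And>x y z L. E (x, y, z) \<le> L \<Longrightarrow>
    \<bar>x - y\<bar> \<le> (C * L) powr (1 / p) \<and> \<bar>x - z\<bar> \<le> (C * L) powr (1 / p) \<and> \<bar>y - z\<bar> \<le> (C * L) powr (1 / p)"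
    by (rule E_oscillation) (rule that)
  show ?thesis
  proof (rule that)
    show "0 < C / \<rho>" using C rho_pos by simp
    fix x1 x2 x3 a b c L assume L: "\<rho> * total (x1, x2, x3) (a, b, c) \<le> L"
    then have "total (x1, x2, x3) (a, b, c) \<le> L / \<rho>" using rho_pos by (simp add: field_simps)
    then have "E (x1, a, b) \<le> L / \<rho>" "E (a, x2, c) \<le> L / \<rho>"
      using E_nonneg[of "(x1, a, b)"] E_nonneg[of "(a, x2, c)"] E_nonneg[of "(b, c, x3)"]
      by (auto simp: total_def)
    from osc[OF this(1)] osc[OF this(2)] show "\<bar>x1 - a\<bar> \<le> (C / \<rho> * L) powr (1 / p) \<and>
      \<bar>x1 - b\<bar> \<le> (C / \<rho> * L) powr (1 / p) \<and> \<bar>x2 - c\<bar> \<le> (C / \<rho> * L) powr (1 / p)"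
      by simp
  qed
qed

lemma norm_triple_le: "norm (a, b, c) \<le> \<bar>a\<bar> + (\<bar>b\<bar> + \<bar>c\<bar>)" for a b c :: real
  using norm_Pair_le[of a "(b, c)"] norm_Pair_le[of b c] by simp

text \<open>Direct method: a bound on the energy controls the distance of each midpoint value from a
  boundary value, so sublevel sets are compact.\<close>

lemma minimizer_exists: "\<exists>m. \<rho> * total x m = E x"
proof -
  obtain x1 x2 x3 where x: "x = (x1, x2, x3)" by (cases x)
  obtain C where C: "\<And>a b c L. \<rho> * total (x1, x2, x3) (a, b, c) \<le> L \<Longrightarrow>
    \<bar>x1 - a\<bar> \<le> (C * L) powr (1 / p) \<and> \<bar>x1 - b\<bar> \<le> (C * L) powr (1 / p) \<and> \<bar>x2 - c\<bar> \<le> (C * L) powr (1 / p)"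
    by (rule total_bound) (rule that)
  define S where "S = {m. \<rho> * total x m \<le> E x + 1}"
  define R where "R = (C * (E x + 1)) powr (1 / p)"
  have "norm m \<le> (\<bar>x1\<bar> + R) + ((\<bar>x1\<bar> + R) + (\<bar>x2\<bar> + R))" if "m \<in> S" for m
  proof -
    obtain a b c where m: "m = (a, b, c)" by (cases m)
    have "\<bar>x1 - a\<bar> \<le> R \<and> \<bar>x1 - b\<bar> \<le> R \<and> \<bar>x2 - c\<bar> \<le> R"
      using C[of a b c "E x + 1"] that by (simp add: S_def m x R_def)
    then show ?thesis using norm_triple_le[of a b c] unfolding m by linarith
  qed
  then have "bounded S" by (rule boundedI)
  moreover have "closed S" unfolding S_def
    by (intro closed_Collect_le continuous_intros continuous_total)
  ultimately have cS: "compact S" by (simp add: compact_eq_bounded_closed)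
  have approx: "\<exists>m. \<rho> * total x m < E x + \<epsilon>" if "0 < \<epsilon>" for \<epsilon>
  proof -
    obtain a b c where "\<rho> * (E (x1, a, b) + E (a, x2, c) + E (b, c, x3)) < E (x1, x2, x3) + \<epsilon>"
      using renorm_approx[OF \<open>0 < \<epsilon>\<close>] by blast
    then show ?thesis unfolding x by (intro exI[of _ "(a, b, c)"]) simp
  qed
  from approx[of 1] obtain m where "\<rho> * total x m < E x + 1" by auto
  then have "m \<in> S" by (simp add: S_def)
  then have "S \<noteq> {}" by auto
  with cS obtain m where m: "m \<in> S" "\<And>m'. m' \<in> S \<Longrightarrow> total x m \<le> total x m'"
    using continuous_attains_inf[of S "total x"] continuous_on_subset[OF continuous_total] by blast
  have "\<rho> * total x m \<le> E x + \<epsilon>" if "0 < \<epsilon>" for \<epsilon>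
  proof -
    obtain m' where m': "\<rho> * total x m' < E x + min 1 \<epsilon>" using approx[of "min 1 \<epsilon>"] \<open>0 < \<epsilon>\<close> by auto
    then have "total x m \<le> total x m'" by (intro m) (auto simp: S_def)
    then have "\<rho> * total x m \<le> \<rho> * total x m'" using rho_pos by simp
    then show ?thesis using m' by simp
  qed
  then have "\<rho> * total x m \<le> E x" by (rule field_le_epsilon)
  then show ?thesis using E_le_total[of x m] by (intro exI[of _ m]) simp
qed

text \<open>Each cell contains one vertex with prescribed value, so two different choices of
  midpoint values differ by a nonconstant triple on cell 1 or on cell 2; there strict convexity
  makes their average strictly better.\<close>

lemma minimizer_unique:
  assumes "\<rho> * total x m \<le> E x" "\<rho> * total x m' \<le> E x"
  shows "m = m'"
proof (rule ccontr)
  assume ne: "m \<noteq> m'"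
  obtain x1 x2 x3 a b c a' b' c' where [simp]: "x = (x1, x2, x3)" "m = (a, b, c)" "m' = (a', b', c')"
    by (cases x, cases m, cases m') auto
  have le: "E ((1 / 2) *\<^sub>R (u + v)) \<le> (E u + E v) / 2" for u v
    using convex_onD[OF E_convex, of "1 / 2" u v] by (simp add: algebra_simps)
  let ?h = "\<lambda>s t. (s + t) / (2 :: real)"
  have mid_total: "total x (?h a a', ?h b b', ?h c c') < (total x m + total x m') / 2"
  proof -
    have 1: "E (x1, ?h a a', ?h b b') \<le> (E (x1, a, b) + E (x1, a', b')) / 2"
      using le[of "(x1, a, b)" "(x1, a', b')"] by simp
    have 2: "E (?h a a', x2, ?h c c') \<le> (E (a, x2, c) + E (a', x2, c')) / 2"
      using le[of "(a, x2, c)" "(a', x2, c')"] by simp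
    have 3: "E (?h b b', ?h c c', x3) \<le> (E (b, c, x3) + E (b', c', x3)) / 2"
      using le[of "(b, c, x3)" "(b', c', x3)"] by simp
    consider "a \<noteq> a' \<or> b \<noteq> b'" | "c \<noteq> c'" using ne by auto
    then show ?thesis
    proof cases
      case 1
      then have "E (0, a - a', b - b') \<noteq> 0" by (auto simp: E_zero_iff)
      then have "E (x1, ?h a a', ?h b b') < (E (x1, a, b) + E (x1, a', b')) / 2"
        using E_strict[of "(x1, a, b)" "(x1, a', b')"] by simp
      then show ?thesis using 2 3 by (simp add: add_divide_distrib)
    next
      case c: 2
      have "E (a - a', 0, c - c') \<noteq> 0" using c by (auto simp: E_zero_iff)
      then have "E (?h a a', x2, ?h c c') < (E (a, x2, c) + E (a', x2, c')) / 2"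
        using E_strict[of "(a, x2, c)" "(a', x2, c')"] by simp
      then show ?thesis using 1 3 by (simp add: add_divide_distrib)
    qed
  qed
  then have "\<rho> * total x (?h a a', ?h b b', ?h c c') < \<rho> * ((total x m + total x m') / 2)"
    using rho_pos by simp
  also have "\<dots> \<le> E x" using assms by (simp add: algebra_simps)
  finally show False using E_le_total[of x "(?h a a', ?h b b', ?h c c')"] by simp
qed

section \<open>The harmonic extension and its continuity\<close>

definition mid :: "real \<times> real \<times> real \<Rightarrow> real \<times> real \<times> real" where
  "mid x = (THE m. \<rho> * total x m = E x)"

lemma mid_total: "\<rho> * total x (mid x) = E x"
  unfolding mid_def
  by (rule theI') (use minimizer_exists minimizer_unique in \<open>metis order_refl\<close>)

lemma mid_eqI: "\<rho> * total x m \<le> E x \<Longrightarrow> mid x = m"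
  using minimizer_unique[of x "mid x" m] mid_total by simp

lemma mid_swap12: "mid (x1, x2, x3) = (a, b, c) \<Longrightarrow> mid (x2, x1, x3) = (a, c, b)"
  using mid_total[of "(x1, x2, x3)"] E_swap12[of x1 a c] E_swap12 E_swap23
  by (intro mid_eqI) (simp add: add.commute add.left_commute)

lemma mid_swap23: "mid (x1, x2, x3) = (a, b, c) \<Longrightarrow> mid (x1, x3, x2) = (b, a, c)"
  using mid_total[of "(x1, x2, x3)"]  E_swap23
  by (intro mid_eqI) (simp add: add.commute add.left_commute)

lemma mid_swap13: "mid (x1, x2, x3) = (a, b, c) \<Longrightarrow> mid (x3, x2, x1) = (c, b, a)"
  using mid_swap12 mid_swap23 by blast

lemma mid_shift:
  assumes "mid (x1, x2, x3) = (a, b, c)"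
  shows "mid (x1 + k, x2 + k, x3 + k) = (a + k, b + k, c + k)"
proof (rule mid_eqI)
  have "E (u + k, v + k, w + k) = E (u, v, w)" for u v w using E_shift[of "(u, v, w)" k] by simp
  then show "\<rho> * total (x1 + k, x2 + k, x3 + k) (a + k, b + k, c + k) \<le> E (x1 + k, x2 + k, x3 + k)"
    using mid_total[of "(x1, x2, x3)"] assms by simp
qed

lemma mid_scale:
  assumes "mid (x1, x2, x3) = (a, b, c)"
  shows "mid (k * x1, k * x2, k * x3) = (k * a, k * b, k * c)"
proof (rule mid_eqI)
  have *: "E (k * u, k * v, k * w) = \<bar>k\<bar> powr p * E (u, v, w)" for u v w
    using E_scale[of k "(u, v, w)"] by simp
  have "\<rho> * total (k * x1, k * x2, k * x3) (k * a, k * b, k * c) = \<bar>k\<bar> powr p * (\<rho> * total (x1, x2, x3) (a, b, c))"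
    by (simp only: total_simp * distrib_left mult.left_commute)
  also have "\<rho> * total (x1, x2, x3) (a, b, c) = E (x1, x2, x3)"
    using mid_total[of "(x1, x2, x3)"] unfolding assms .
  finally show "\<rho> * total (k * x1, k * x2, k * x3) (k * a, k * b, k * c) \<le> E (k * x1, k * x2, k * x3)"
    unfolding * by (rule eq_refl)
qed

lemma mid_const: "mid (k, k, k) = (k, k, k)"
  by (rule mid_eqI) simp

text \<open>By submodularity in each cell, the entrywise minimum and maximum together have no more
  energy than the two minimizers. Neither term can fall below its trace value, so the minimum is
  again a minimizer for the smaller data, and uniqueness applies.\<close>

lemma comparison_principle:
  assumes "mid (x1, x2, x3) = (a, b, c)" "mid (y1, y2, y3) = (a', b', c')"
    and "x1 \<le> y1" "x2 \<le> y2" "x3 \<le> y3"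
  shows "a \<le> a' \<and> b \<le> b' \<and> c \<le> c'"
proof -
  let ?m = "(min a a', min b b', min c c')" and ?M = "(max a a', max b b', max c c')"
  have "total (x1, x2, x3) ?m + total (y1, y2, y3) ?M \<le> total (x1, x2, x3) (a, b, c) + total (y1, y2, y3) (a', b', c')"
    using add_mono[OF E_submodular[of x1 y1 a a' b b']
        add_mono[OF E_submodular[of a a' x2 y2 c c'] E_submodular[of b b' c c' x3 y3]]]
    by (simp only: total_simp add_ac min_absorb1[OF assms(3)] min_absorb1[OF assms(4)] min_absorb1[OF assms(5)]
        max_absorb2[OF assms(3)] max_absorb2[OF assms(4)] max_absorb2[OF assms(5)])
  then have "\<rho> * (total (x1, x2, x3) ?m + total (y1, y2, y3) ?M) \<le> \<rho> * (total (x1, x2, x3) (a, b, c) + total (y1, y2, y3) (a', b', c'))"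
    using rho_pos by (intro mult_left_mono) auto
  also have "\<dots> = E (x1, x2, x3) + E (y1, y2, y3)"
    using mid_total[of "(x1, x2, x3)"] mid_total[of "(y1, y2, y3)"] unfolding assms by (simp add: distrib_left)
  finally have "\<rho> * total (x1, x2, x3) ?m \<le> E (x1, x2, x3)"
    using E_le_total[of "(y1, y2, y3)" ?M] unfolding distrib_left by (smt (verit))
  then have "mid (x1, x2, x3) = ?m" by (rule mid_eqI)
  then show ?thesis using assms by auto
qed

text \<open>Comparison with the data shifted by \<delta> makes the extension nonexpansive in the
  maximum norm; this replaces linearity as the source of continuity.\<close>

lemma mid_lipschitz:
  assumes "mid (x1, x2, x3) = (a, b, c)" "mid (y1, y2, y3) = (a', b', c')"
    and "\<bar>x1 - y1\<bar> \<le> \<delta>" "\<bar>x2 - y2\<bar> \<le> \<delta>" "\<bar>x3 - y3\<bar> \<le> \<delta>"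
  shows "\<bar>a - a'\<bar> \<le> \<delta> \<and> \<bar>b - b'\<bar> \<le> \<delta> \<and> \<bar>c - c'\<bar> \<le> \<delta>"
proof -
  have "a \<le> a' + \<delta> \<and> b \<le> b' + \<delta> \<and> c \<le> c' + \<delta>"
    by (rule comparison_principle[OF assms(1) mid_shift[OF assms(2), of \<delta>]]) (use assms(3-5) in linarith)+
  moreover have "a' \<le> a + \<delta> \<and> b' \<le> b + \<delta> \<and> c' \<le> c + \<delta>"
    by (rule comparison_principle[OF assms(2) mid_shift[OF assms(1), of \<delta>]]) (use assms(3-5) in linarith)+
  ultimately show ?thesis by (simp add: abs_le_iff)
qed

lemma tendsto_mid:
  assumes "(f \<longlongrightarrow> x) F"
  shows "((\<lambda>n. mid (f n)) \<longlongrightarrow> mid x) F"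
proof -
  define d where "d y = \<bar>fst y - fst x\<bar> + \<bar>fst (snd y) - fst (snd x)\<bar> + \<bar>snd (snd y) - snd (snd x)\<bar>" for y
  have le: "norm (mid y - mid x) \<le> 3 * d y" for y
  proof -
    obtain x1 x2 x3 a b c y1 y2 y3 a' b' c' where [simp]: "x = (x1, x2, x3)" "mid x = (a, b, c)"
      "y = (y1, y2, y3)" "mid y = (a', b', c')" by (cases x, cases y, cases "mid x", cases "mid y") auto
    have m: "mid (x1, x2, x3) = (a, b, c)" "mid (y1, y2, y3) = (a', b', c')"
      using \<open>mid x = (a, b, c)\<close> \<open>mid y = (a', b', c')\<close> by simp_all
    have "\<bar>a' - a\<bar> \<le> d y \<and> \<bar>b' - b\<bar> \<le> d y \<and> \<bar>c' - c\<bar> \<le> d y"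
      by (rule mid_lipschitz[OF m(2) m(1)]) (auto simp: d_def)
    then show ?thesis using norm_triple_le[of "a' - a" "b' - b" "c' - c"] m by simp
  qed
  have "((\<lambda>n. 3 * d (f n)) \<longlongrightarrow> 3 * d x) F" unfolding d_def by (intro tendsto_intros assms)
  then have "((\<lambda>n. 3 * d (f n)) \<longlongrightarrow> 0) F" by (simp add: d_def)
  then have "((\<lambda>n. mid (f n) - mid x) \<longlongrightarrow> 0) F"
    by (rule Lim_null_comparison[rotated]) (simp add: le)
  then show ?thesis by (simp add: LIM_zero_iff)
qed

text \<open>Both sides of the minimality inequality, perturbed in an arbitrary direction, have the same
  derivative at 0.\<close>

lemma gauss_green:
  assumes m: "mid (x1, x2, x3) = (a, b, c)"
  shows "D (x1, x2, x3) (y1, y2, y3) =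
    \<rho> * (D (x1, a, b) (y1, \<alpha>, \<beta>) + D (a, x2, c) (\<alpha>, y2, \<gamma>) + D (b, c, x3) (\<beta>, \<gamma>, y3))"
proof -
  define g where "g t = \<rho> * (E ((x1, a, b) + t *\<^sub>R (y1, \<alpha>, \<beta>)) + E ((a, x2, c) + t *\<^sub>R (\<alpha>, y2, \<gamma>))
      + E ((b, c, x3) + t *\<^sub>R (\<beta>, \<gamma>, y3))) - E ((x1, x2, x3) + t *\<^sub>R (y1, y2, y3))" for t
  have "(g has_real_derivative (\<rho> * (D (x1, a, b) (y1, \<alpha>, \<beta>) + D (a, x2, c) (\<alpha>, y2, \<gamma>) + D (b, c, x3) (\<beta>, \<gamma>, y3))
      - D (x1, x2, x3) (y1, y2, y3))) (at 0)"
    unfolding g_def by (intro DERIV_diff DERIV_cmult DERIV_add has_derivative_D)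
  moreover have "g 0 = 0" using mid_total[of "(x1, x2, x3)"] m by (simp add: g_def)
  moreover have "0 \<le> g t" for t
    using renorm_le[of "x1 + t * y1" "x2 + t * y2" "x3 + t * y3" "a + t * \<alpha>" "b + t * \<beta>" "c + t * \<gamma>"]
    by (simp add: g_def)
  ultimately have "\<rho> * (D (x1, a, b) (y1, \<alpha>, \<beta>) + D (a, x2, c) (\<alpha>, y2, \<gamma>) + D (b, c, x3) (\<beta>, \<gamma>, y3))
      - D (x1, x2, x3) (y1, y2, y3) = 0"
    by (intro DERIV_local_min[of g _ 0 1]) auto
  then show ?thesis by simp
qed

text \<open>Unit perturbations at the three vertices and the three midpoints: in passing to the cell
  at a vertex the flux there is divided by \<rho>, and at a midpoint the fluxes of the two adjacent
  cells cancel.\<close>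

lemma flux:
  assumes m: "mid (x1, x2, x3) = (a, b, c)"
  shows flux1: "D (x1, x2, x3) (1, 0, 0) = \<rho> * D (x1, a, b) (1, 0, 0)"
    and flux2: "D (x1, x2, x3) (0, 1, 0) = \<rho> * D (a, x2, c) (0, 1, 0)"
    and flux3: "D (x1, x2, x3) (0, 0, 1) = \<rho> * D (b, c, x3) (0, 0, 1)"
    and flux12: "D (x1, a, b) (0, 1, 0) + D (a, x2, c) (1, 0, 0) = 0"
    and flux13: "D (x1, a, b) (0, 0, 1) + D (b, c, x3) (1, 0, 0) = 0"
    and flux23: "D (a, x2, c) (0, 0, 1) + D (b, c, x3) (0, 1, 0) = 0"
  using gauss_green[OF m, of 1 0 0 0 0 0] gauss_green[OF m, of 0 1 0 0 0 0] gauss_green[OF m, of 0 0 1 0 0 0]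
    gauss_green[OF m, of 0 0 0 1 0 0] gauss_green[OF m, of 0 0 0 0 1 0] gauss_green[OF m, of 0 0 0 0 0 1]
    D_const_dir[of _ 0] rho_pos
  by simp_all

section \<open>The symmetric function and its scaling factor\<close>

definition lam :: real where "lam = fst (mid (0, 1, 1))"

definition d0 :: real where "d0 = D (0, 1, 1) (1, 0, 0)"

lemma d0: "d0 = - p * E (0, 1, 1)" "d0 < 0"
proof -
  have "D (0, 1, 1) (0, 1, 1) = p * E (0, 1, 1)" by (rule D_self)
  then show "d0 = - p * E (0, 1, 1)"
    using D_coords[of "(0, 1, 1)" 0 1 1] D_sum[of "(0, 1, 1)"] by (simp add: d0_def)
  moreover have "E (0, 1, 1) \<noteq> 0" by (simp add: E_zero_iff)
  ultimately show "d0 < 0" using E_nonneg[of "(0, 1, 1)"] p_gt_1 by simp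
qed

lemma D_sym: "D (0, 1, 1) (0, 1, 0) = - d0 / 2" "D (0, 1, 1) (0, 0, 1) = - d0 / 2"
  using D_swap23[of 0 1 1 0 1 0] D_sum[of "(0, 1, 1)"] by (simp_all add: d0_def)

lemma D3_zero:
  assumes "D (x1, x2, x3) (0, 0, 1) = 0"
  shows "x3 = (x1 + x2) / 2"
  using D1_zero[of x3 x2 x1] D_swap13[of x1 x2 x3 0 0 1] assms by simp

lemma D2_zero:
  assumes "D (x1, x2, x3) (0, 1, 0) = 0"
  shows "x2 = (x1 + x3) / 2"
  using D1_zero[of x2 x1 x3] D_swap12[of x1 x2 x3 0 1 0] assms by simp

text \<open>Symmetry in vertices 2 and 3 makes the values on cell 1 the multiple \<open>lam\<close>
  of (0, 1, 1), so conservation of flux at vertex 1 reads \<rho> lam^(p - 1) = 1. The same symmetry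
  kills the flux at the midpoint of the opposite side, which determines its value, and half of the
  flux of cell 1 enters cell 2.\<close>

lemma lam_properties:
  shows lam_pos: "0 < lam" and lam_less_1: "lam < 1"
    and rho_lam: "\<rho> * lam powr (p - 1) = 1"
    and mid_sym: "mid (0, 1, 1) = (lam, lam, (1 + lam) / 2)"
    and d_anti: "D (lam, 1, (1 + lam) / 2) (1, 0, 0) = lam powr (p - 1) * d0 / 2"
proof -
  obtain b c where m: "mid (0, 1, 1) = (lam, b, c)" by (cases "mid (0, 1, 1)") (simp add: lam_def)
  have b: "b = lam"
    by (rule conjunct1[OF prod.inject[THEN iffD1, OF trans[OF m[symmetric] mid_swap23[OF m]]], symmetric])
  note m = m[unfolded b]
  have le: "0 \<le> lam" "lam \<le> 1"
    using comparison_principle[OF mid_const[of 0] m] comparison_principle[OF m mid_const[of 1]] by auto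
  \<comment> \<open>Otherwise cell 1 would be constant and the flux at vertex 1 would be 0.\<close>
  have "lam \<noteq> 0" using flux1[OF m] d0 by (auto simp: d0_def)
  with le show pos: "0 < lam" by simp
  have sc: "D (0, lam, lam) y = lam powr (p - 1) * D (0, 1, 1) y" for y
    using D_scale[OF pos, of "(0, 1, 1)" y] by simp
  show rl: "\<rho> * lam powr (p - 1) = 1"
    using flux1[OF m] d0(2) sc[of "(1, 0, 0)"] by (simp add: d0_def)
  have "D (lam, 1, c) (0, 0, 1) + D (lam, c, 1) (0, 1, 0) = 0" by (rule flux23[OF m])
  then have "D (lam, 1, c) (0, 0, 1) = 0" using D_swap23[of lam 1 c 0 0 1] by simp
  then have c: "c = (1 + lam) / 2" using D3_zero[of lam 1 c] by (simp add: add.commute)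
  show mm: "mid (0, 1, 1) = (lam, lam, (1 + lam) / 2)" using m c by simp
  show da: "D (lam, 1, (1 + lam) / 2) (1, 0, 0) = lam powr (p - 1) * d0 / 2"
    using flux12[OF mm] sc[of "(0, 1, 0)"] D_sym by simp
  \<comment> \<open>For \<open>lam = 1\<close> cell 2 would be constant, contradicting its nonzero
    flux.\<close>
  have "lam \<noteq> 1"
  proof
    assume "lam = 1" then show False using da d0 p_gt_1 by auto
  qed
  with le show "lam < 1" by simp
qed

text \<open>The fluxes through cells 2 and 3 vanish at the third midpoint, whose value is therefore the
  mean of the two others in both cells.\<close>

lemma blowup_fixed_point:
  assumes m: "mid (0, s, t) = (lam * s, lam * t, c)"
  shows "s = t"
proof -
  have sc: "D (0, lam * s, lam * t) y = lam powr (p - 1) * D (0, s, t) y" for y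
    using D_scale[OF lam_pos, of "(0, s, t)" y] by simp
  have r: "lam powr (p - 1) * (\<rho> * z) = z" for z using rho_lam by (metis mult.assoc mult.commute mult_1)
  have "D (lam * s, s, c) (0, 1, 0) = lam powr (p - 1) * D (0, s, t) (0, 1, 0)"
    using flux2[OF m] r by simp
  then have "D (lam * s, s, c) (0, 0, 1) = 0"
    using flux12[OF m] sc[of "(0, 1, 0)"] D_sum[of "(lam * s, s, c)"] by simp
  then have c1: "c = (lam * s + s) / 2" by (rule D3_zero)
  have "D (lam * t, c, t) (0, 0, 1) = lam powr (p - 1) * D (0, s, t) (0, 0, 1)"
    using flux3[OF m] r by simp
  then have "D (lam * t, c, t) (0, 1, 0) = 0"
    using flux13[OF m] sc[of "(0, 0, 1)"] D_sum[of "(lam * t, c, t)"] by simp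
  then have "c = (lam * t + t) / 2" by (rule D2_zero)
  with c1 have "(lam + 1) * (s - t) = 0" by (simp add: algebra_simps)
  then show ?thesis using lam_pos by simp
qed

text \<open>If the order were reversed, exchanging the two values would not increase the energy, by
  submodularity for one cell and the reflection of the other.\<close>

lemma mid_order:
  assumes m: "mid (0, s, t) = (a, b, c)" and "s \<le> t"
  shows "a \<le> b"
proof (rule ccontr)
  assume n: "\<not> a \<le> b"
  have "E (b, s, c) + E (a, t, c) \<le> E (a, s, c) + E (b, t, c)"
    using E_submodular[of a b s t c c] n assms by (simp add: min_def max_def)
  then have "total (0, s, t) (b, a, c) \<le> total (0, s, t) (a, b, c)"
    using E_swap23[of 0 a b] E_swap23[of a t c] E_swap23[of b t c] by simp
  then have "\<rho> * total (0, s, t) (b, a, c) \<le> \<rho> * total (0, s, t) (a, b, c)" using rho_pos by simp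
  then have "mid (0, s, t) = (b, a, c)" using mid_total[of "(0, s, t)"] m by (intro mid_eqI) simp
  then show False using m n by simp
qed

text \<open>Under \<open>fold H\<close> the first letter of a word selects the largest cell, the
  same order as in \<open>word_map\<close>.\<close>

fun H :: "nat \<Rightarrow> real \<times> real \<times> real \<Rightarrow> real \<times> real \<times> real" where
  "H i (x1, x2, x3) = (case mid (x1, x2, x3) of (a, b, c) \<Rightarrow>
     if i = 1 then (x1, a, b) else if i = 2 then (a, x2, c) else (b, c, x3))"

text \<open>Divided by \<open>lam\<close> at each step, \<open>H 1\<close> acts on the pair of
  values at vertices 2 and 3 as G, which fixes all pairs (k, k). Comparison with these makes the
  smaller value increase and the larger one decrease, and \<open>blowup_fixed_point\<close>
  identifies the limits. The flux at vertex 1 is the same at every step, since the factors \<rho>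
  and lam^(p - 1) cancel, so it is also that of the limit and determines \<kappa>.\<close>

lemma blowup_ordered:
  assumes "s \<le> t"
  shows "\<exists>\<kappa>. (\<lambda>n. (1 / lam ^ n) *\<^sub>R (H 1 ^^ n) (0, s, t)) \<longlonglongrightarrow> (0, \<kappa>, \<kappa>) \<and>
    D (0, s, t) (1, 0, 0) = D (0, \<kappa>, \<kappa>) (1, 0, 0)"
proof -
  define G where "G z = (fst (mid (0, fst z, snd z)) / lam, fst (snd (mid (0, fst z, snd z))) / lam)" for z
  define z where "z n = (G ^^ n) (s, t)" for n
  define u where "u n = fst (z n)" for n
  define v where "v n = snd (z n)" for n
  have z0: "u 0 = s" "v 0 = t" by (simp_all add: u_def v_def z_def)
  have step: "\<exists>c. mid (0, u n, v n) = (lam * u (Suc n), lam * v (Suc n), c)" for n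
    using lam_pos by (cases "mid (0, u n, v n)") (auto simp: u_def v_def z_def G_def)
  have ord: "u n \<le> v n" for n
  proof (induction n)
    case (Suc n)
    obtain c where "mid (0, u n, v n) = (lam * u (Suc n), lam * v (Suc n), c)" using step by blast
    from mid_order[OF this Suc] show ?case using lam_pos by simp
  qed (use assms z0 in simp)
  have mono: "u n \<le> u (Suc n) \<and> v (Suc n) \<le> v n" for n
  proof -
    obtain c where m: "mid (0, u n, v n) = (lam * u (Suc n), lam * v (Suc n), c)" using step by blast
    have k: "mid (0, k, k) = (k * lam, k * lam, k * ((1 + lam) / 2))" for k
      using mid_scale[OF mid_sym, of k] by simp
    show ?thesis
      using comparison_principle[OF k m] comparison_principle[OF m k] ord[of n] lam_pos by (simp add: mult.commute)
  qed
  have "incseq u" "decseq v" using mono by (auto intro: incseq_SucI decseq_SucI)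
  have "u n \<le> t" "s \<le> v n" for n
    using ord[of n] decseqD[OF \<open>decseq v\<close>, of 0 n] incseqD[OF \<open>incseq u\<close>, of 0 n] z0 by auto
  then obtain \<kappa> \<kappa>' where lim: "u \<longlonglongrightarrow> \<kappa>" "v \<longlonglongrightarrow> \<kappa>'"
    using incseq_convergent[OF \<open>incseq u\<close>] decseq_convergent[OF \<open>decseq v\<close>] by metis
  have "(\<lambda>n. mid (0, u n, v n)) \<longlonglongrightarrow> mid (0, \<kappa>, \<kappa>')" by (intro tendsto_mid tendsto_intros lim)
  moreover have g: "fst (mid (0, u n, v n)) = lam * u (Suc n)" "fst (snd (mid (0, u n, v n))) = lam * v (Suc n)" for n
    using step[of n] by auto
  ultimately
  have "(\<lambda>n. lam * u (Suc n)) \<longlonglongrightarrow> fst (mid (0, \<kappa>, \<kappa>'))" "(\<lambda>n. lam * v (Suc n)) \<longlonglongrightarrow> fst (snd (mid (0, \<kappa>, \<kappa>')))"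
    using tendsto_fst tendsto_snd unfolding g[symmetric] by blast+
  moreover have "(\<lambda>n. lam * u (Suc n)) \<longlonglongrightarrow> lam * \<kappa>" "(\<lambda>n. lam * v (Suc n)) \<longlonglongrightarrow> lam * \<kappa>'"
    using lim by (auto intro!: tendsto_intros simp: filterlim_sequentially_Suc)
  ultimately have "fst (mid (0, \<kappa>, \<kappa>')) = lam * \<kappa>" "fst (snd (mid (0, \<kappa>, \<kappa>'))) = lam * \<kappa>'"
    using LIMSEQ_unique by blast+
  then have "mid (0, \<kappa>, \<kappa>') = (lam * \<kappa>, lam * \<kappa>', snd (snd (mid (0, \<kappa>, \<kappa>'))))" by (metis prod.collapse)
  then have eq: "\<kappa> = \<kappa>'" by (rule blowup_fixed_point)
  have iter: "(H 1 ^^ n) (0, s, t) = (lam ^ n) *\<^sub>R (0, u n, v n)" for n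
  proof (induction n)
    case (Suc n)
    obtain c where m: "mid (0, u n, v n) = (lam * u (Suc n), lam * v (Suc n), c)" using step by blast
    show ?case using Suc mid_scale[OF m, of "lam ^ n"] by simp
  qed (simp add: z0)
  have const: "D (0, u n, v n) (1, 0, 0) = D (0, s, t) (1, 0, 0)" for n
  proof (induction n)
    case (Suc n)
    obtain c where m: "mid (0, u n, v n) = (lam * u (Suc n), lam * v (Suc n), c)" using step by blast
    have "D (0, u n, v n) (1, 0, 0) = \<rho> * D (lam *\<^sub>R (0, u (Suc n), v (Suc n))) (1, 0, 0)"
      using flux1[OF m] by simp
    also have "\<dots> = \<rho> * lam powr (p - 1) * D (0, u (Suc n), v (Suc n)) (1, 0, 0)"
      by (simp only: D_scale[OF lam_pos] mult.assoc)
    finally show ?case using Suc rho_lam by simp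
  qed (simp add: z0)
  have zlim: "(\<lambda>n. (0, u n, v n)) \<longlonglongrightarrow> (0, \<kappa>, \<kappa>)" using lim eq by (intro tendsto_intros) auto
  have "(\<lambda>n. D (0, u n, v n) (1, 0, 0)) \<longlonglongrightarrow> D (0, \<kappa>, \<kappa>) (1, 0, 0)" by (rule tendsto_D[OF zlim])
  then have "D (0, s, t) (1, 0, 0) = D (0, \<kappa>, \<kappa>) (1, 0, 0)"
    unfolding const by (simp add: LIMSEQ_const_iff)
  moreover have "(1 / lam ^ n) *\<^sub>R (H 1 ^^ n) (0, s, t) = (0, u n, v n)" for n
    unfolding iter using lam_pos by simp
  ultimately show ?thesis using zlim by auto
qed

end

section \<open>Blow-up and rigidity\<close>

context renorm_form
begin

lemma H_simps:
  assumes "mid (x1, x2, x3) = (a, b, c)"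
  shows "H 1 (x1, x2, x3) = (x1, a, b)" "H (Suc 0) (x1, x2, x3) = (x1, a, b)"
    "H 2 (x1, x2, x3) = (a, x2, c)" "H 3 (x1, x2, x3) = (b, c, x3)"
  using assms by simp_all

declare H.simps [simp del]

lemma H_shift: "H i (x + (k, k, k)) = H i x + (k, k, k)"
proof -
  obtain x1 x2 x3 a b c where "x = (x1, x2, x3)" "mid (x1, x2, x3) = (a, b, c)"
    by (cases x; cases "mid x") auto
  then show ?thesis using mid_shift[of x1 x2 x3 a b c k] by (simp add: H.simps)
qed

lemma H_scale: "H i (k *\<^sub>R x) = k *\<^sub>R H i x"
proof -
  obtain x1 x2 x3 a b c where "x = (x1, x2, x3)" "mid (x1, x2, x3) = (a, b, c)"
    by (cases x; cases "mid x") auto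
  then show ?thesis using mid_scale[of x1 x2 x3 a b c k] by (simp add: H.simps)
qed

lemma tendsto_H:
  assumes "(f \<longlongrightarrow> x) F"
  shows "((\<lambda>n. H i (f n)) \<longlongrightarrow> H i x) F"
proof -
  have *: "H i x = (if i = 1 then (fst x, fst (mid x), fst (snd (mid x)))
      else if i = 2 then (fst (mid x), fst (snd x), snd (snd (mid x)))
      else (fst (snd (mid x)), snd (snd (mid x)), snd (snd x)))" for x
    by (cases x) (auto simp: H.simps split: prod.splits)
  have "((\<lambda>n. (fst (f n), fst (mid (f n)), fst (snd (mid (f n))))) \<longlongrightarrow> (fst x, fst (mid x), fst (snd (mid x)))) F"
    "((\<lambda>n. (fst (mid (f n)), fst (snd (f n)), snd (snd (mid (f n))))) \<longlongrightarrow> (fst (mid x), fst (snd x), snd (snd (mid x)))) F"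
    "((\<lambda>n. (fst (snd (mid (f n))), snd (snd (mid (f n))), snd (snd (f n)))) \<longlongrightarrow> (fst (snd (mid x)), snd (snd (mid x)), snd (snd x))) F"
    by (intro tendsto_intros tendsto_mid assms)+
  then show ?thesis unfolding * by auto
qed

lemma fold_H_shift: "fold H w (x + (k, k, k)) = fold H w x + (k, k, k)"
  by (induction w arbitrary: x) (simp_all add: H_shift)

lemma fold_H_scale: "fold H w (k *\<^sub>R x) = k *\<^sub>R fold H w x"
  by (induction w arbitrary: x) (simp_all add: H_scale)

lemma tendsto_fold_H: "(f \<longlongrightarrow> x) F \<Longrightarrow> ((\<lambda>n. fold H w (f n)) \<longlongrightarrow> fold H w x) F"
  by (induction w arbitrary: x f) (simp_all add: tendsto_H)

lemma E_H_sum: "E x = \<rho> * (E (H 1 x) + E (H 2 x) + E (H 3 x))"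
proof -
  obtain x1 x2 x3 a b c where [simp]: "x = (x1, x2, x3)" and m: "mid (x1, x2, x3) = (a, b, c)"
    by (cases x; cases "mid x") auto
  show ?thesis using mid_total[of x] m H_simps[OF m] by simp
qed

section \<open>Relative energies of cells: the normalized energy measure of a harmonic
  function\<close>

definition frac :: "nat list \<Rightarrow> real \<times> real \<times> real \<Rightarrow> real" where
  "frac w x = \<rho> ^ length w * E (fold H w x) / E x"

lemma frac_append: "E (fold H v x) \<noteq> 0 \<Longrightarrow> frac (v @ w) x = frac v x * frac w (fold H v x)"
  by (simp add: frac_def power_add)

lemma frac_shift: "frac w (x + (k, k, k)) = frac w x"
  by (simp add: frac_def fold_H_shift E_shift)

lemma frac_scale: "k \<noteq> 0 \<Longrightarrow> frac w (k *\<^sub>R x) = frac w x"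
  by (simp add: frac_def fold_H_scale E_scale)

lemma tendsto_frac: "(f \<longlongrightarrow> x) F \<Longrightarrow> E x \<noteq> 0 \<Longrightarrow> ((\<lambda>n. frac w (f n)) \<longlongrightarrow> frac w x) F"
  unfolding frac_def by (intro tendsto_intros tendsto_E tendsto_fold_H)

text \<open>Vertices and letters are relabelled together; this reduces a comparison of distributions
  at vertex 2 to one at vertex 1.\<close>

lemma frac_swap12:
  "frac (map (Transposition.transpose 1 2) w) (x2, x1, x3) = frac w (x1, x2, x3)" if "set w \<subseteq> alphabet"
proof -
  define sw where "sw y = (fst (snd y), fst y, snd (snd y))" for y :: "real \<times> real \<times> real"
  have 1: "H (Transposition.transpose 1 2 i) (sw y) = sw (H i y)" if "i \<in> alphabet" for i y
  proof -
    obtain x1 x2 x3 a b c where [simp]: "y = (x1, x2, x3)" and m: "mid (x1, x2, x3) = (a, b, c)"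
      by (cases y; cases "mid y") auto
    show ?thesis using that mid_swap12[OF m] m
      by (auto simp: H.simps alphabet_def sw_def transpose_def)
  qed
  have "fold H (map (Transposition.transpose 1 2) w) (sw y) = sw (fold H w y)" for y
    using that by (induction w arbitrary: y) (auto simp: 1 simp del: One_nat_def)
  moreover have "E (sw y) = E y" for y by (cases y) (simp add: sw_def E_swap12)
  ultimately have "frac (map (Transposition.transpose 1 2) w) (sw (x1, x2, x3)) = frac w (x1, x2, x3)" by (simp add: frac_def)
  then show ?thesis by (simp add: sw_def)
qed

lemma frac_swap13:
  "frac (map (Transposition.transpose 1 3) w) (x3, x2, x1) = frac w (x1, x2, x3)" if "set w \<subseteq> alphabet"
proof -
  define sw where "sw y = (snd (snd y), fst (snd y), fst y)" for y :: "real \<times> real \<times> real"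
  have 1: "H (Transposition.transpose 1 3 i) (sw y) = sw (H i y)" if "i \<in> alphabet" for i y
  proof -
    obtain x1 x2 x3 a b c where [simp]: "y = (x1, x2, x3)" and m: "mid (x1, x2, x3) = (a, b, c)"
      by (cases y; cases "mid y") auto
    show ?thesis using that mid_swap13[OF m] m
      by (auto simp: H.simps alphabet_def sw_def transpose_def)
  qed
  have "fold H (map (Transposition.transpose 1 3) w) (sw y) = sw (fold H w y)" for y
    using that by (induction w arbitrary: y) (auto simp: 1 simp del: One_nat_def)
  moreover have "E (sw y) = E y" for y by (cases y) (simp add: sw_def E_swap13)
  ultimately have "frac (map (Transposition.transpose 1 3) w) (sw (x1, x2, x3)) = frac w (x1, x2, x3)" by (simp add: frac_def)
  then show ?thesis by (simp add: sw_def)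
qed

lemma H1_funpow_shift: "(H 1 ^^ n) (x + (k, k, k)) = (H 1 ^^ n) x + (k, k, k)"
  using fold_H_shift[of "replicate n 1" x k] by (simp add: fold_replicate)

lemma H1_funpow_swap23:
  "(H 1 ^^ n) (x1, x3, x2) = (\<lambda>y. (fst y, snd (snd y), fst (snd y))) ((H 1 ^^ n) (x1, x2, x3))"
proof (induction n)
  case (Suc n)
  obtain y1 y2 y3 a b c where y: "(H 1 ^^ n) (x1, x2, x3) = (y1, y2, y3)" and m: "mid (y1, y2, y3) = (a, b, c)"
    by (cases "(H 1 ^^ n) (x1, x2, x3)"; cases "mid ((H 1 ^^ n) (x1, x2, x3))") auto
  show ?case using Suc y H_simps[OF m] H_simps[OF mid_swap23[OF m]] by simp
qed simp

lemma blowup: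
  "\<exists>\<kappa>. (\<lambda>n. (1 / lam ^ n) *\<^sub>R ((H 1 ^^ n) (x1, x2, x3) - (x1, x1, x1))) \<longlonglongrightarrow> (0, \<kappa>, \<kappa>) \<and>
    D (x1, x2, x3) (1, 0, 0) = D (0, \<kappa>, \<kappa>) (1, 0, 0)"
proof -
  have main: "\<exists>\<kappa>. (\<lambda>n. (1 / lam ^ n) *\<^sub>R ((H 1 ^^ n) (x1, x2, x3) - (x1, x1, x1))) \<longlonglongrightarrow> (0, \<kappa>, \<kappa>) \<and>
    D (x1, x2, x3) (1, 0, 0) = D (0, \<kappa>, \<kappa>) (1, 0, 0)" if "x2 \<le> x3" for x2 x3
  proof -
    have "(x1, x2, x3) = (0, x2 - x1, x3 - x1) + (x1, x1, x1)" by simp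
    then have "(H 1 ^^ n) (x1, x2, x3) - (x1, x1, x1) = (H 1 ^^ n) (0, x2 - x1, x3 - x1)"
      "D (x1, x2, x3) (1, 0, 0) = D (0, x2 - x1, x3 - x1) (1, 0, 0)" for n
      by (metis H1_funpow_shift add_diff_cancel_right', metis D_shift)
    then show ?thesis using blowup_ordered[of "x2 - x1" "x3 - x1"] that by simp
  qed
  show ?thesis
  proof (cases "x2 \<le> x3")
    case True then show ?thesis by (rule main)
  next
    case False
    then obtain \<kappa> where \<kappa>: "(\<lambda>n. (1 / lam ^ n) *\<^sub>R ((H 1 ^^ n) (x1, x3, x2) - (x1, x1, x1))) \<longlonglongrightarrow> (0, \<kappa>, \<kappa>)"
      and d: "D (x1, x3, x2) (1, 0, 0) = D (0, \<kappa>, \<kappa>) (1, 0, 0)"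
      using main[of x3 x2] by auto
    let ?sw = "\<lambda>y :: real \<times> real \<times> real. (fst y, snd (snd y), fst (snd y))"
    have "(\<lambda>n. ?sw ((1 / lam ^ n) *\<^sub>R ((H 1 ^^ n) (x1, x3, x2) - (x1, x1, x1)))) \<longlonglongrightarrow> ?sw (0, \<kappa>, \<kappa>)"
      by (intro tendsto_intros \<kappa>)
    moreover have "?sw ((1 / lam ^ n) *\<^sub>R ((H 1 ^^ n) (x1, x3, x2) - (x1, x1, x1)))
        = (1 / lam ^ n) *\<^sub>R ((H 1 ^^ n) (x1, x2, x3) - (x1, x1, x1))" for n
      unfolding H1_funpow_swap23[of n x1 x2 x3] by (cases "(H 1 ^^ n) (x1, x3, x2)"; cases "(H 1 ^^ n) (x1, x2, x3)") (use H1_funpow_swap23[of n x1 x3 x2] in simp)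
    ultimately show ?thesis using d D_swap23[of x1 x2 x3 1 0 0] by auto
  qed
qed

lemma E_nonzero_of_flux: "D x y \<noteq> 0 \<Longrightarrow> E x \<noteq> 0"
  by (cases x) (auto simp: E_zero_iff)

lemma flux_H1: "D x (1, 0, 0) = \<rho> ^ n * D ((H 1 ^^ n) x) (1, 0, 0)"
proof (induction n)
  case (Suc n)
  obtain y1 y2 y3 a b c where y: "(H 1 ^^ n) x = (y1, y2, y3)" and m: "mid (y1, y2, y3) = (a, b, c)"
    by (cases "(H 1 ^^ n) x"; cases "mid ((H 1 ^^ n) x)") auto
  show ?case using Suc y flux1[OF m] H_simps[OF m] by simp
qed simp

text \<open>Relative energies ignore shifts and multiples, so they converge along the blow-up
  although the functions themselves shrink to a constant. Nonzero flux means \<kappa> \<noteq> 0,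
  and then (0, \<kappa>, \<kappa>) is a multiple of (0, 1, 1).\<close>

lemma frac_blowup:
  assumes "D x (1, 0, 0) \<noteq> 0"
  shows "(\<lambda>n. frac w ((H 1 ^^ n) x)) \<longlonglongrightarrow> frac w (0, 1, 1)"
proof -
  obtain x1 x2 x3 where x: "x = (x1, x2, x3)" by (cases x)
  obtain \<kappa> where lim: "(\<lambda>n. (1 / lam ^ n) *\<^sub>R ((H 1 ^^ n) x - (x1, x1, x1))) \<longlonglongrightarrow> (0, \<kappa>, \<kappa>)"
    and d: "D x (1, 0, 0) = D (0, \<kappa>, \<kappa>) (1, 0, 0)"
    using blowup[of x1 x2 x3] x by auto
  have k0: "\<kappa> \<noteq> 0" using d assms by auto
  have "(\<lambda>n. frac w ((1 / lam ^ n) *\<^sub>R ((H 1 ^^ n) x - (x1, x1, x1)))) \<longlonglongrightarrow> frac w (0, \<kappa>, \<kappa>)"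
    by (rule tendsto_frac[OF lim]) (use k0 in \<open>simp add: E_zero_iff\<close>)
  moreover have "frac w ((1 / lam ^ n) *\<^sub>R ((H 1 ^^ n) x - (x1, x1, x1))) = frac w ((H 1 ^^ n) x)" for n
  proof -
    have "frac w ((1 / lam ^ n) *\<^sub>R ((H 1 ^^ n) x - (x1, x1, x1))) = frac w ((H 1 ^^ n) x - (x1, x1, x1))"
      using lam_pos by (intro frac_scale) simp
    also have "\<dots> = frac w ((H 1 ^^ n) x)"
      using frac_shift[of w "(H 1 ^^ n) x - (x1, x1, x1)" x1] by simp
    finally show ?thesis .
  qed
  moreover have "frac w (0, \<kappa>, \<kappa>) = frac w (0, 1, 1)" using frac_scale[OF k0, of w "(0, 1, 1)"] by simp
  ultimately show ?thesis by simp
qed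

text \<open>Cell 1 carries the fraction \<rho> lam^p = lam, so the distribution of the symmetric
  function reveals \<open>lam\<close>.\<close>

lemma frac_sym_1: "frac [1] (0, 1, 1) = lam"
proof -
  have "E (H 1 (0, 1, 1)) = lam powr p * E (0, 1, 1)"
    using H_simps[OF mid_sym] E_scale[of lam "(0, 1, 1)"] lam_pos by simp
  then have "frac [1] (0, 1, 1) = \<rho> * lam powr p"
    by (simp add: frac_def E_zero_iff)
  also have "\<dots> = (\<rho> * lam powr (p - 1)) * lam" using lam_pos by (simp add: powr_diff)
  finally show ?thesis by (simp add: rho_lam)
qed

text \<open>The values on cell 2 of the harmonic function with boundary values \<open>(0, 1, 1)\<close>.\<close>

definition anti :: "real \<times> real \<times> real" where "anti = (lam, 1, (1 + lam) / 2)"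

lemma E_anti: "E anti \<noteq> 0" using lam_less_1 by (auto simp: anti_def E_zero_iff)

lemma frac_sym_2: "frac (2 # w) (0, 1, 1) = frac [2] (0, 1, 1) * frac w anti" "frac [2] (0, 1, 1) \<noteq> 0"
proof -
  have H2: "H 2 (0, 1, 1) = anti" using H_simps[OF mid_sym] by (simp add: anti_def)
  then show "frac (2 # w) (0, 1, 1) = frac [2] (0, 1, 1) * frac w anti"
    using frac_append[of "[2]" "(0, 1, 1)" w] E_anti by simp
  show "frac [2] (0, 1, 1) \<noteq> 0" using rho_pos E_anti by (simp add: frac_def H2 E_zero_iff)
qed

lemma frac_anti_limit:
  "(\<lambda>n. frac (replicate n 1) anti / lam ^ n) \<longlonglongrightarrow> lam * 2 powr (- 1 / (p - 1)) / (1 - lam)"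
proof -
  have d1: "D anti (1, 0, 0) = lam powr (p - 1) * d0 / 2" by (simp add: anti_def d_anti)
  have d3: "D anti (0, 0, 1) = 0"
    using flux23[OF mid_sym] D_swap23[of lam 1 "(1 + lam) / 2" 0 0 1] by (simp add: anti_def)
  \<comment> \<open>Euler's identity, with zero flux at the third vertex and total flux 0, expresses
    the energy of this cell by its flux at the first vertex alone.\<close>
  have "p * E anti = D anti anti" by (simp add: D_self)
  also have "\<dots> = lam * D anti (1, 0, 0) + D anti (0, 1, 0)"
    using D_coords[of anti lam 1 "(1 + lam) / 2"] d3 by (simp add: anti_def[symmetric])
  also have "\<dots> = - (1 - lam) * D anti (1, 0, 0)"
    using D_sum[of anti] d3 by (simp add: algebra_simps)
  finally have Ea: "p * E anti = - (1 - lam) * (lam powr (p - 1) * d0 / 2)" unfolding d1 .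
  obtain \<kappa> where lim: "(\<lambda>n. (1 / lam ^ n) *\<^sub>R ((H 1 ^^ n) anti - (lam, lam, lam))) \<longlonglongrightarrow> (0, \<kappa>, \<kappa>)"
    and d: "D anti (1, 0, 0) = D (0, \<kappa>, \<kappa>) (1, 0, 0)"
    using blowup[of lam 1 "(1 + lam) / 2"] by (auto simp: anti_def)
  have neg: "D (0, \<kappa>, \<kappa>) (1, 0, 0) < 0" using d d1 mult_pos_neg[OF _ d0(2), of "lam powr (p - 1)"] lam_pos by simp
  have \<kappa>: "0 < \<kappa>"
  proof (rule ccontr)
    assume "\<not> 0 < \<kappa>"
    moreover have "\<kappa> \<noteq> 0" using neg by auto
    ultimately have "0 < - \<kappa>" by simp
    then have "D (0, - \<kappa>, - \<kappa>) (1, 0, 0) < 0"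
      using D_scale[of "- \<kappa>" "(0, 1, 1)" "(1, 0, 0)"] d0(2) by (simp add: d0_def mult_pos_neg)
    then show False using neg D_minus[of "(0, \<kappa>, \<kappa>)" "(1, 0, 0)"] by simp
  qed
  \<comment> \<open>The blow-up limit carries the same flux at the first vertex, namely half that of
    (0, lam, lam); homogeneity of degree p - 1 turns this into an equation for \<kappa>.\<close>
  have "\<kappa> powr (p - 1) * d0 = D (0, \<kappa>, \<kappa>) (1, 0, 0)"
    using D_scale[OF \<kappa>, of "(0, 1, 1)" "(1, 0, 0)"] by (simp add: d0_def)
  also have "\<dots> = lam powr (p - 1) / 2 * d0" using d d1 by simp
  finally have "\<kappa> powr (p - 1) * d0 = lam powr (p - 1) / 2 * d0" .
  then have kp: "\<kappa> powr (p - 1) = lam powr (p - 1) / 2"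
    using mult_right_cancel d0(2) by (metis less_irrefl)
  have "\<kappa> = (\<kappa> powr (p - 1)) powr (1 / (p - 1))" using \<kappa> p_gt_1 by (simp add: powr_powr)
  also have "\<dots> = lam * 2 powr (- 1 / (p - 1))"
    using lam_pos p_gt_1 by (simp add: kp powr_divide powr_powr powr_minus_divide)
  finally have keq: "\<kappa> = lam * 2 powr (- 1 / (p - 1))" .
  \<comment> \<open>Since \<rho> lam^p = lam, the factor \<open>lam ^ n\<close> is exactly what
    separates the share of the n-th subcell from the energy of its blow-up.\<close>
  have fr: "frac (replicate n 1) anti / lam ^ n = E ((1 / lam ^ n) *\<^sub>R ((H 1 ^^ n) anti - (lam, lam, lam))) / E anti" for n
  proof -
    define z where "z = (1 / lam ^ n) *\<^sub>R ((H 1 ^^ n) anti - (lam, lam, lam))"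
    have "(H 1 ^^ n) anti = lam ^ n *\<^sub>R z + (lam, lam, lam)" using lam_pos by (simp add: z_def)
    then have "E ((H 1 ^^ n) anti) = (lam ^ n) powr p * E z"
      using lam_pos by (simp add: E_shift E_scale)
    also have "(lam ^ n) powr p = (lam powr p) ^ n" using lam_pos by (simp add: powr_power powr_realpow[symmetric] powr_powr mult.commute)
    also have "lam powr p = lam powr (p - 1) * lam" using lam_pos by (simp add: powr_diff)
    finally have "\<rho> ^ n * E ((H 1 ^^ n) anti) = (\<rho> * lam powr (p - 1)) ^ n * lam ^ n * E z"
      by (simp add: power_mult_distrib)
    then have "\<rho> ^ n * E ((H 1 ^^ n) anti) = lam ^ n * E z" by (simp add: rho_lam)
    then show ?thesis using lam_pos by (simp add: frac_def fold_replicate z_def)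
  qed
  have "(\<lambda>n. frac (replicate n 1) anti / lam ^ n) \<longlonglongrightarrow> E (0, \<kappa>, \<kappa>) / E anti"
    unfolding fr by (intro tendsto_intros tendsto_E lim E_anti)
  moreover have "E (0, \<kappa>, \<kappa>) = \<kappa> powr p * E (0, 1, 1)" using E_scale[of \<kappa> "(0, 1, 1)"] \<kappa> by simp
  moreover have "\<kappa> powr p * E (0, 1, 1) / E anti = \<kappa> / (1 - lam)"
  proof -
    have E1: "p * E (0, 1, 1) = - d0" using d0(1) by simp
    have "\<kappa> powr p * E (0, 1, 1) / E anti = \<kappa> powr p * (p * E (0, 1, 1)) / (p * E anti)" using p_gt_1 by simp
    also have "\<dots> = (\<kappa> * \<kappa> powr (p - 1)) * (- d0) / (- (1 - lam) * (lam powr (p - 1) * d0 / 2))"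
      using \<kappa> by (simp only: E1 Ea) (simp add: powr_diff)
    also have "\<dots> = \<kappa> / (1 - lam)" using d0(2) lam_pos lam_less_1 by (simp add: kp field_simps)
    finally show ?thesis .
  qed
  ultimately show ?thesis by (simp add: keq)
qed

text \<open>The three fluxes sum to 0, so two zeros give a third, and then the energy vanishes by
  Euler's identity.\<close>

lemma two_fluxes_nonzero:
  assumes "E x \<noteq> 0"
  shows "D x (1, 0, 0) \<noteq> 0 \<or> D x (0, 1, 0) \<noteq> 0" "D x (1, 0, 0) \<noteq> 0 \<or> D x (0, 0, 1) \<noteq> 0"
    "D x (0, 1, 0) \<noteq> 0 \<or> D x (0, 0, 1) \<noteq> 0"
proof -
  obtain x1 x2 x3 where x: "x = (x1, x2, x3)" by (cases x)
  have "D x x \<noteq> 0" using assms p_gt_1 by (simp add: D_self)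
  then show "D x (1, 0, 0) \<noteq> 0 \<or> D x (0, 1, 0) \<noteq> 0" "D x (1, 0, 0) \<noteq> 0 \<or> D x (0, 0, 1) \<noteq> 0"
    "D x (0, 1, 0) \<noteq> 0 \<or> D x (0, 0, 1) \<noteq> 0"
    using D_coords[of x x1 x2 x3] D_sum[of x] by (auto simp: x)
qed

end

section \<open>Rigidity for two different exponents\<close>

locale two_renorm_forms =
  P: renorm_form p E \<rho> + Q: renorm_form q E' \<rho>' for p E \<rho> q E' \<rho>' +
  assumes p_neq_q: "p \<noteq> q"
begin

lemma no_common_frac_sym:
  assumes eq: "\<And>w. set w \<subseteq> alphabet \<Longrightarrow> P.frac w (0, 1, 1) = Q.frac w (0, 1, 1)"
  shows False
proof -
  have lam: "P.lam = Q.lam" using eq[of "[1]"] P.frac_sym_1 Q.frac_sym_1 by (simp add: alphabet_def)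
  have anti: "P.frac w P.anti = Q.frac w Q.anti" if "set w \<subseteq> alphabet" for w
    using eq[of "[2]"] eq[of "2 # w"] that P.frac_sym_2(1)[of w] Q.frac_sym_2(1)[of w] P.frac_sym_2(2)
    by (simp add: alphabet_def)
  have "P.frac (replicate n 1) P.anti = Q.frac (replicate n 1) Q.anti" for n
    by (rule anti) (auto simp: alphabet_def)
  then have "(\<lambda>n. P.frac (replicate n 1) P.anti / P.lam ^ n) \<longlonglongrightarrow> Q.lam * 2 powr (- 1 / (q - 1)) / (1 - Q.lam)"
    using Q.frac_anti_limit by (simp add: lam)
  with P.frac_anti_limit
  have "P.lam * 2 powr (- 1 / (p - 1)) / (1 - P.lam) = Q.lam * 2 powr (- 1 / (q - 1)) / (1 - Q.lam)"
    by (rule LIMSEQ_unique)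
  then have "2 powr (- 1 / (p - 1)) = (2 :: real) powr (- 1 / (q - 1))"
    using Q.lam_pos Q.lam_less_1 by (simp add: lam)
  then have "- 1 / (p - 1) = - 1 / (q - 1)" by (simp add: powr_inj)
  then show False using p_neq_q P.p_gt_1 Q.p_gt_1 by (simp add: field_simps)
qed

text \<open>Dividing by the common share of the n-th cell at vertex 1 carries the equality over to
  that cell. For large n both sides approach the distributions of the symmetric functions, whatever
  x and y were.\<close>

lemma no_common_frac_1:
  assumes eq: "\<And>w. set w \<subseteq> alphabet \<Longrightarrow> P.frac w x = Q.frac w y"
    and x: "P.D x (1, 0, 0) \<noteq> 0" and y: "Q.D y (1, 0, 0) \<noteq> 0"
  shows False
proof (rule no_common_frac_sym)
  fix w assume w: "set w \<subseteq> alphabet"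
  have "P.frac w ((P.H 1 ^^ n) x) = Q.frac w ((Q.H 1 ^^ n) y)" for n
  proof -
    have "P.D ((P.H 1 ^^ n) x) (1, 0, 0) \<noteq> 0" "Q.D ((Q.H 1 ^^ n) y) (1, 0, 0) \<noteq> 0"
      using x y P.flux_H1[of x n] Q.flux_H1[of y n] by auto
    then have nz: "E ((P.H 1 ^^ n) x) \<noteq> 0" "E' ((Q.H 1 ^^ n) y) \<noteq> 0"
      using P.E_nonzero_of_flux Q.E_nonzero_of_flux by blast+
    then have "P.frac (replicate n 1) x \<noteq> 0"
      using P.rho_pos P.E_nonzero_of_flux[OF x] by (simp add: P.frac_def fold_replicate)
    moreover have "P.frac (replicate n 1) x = Q.frac (replicate n 1) y"
      "P.frac (replicate n 1 @ w) x = Q.frac (replicate n 1 @ w) y"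
      using w by (intro eq; auto simp: alphabet_def)+
    ultimately show ?thesis
      using P.frac_append[of "replicate n 1" x w] Q.frac_append[of "replicate n 1" y w] nz
      by (simp add: fold_replicate)
  qed
  then show "P.frac w (0, 1, 1) = Q.frac w (0, 1, 1)"
    using P.frac_blowup[OF x, of w] Q.frac_blowup[OF y, of w] LIMSEQ_unique by fastforce
qed

theorem no_common_frac:
  assumes eq: "\<And>w. set w \<subseteq> alphabet \<Longrightarrow> P.frac w x = Q.frac w y"
    and x: "E x \<noteq> 0" and y: "E' y \<noteq> 0"
  shows False
proof -
  obtain x1 x2 x3 y1 y2 y3 where xy: "x = (x1, x2, x3)" "y = (y1, y2, y3)" by (cases x; cases y) auto
  \<comment> \<open>Each function has zero flux at no more than one vertex, so one of the three
    vertices serves both.\<close>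
  consider "P.D x (1, 0, 0) \<noteq> 0" "Q.D y (1, 0, 0) \<noteq> 0" | "P.D x (0, 1, 0) \<noteq> 0" "Q.D y (0, 1, 0) \<noteq> 0"
    | "P.D x (0, 0, 1) \<noteq> 0" "Q.D y (0, 0, 1) \<noteq> 0"
    using P.two_fluxes_nonzero[OF x] Q.two_fluxes_nonzero[OF y] by blast
  then show False
  proof cases
    case 1
    then show False using no_common_frac_1[OF eq] by blast
  next
    case 2
    have "P.frac w (x2, x1, x3) = Q.frac w (y2, y1, y3)" if "set w \<subseteq> alphabet" for w
    proof -
      have "set (map (Transposition.transpose 1 2) w) \<subseteq> alphabet" using that by (auto simp: alphabet_def transpose_def)
      from eq[OF this] P.frac_swap12[OF that, of x1 x2 x3] Q.frac_swap12[OF that, of y1 y2 y3]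
      show ?thesis by (simp add: xy o_def)
    qed
    then show False using no_common_frac_1[of "(x2, x1, x3)" "(y2, y1, y3)"] 2
        P.D_swap12[of x1 x2 x3 0 1 0] Q.D_swap12[of y1 y2 y3 0 1 0] by (simp add: xy)
  next
    case 3
    have "P.frac w (x3, x2, x1) = Q.frac w (y3, y2, y1)" if "set w \<subseteq> alphabet" for w
    proof -
      have "set (map (Transposition.transpose 1 3) w) \<subseteq> alphabet" using that by (auto simp: alphabet_def transpose_def)
      from eq[OF this] P.frac_swap13[OF that, of x1 x2 x3] Q.frac_swap13[OF that, of y1 y2 y3]
      show ?thesis by (simp add: xy o_def)
    qed
    then show False using no_common_frac_1[of "(x3, x2, x1)" "(y3, y2, y1)"] 3
        P.D_swap13[of x1 x2 x3 0 0 1] Q.D_swap13[of y1 y2 y3 0 0 1] by (simp add: xy)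
  qed
qed

end

section \<open>Trees of finite energy\<close>

lemma finite_words [simp]: "finite (words n)"
  unfolding words_def alphabet_def
  by (rule finite_subset[OF _ finite_lists_length_eq[of "{1, 2, 3}" n]]) auto

lemma words_0 [simp]: "words 0 = {[]}"
  by (auto simp: words_def)

lemma sum_words_add: "(\<Sum>w\<in>words (n + m). f w) = (\<Sum>v\<in>words n. \<Sum>w\<in>words m. f (v @ w))"
proof -
  have "(\<Sum>v\<in>words n. \<Sum>w\<in>words m. f (v @ w)) = (\<Sum>(v, w)\<in>words n \<times> words m. f (v @ w))"
    by (rule sum.cartesian_product)
  also have "\<dots> = (\<Sum>w\<in>words (n + m). f w)"
    by (rule sum.reindex_bij_witness[where i = "\<lambda>w. (take n w, drop n w)" and j = "\<lambda>(v, w). v @ w"])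
       (auto simp: words_def dest: in_set_takeD in_set_dropD)
  finally show ?thesis by simp
qed

lemma sum_words_1: "(\<Sum>w\<in>words (Suc 0). f w) = f [1] + f [2] + (f [3] :: real)"
proof -
  have "words (Suc 0) = {[1], [2], [3]}" by (auto simp: words_def alphabet_def length_Suc_conv)
  then show ?thesis by simp
qed

lemma sum_sqrt_le:
  fixes a b :: "'a \<Rightarrow> real"
  assumes "\<And>i. i \<in> A \<Longrightarrow> 0 \<le> a i" "\<And>i. i \<in> A \<Longrightarrow> 0 \<le> b i"
  shows "(\<Sum>i\<in>A. sqrt (a i * b i)) \<le> sqrt (sum a A * sum b A)"
proof (rule real_le_rsqrt)
  have "(\<Sum>i\<in>A. sqrt (a i) * sqrt (b i))\<^sup>2 \<le> (\<Sum>i\<in>A. (sqrt (a i))\<^sup>2) * (\<Sum>i\<in>A. (sqrt (b i))\<^sup>2)"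
    by (rule Cauchy_Schwarz_ineq_sum)
  then show "(\<Sum>i\<in>A. sqrt (a i * b i))\<^sup>2 \<le> sum a A * sum b A"
    using assms by (simp add: real_sqrt_mult)
qed

text \<open>For the tree of vertex values of a function u this is the tree of u composed with the
  map of the cell w.\<close>

definition subtree :: "nat list \<Rightarrow> (nat list \<Rightarrow> 'a) \<Rightarrow> nat list \<Rightarrow> 'a" where
  "subtree w X = (\<lambda>v. X (w @ v))"

lemma subtree_simps [simp]: "subtree w X v = X (w @ v)" "subtree [] X = X"
  "subtree v (subtree w X) = subtree (w @ v) X"
  by (simp_all add: subtree_def)

text \<open>A function on the vertices of all levels is recorded by one triple per cell; the
  condition says that a cell shares a vertex with each subcell and that the subcells meet in pairs.
  Such trees can be rescaled and passed to limits without reference to points of the plane.\<close>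

definition compatible :: "(nat list \<Rightarrow> real \<times> real \<times> real) \<Rightarrow> bool" where
  "compatible X \<longleftrightarrow> (\<forall>w. \<exists>x1 x2 x3 a b c. X w = (x1, x2, x3) \<and>
     X (w @ [1]) = (x1, a, b) \<and> X (w @ [2]) = (a, x2, c) \<and> X (w @ [3]) = (b, c, x3))"

lemma compatible_subtree: "compatible X \<Longrightarrow> compatible (subtree w X)"
  by (simp add: compatible_def flip: append_assoc)

lemma compatible_affine:
  assumes "compatible X"
  shows "compatible (\<lambda>w. k *\<^sub>R (X w - (c, c, c)))"
  unfolding compatible_def
proof
  fix w
  obtain x1 x2 x3 y1 y2 y3 where "X w = (x1, x2, x3) \<and>
     X (w @ [1]) = (x1, y1, y2) \<and> X (w @ [2]) = (y1, x2, y3) \<and> X (w @ [3]) = (y2, y3, x3)"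
    using assms unfolding compatible_def by blast
  then show "\<exists>x1 x2 x3 y1 y2 y3. k *\<^sub>R (X w - (c, c, c)) = (x1, x2, x3) \<and>
     k *\<^sub>R (X (w @ [1]) - (c, c, c)) = (x1, y1, y2) \<and> k *\<^sub>R (X (w @ [2]) - (c, c, c)) = (y1, x2, y3) \<and>
     k *\<^sub>R (X (w @ [3]) - (c, c, c)) = (y2, y3, x3)"
    by simp
qed

context renorm_form
begin

definition level_energy :: "(nat list \<Rightarrow> real \<times> real \<times> real) \<Rightarrow> nat \<Rightarrow> real" where
  "level_energy X n = (\<Sum>w\<in>words n. \<rho> ^ n * E (X w))"

definition energy :: "(nat list \<Rightarrow> real \<times> real \<times> real) \<Rightarrow> real" where
  "energy X = lim (level_energy X)"

definition finite_energy :: "(nat list \<Rightarrow> real \<times> real \<times> real) \<Rightarrow> bool" where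
  "finite_energy X \<longleftrightarrow> compatible X \<and> convergent (level_energy X)"

text \<open>The value of the energy measure on the cell w.\<close>

definition mass :: "(nat list \<Rightarrow> real \<times> real \<times> real) \<Rightarrow> nat list \<Rightarrow> real" where
  "mass X w = \<rho> ^ length w * energy (subtree w X)"

lemma E_le_children:
  assumes "compatible X"
  shows "E (X w) \<le> \<rho> * (E (X (w @ [1])) + E (X (w @ [2])) + E (X (w @ [3])))"
proof -
  obtain x1 x2 x3 a b c where "X w = (x1, x2, x3)" "X (w @ [1]) = (x1, a, b)"
    "X (w @ [2]) = (a, x2, c)" "X (w @ [3]) = (b, c, x3)"
    using assms unfolding compatible_def by metis
  then show ?thesis using renorm_le[of x1 x2 x3 a b c] by simp
qed

lemma level_energy_mono:
  assumes "compatible X"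
  shows "level_energy X n \<le> level_energy X (Suc n)"
proof -
  have "level_energy X (Suc n) = (\<Sum>w\<in>words n. \<rho> ^ n * (\<rho> * (E (X (w @ [1])) + E (X (w @ [2])) + E (X (w @ [3])))))"
    using sum_words_add[of "\<lambda>w. \<rho> ^ Suc n * E (X w)" n 1]
    by (simp add: level_energy_def sum_words_1 algebra_simps)
  then show ?thesis using E_le_children[OF assms] rho_pos
    by (simp add: level_energy_def sum_mono)
qed

lemma level_energy_Suc:
  "level_energy X (Suc n) = \<rho> * (level_energy (subtree [1] X) n + level_energy (subtree [2] X) n + level_energy (subtree [3] X) n)"
  using sum_words_add[of "\<lambda>w. \<rho> ^ Suc n * E (X w)" 1 n]
  by (simp add: level_energy_def sum_words_1 algebra_simps sum_distrib_left)

lemma level_energy_nonneg: "0 \<le> level_energy X n"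
  using rho_pos by (auto simp: level_energy_def E_nonneg intro!: sum_nonneg)

lemma level_energy_le:
  assumes "finite_energy X"
  shows "level_energy X n \<le> energy X"
proof -
  have "incseq (level_energy X)"
    using assms level_energy_mono by (intro incseq_SucI) (auto simp: finite_energy_def)
  moreover have "level_energy X \<longlonglongrightarrow> energy X"
    using assms by (simp add: finite_energy_def energy_def convergent_LIMSEQ_iff)
  ultimately show ?thesis by (rule incseq_le)
qed

lemma energy_limit: "finite_energy X \<Longrightarrow> level_energy X \<longlonglongrightarrow> energy X"
  by (simp add: finite_energy_def energy_def convergent_LIMSEQ_iff)

lemma energy_nonneg: "finite_energy X \<Longrightarrow> 0 \<le> energy X"
  using level_energy_le[of X 0] level_energy_nonneg[of X 0] by simp

lemma E_le_energy: "finite_energy X \<Longrightarrow> E (X []) \<le> energy X"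
  using level_energy_le[of X 0] by (simp add: level_energy_def)

lemma finite_energy_child:
  assumes X: "finite_energy X" and i: "i \<in> alphabet"
  shows "finite_energy (subtree [i] X)"
proof -
  have c: "compatible (subtree [i] X)" using X by (simp add: finite_energy_def compatible_subtree)
  have "\<rho> * level_energy (subtree [i] X) n \<le> level_energy X (Suc n)" for n
    using i rho_pos level_energy_nonneg[of "subtree [1] X" n] level_energy_nonneg[of "subtree [2] X" n]
      level_energy_nonneg[of "subtree [3] X" n]
    by (auto simp: level_energy_Suc alphabet_def)
  then have "\<rho> * level_energy (subtree [i] X) n \<le> energy X" for n
    using level_energy_le[OF X] order_trans by blast
  then have "level_energy (subtree [i] X) n \<le> energy X / \<rho>" for n using rho_pos by (simp add: field_simps)
  then have "Bseq (level_energy (subtree [i] X))"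
    using level_energy_nonneg by (intro BseqI'[of _ "energy X / \<rho>"]) simp
  moreover have "incseq (level_energy (subtree [i] X))"
    using level_energy_mono[OF c] by (rule incseq_SucI)
  ultimately have "convergent (level_energy (subtree [i] X))" by (intro Bseq_monoseq_convergent incseq_imp_monoseq)
  then show ?thesis using c by (simp add: finite_energy_def)
qed

lemma finite_energy_subtree:
  "finite_energy X \<Longrightarrow> set w \<subseteq> alphabet \<Longrightarrow> finite_energy (subtree w X)"
proof (induction w arbitrary: X)
  case (Cons i w)
  have "finite_energy (subtree w (subtree [i] X))" using Cons by (intro Cons.IH finite_energy_child) auto
  then show ?case by (simp add: subtree_def)
qed simp

lemma energy_children:
  assumes "finite_energy X"
  shows "energy X = \<rho> * (energy (subtree [1] X) + energy (subtree [2] X) + energy (subtree [3] X))"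
proof -
  have "(\<lambda>n. level_energy X (Suc n)) \<longlonglongrightarrow> \<rho> * (energy (subtree [1] X) + energy (subtree [2] X) + energy (subtree [3] X))"
    unfolding level_energy_Suc
    by (intro tendsto_intros energy_limit finite_energy_child assms) (simp_all add: alphabet_def)
  moreover have "(\<lambda>n. level_energy X (Suc n)) \<longlonglongrightarrow> energy X"
    using energy_limit[OF assms] by (simp add: filterlim_sequentially_Suc)
  ultimately show ?thesis using LIMSEQ_unique by blast
qed

lemma mass_nonneg: "finite_energy X \<Longrightarrow> set w \<subseteq> alphabet \<Longrightarrow> 0 \<le> mass X w"
  using rho_pos by (simp add: mass_def energy_nonneg finite_energy_subtree)

lemma mass_append: "mass X (v @ w) = \<rho> ^ length v * mass (subtree v X) w"
  by (simp add: mass_def power_add)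

lemma mass_Nil: "mass X [] = energy X"
  by (simp add: mass_def)

lemma sum_mass:
  assumes "finite_energy X"
  shows "(\<Sum>w\<in>words n. mass X w) = energy X"
proof (induction n)
  case (Suc n)
  have "(\<Sum>w\<in>words (n + 1). mass X w) = (\<Sum>w\<in>words n. mass X (w @ [1]) + mass X (w @ [2]) + mass X (w @ [3]))"
    unfolding sum_words_add by (simp add: sum_words_1)
  also have "\<dots> = (\<Sum>w\<in>words n. mass X w)"
  proof (rule sum.cong[OF refl])
    fix w assume "w \<in> words n"
    then have "finite_energy (subtree w X)" using assms by (intro finite_energy_subtree) (auto simp: words_def)
    from energy_children[OF this] show "mass X (w @ [1]) + mass X (w @ [2]) + mass X (w @ [3]) = mass X w"
      by (simp add: mass_def algebra_simps)
  qed
  finally show ?case using Suc by simp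
qed (simp add: mass_Nil)

text \<open>Stability of the minimization problem: data and energies are bounded, so the midpoint
  values are; every limit point is a minimizer for l and hence equals \<open>mid l\<close>.\<close>

lemma near_minimizer_limit:
  assumes x: "x \<longlonglongrightarrow> l" and t: "t \<longlonglongrightarrow> E l" and le: "\<And>n. \<rho> * total (x n) (m n) \<le> t n"
  shows "m \<longlonglongrightarrow> mid l"
proof (rule ccontr)
  assume "\<not> m \<longlonglongrightarrow> mid l"
  then obtain \<epsilon> where \<epsilon>: "0 < \<epsilon>" "\<not> (\<forall>\<^sub>F n in sequentially. dist (m n) (mid l) < \<epsilon>)"
    by (auto simp: tendsto_iff)
  from not_eventually_sequentiallyD[OF this(2)]
  obtain r :: "nat \<Rightarrow> nat" where r: "strict_mono r" "\<And>n. \<not> dist (m (r n)) (mid l) < \<epsilon>" by blast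
  obtain C where C: "\<And>x1 x2 x3 a b c L. \<rho> * total (x1, x2, x3) (a, b, c) \<le> L \<Longrightarrow>
    \<bar>x1 - a\<bar> \<le> (C * L) powr (1 / p) \<and> \<bar>x1 - b\<bar> \<le> (C * L) powr (1 / p) \<and> \<bar>x2 - c\<bar> \<le> (C * L) powr (1 / p)"
    by (rule total_bound) (rule that)
  obtain B where B: "\<And>n. norm (x n) \<le> B" using convergent_imp_bounded[OF x] by (auto simp: bounded_iff)
  obtain L where L: "\<And>n. norm (t n) \<le> L" using convergent_imp_bounded[OF t] by (auto simp: bounded_iff)
  define R where "R = (C * L) powr (1 / p)"
  have "norm (m n) \<le> (B + R) + ((B + R) + (B + R))" for n
  proof -
    obtain x1 x2 x3 a b c where eq: "x n = (x1, x2, x3)" "m n = (a, b, c)" by (cases "x n"; cases "m n") auto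
    have "t n \<le> L" using L[of n] by simp
    then have "\<rho> * total (x1, x2, x3) (a, b, c) \<le> L" using le[of n] eq by simp
    from C[OF this] have "\<bar>x1 - a\<bar> \<le> R \<and> \<bar>x1 - b\<bar> \<le> R \<and> \<bar>x2 - c\<bar> \<le> R" by (simp add: R_def)
    moreover have "\<bar>x1\<bar> \<le> B" "\<bar>x2\<bar> \<le> B"
      using B[of n] norm_fst_le[of x1 "(x2, x3)"] norm_snd_le[of "(x2, x3)" x1] norm_fst_le[of x2 x3] eq by auto
    ultimately show ?thesis using norm_triple_le[of a b c] unfolding eq by linarith
  qed
  then have "bounded (range (m \<circ> r))" by (auto intro: boundedI)
  then obtain m' s where s: "strict_mono s" "((m \<circ> r) \<circ> s) \<longlonglongrightarrow> m'"
    using bounded_imp_convergent_subsequence by blast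
  define h where "h = r \<circ> s"
  have h: "strict_mono h" using r s by (simp add: h_def strict_mono_o)
  have "(\<lambda>n. m (h n)) \<longlonglongrightarrow> m'" using s by (simp add: h_def o_def)
  moreover have "(\<lambda>n. x (h n)) \<longlonglongrightarrow> l" "(\<lambda>n. t (h n)) \<longlonglongrightarrow> E l"
    using LIMSEQ_subseq_LIMSEQ[OF x h] LIMSEQ_subseq_LIMSEQ[OF t h] by (simp_all add: o_def)
  ultimately have "\<rho> * total l m' \<le> E l"
    by (intro LIMSEQ_le[of "\<lambda>n. \<rho> * total (x (h n)) (m (h n))" _ "\<lambda>n. t (h n)"] tendsto_intros tendsto_total)
       (auto intro: le)
  then have "m' = mid l" using mid_eqI by simp
  with \<open>(\<lambda>n. m (h n)) \<longlonglongrightarrow> m'\<close> \<epsilon>(1) have "\<forall>\<^sub>F n in sequentially. dist (m (h n)) (mid l) < \<epsilon>"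
    by (auto simp: tendsto_iff)
  then show False using r(2) by (auto simp: h_def)
qed

text \<open>Here \<open>e n w\<close> stands for the energy carried by the cell w, an additive
  quantity dominating the energy seen at its vertices. If no excess remains at the root in the
  limit, none remains at the children, because their excesses are nonnegative and sum, up to the
  factor \<rho>, to at most that of the parent. So harmonicity in the limit spreads down the
  tree.\<close>

lemma near_harmonic_limit:
  assumes X: "\<And>n. compatible (X n)" and E_e: "\<And>n w. set w \<subseteq> alphabet \<Longrightarrow> E (X n w) \<le> e n w"
    and e: "\<And>n w. set w \<subseteq> alphabet \<Longrightarrow> e n w = \<rho> * (e n (w @ [1]) + e n (w @ [2]) + e n (w @ [3]))"
    and x: "(\<lambda>n. X n []) \<longlonglongrightarrow> x" and ex: "(\<lambda>n. e n []) \<longlonglongrightarrow> E x"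
    and w: "set w \<subseteq> alphabet"
  shows "(\<lambda>n. X n w) \<longlonglongrightarrow> fold H w x \<and> (\<lambda>n. e n w) \<longlonglongrightarrow> E (fold H w x)"
  using w
proof (induction w rule: rev_induct)
  case Nil
  then show ?case using x ex by simp
next
  case (snoc i w)
  define y where "y = fold H w x"
  have Xw: "(\<lambda>n. X n w) \<longlonglongrightarrow> y" and ew: "(\<lambda>n. e n w) \<longlonglongrightarrow> E y" using snoc by (auto simp: y_def)
  have "\<exists>m. fst m = fst (snd (X n (w @ [1]))) \<and> X n (w @ [1]) = (fst (X n w), fst m, fst (snd m)) \<and>
      X n (w @ [2]) = (fst m, fst (snd (X n w)), snd (snd m)) \<and>
      X n (w @ [3]) = (fst (snd m), snd (snd m), snd (snd (X n w)))" for n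
  proof -
    obtain x1 x2 x3 a b c where "X n w = (x1, x2, x3)" "X n (w @ [1]) = (x1, a, b)"
      "X n (w @ [2]) = (a, x2, c)" "X n (w @ [3]) = (b, c, x3)"
      using X[of n] unfolding compatible_def by metis
    then show ?thesis by (intro exI[of _ "(a, b, c)"]) simp
  qed
  then obtain m where m: "\<And>n. X n (w @ [1]) = (fst (X n w), fst (m n), fst (snd (m n)))"
      "\<And>n. X n (w @ [2]) = (fst (m n), fst (snd (X n w)), snd (snd (m n)))"
      "\<And>n. X n (w @ [3]) = (fst (snd (m n)), snd (snd (m n)), snd (snd (X n w)))"
    by metis
  have tot: "total (X n w) (m n) = E (X n (w @ [1])) + E (X n (w @ [2])) + E (X n (w @ [3]))" for n
    unfolding m by (cases "X n w"; cases "m n") simp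
  have eq: "e n w = \<rho> * (e n (w @ [1]) + e n (w @ [2]) + e n (w @ [3]))" for n
    using snoc.prems by (intro e) auto
  have E_child: "E (X n (w @ [j])) \<le> e n (w @ [j])" if "j \<in> alphabet" for n j
    using snoc.prems that by (intro E_e) auto
  have mlim: "m \<longlonglongrightarrow> mid y"
  proof (rule near_minimizer_limit[OF Xw ew])
    fix n
    have "\<rho> * total (X n w) (m n) \<le> \<rho> * (e n (w @ [1]) + e n (w @ [2]) + e n (w @ [3]))"
      unfolding tot using rho_pos by (intro mult_left_mono add_mono E_child) (auto simp: alphabet_def)
    then show "\<rho> * total (X n w) (m n) \<le> e n w" by (simp add: eq)
  qed
  obtain y1 y2 y3 a b c where y: "y = (y1, y2, y3)" and my: "mid (y1, y2, y3) = (a, b, c)"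
    by (cases y; cases "mid y") auto
  have lims: "(\<lambda>n. X n (w @ [1])) \<longlonglongrightarrow> H 1 y" "(\<lambda>n. X n (w @ [2])) \<longlonglongrightarrow> H 2 y" "(\<lambda>n. X n (w @ [3])) \<longlonglongrightarrow> H 3 y"
  proof -
    have "(\<lambda>n. (fst (X n w), fst (m n), fst (snd (m n)))) \<longlonglongrightarrow> (fst y, fst (mid y), fst (snd (mid y)))"
      "(\<lambda>n. (fst (m n), fst (snd (X n w)), snd (snd (m n)))) \<longlonglongrightarrow> (fst (mid y), fst (snd y), snd (snd (mid y)))"
      "(\<lambda>n. (fst (snd (m n)), snd (snd (m n)), snd (snd (X n w)))) \<longlonglongrightarrow> (fst (snd (mid y)), snd (snd (mid y)), snd (snd y))"
      by (intro tendsto_intros mlim Xw)+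
    then show "(\<lambda>n. X n (w @ [1])) \<longlonglongrightarrow> H 1 y" "(\<lambda>n. X n (w @ [2])) \<longlonglongrightarrow> H 2 y" "(\<lambda>n. X n (w @ [3])) \<longlonglongrightarrow> H 3 y"
      unfolding m y my H_simps[OF my] by simp_all
  qed
  have sum_y: "E y = \<rho> * (E (H 1 y) + E (H 2 y) + E (H 3 y))" by (rule E_H_sum)
  \<comment> \<open>The energy of one child lies between its vertex energy and what the vertex
    energies of its two siblings leave of the parent.\<close>
  have squeeze: "(\<lambda>n. e n (w @ [j])) \<longlonglongrightarrow> E z"
    if j: "(\<lambda>n. X n (w @ [j])) \<longlonglongrightarrow> z" and k: "(\<lambda>n. X n (w @ [k])) \<longlonglongrightarrow> z'" and l: "(\<lambda>n. X n (w @ [l])) \<longlonglongrightarrow> z''"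
    and s: "\<And>n. e n w = \<rho> * (e n (w @ [j]) + e n (w @ [k]) + e n (w @ [l]))"
    and sz: "E y = \<rho> * (E z + E z' + E z'')"
    and jkl: "j \<in> alphabet" "k \<in> alphabet" "l \<in> alphabet" for j k l z z' z''
  proof (rule tendsto_sandwich)
    show "\<forall>\<^sub>F n in sequentially. E (X n (w @ [j])) \<le> e n (w @ [j])" by (simp add: E_child jkl)
    show "\<forall>\<^sub>F n in sequentially. e n (w @ [j]) \<le> e n w / \<rho> - E (X n (w @ [k])) - E (X n (w @ [l]))"
    proof (intro always_eventually allI)
      fix n
      have "e n w / \<rho> = e n (w @ [j]) + e n (w @ [k]) + e n (w @ [l])" using s[of n] rho_pos by simp
      then show "e n (w @ [j]) \<le> e n w / \<rho> - E (X n (w @ [k])) - E (X n (w @ [l]))"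
        using E_child[OF jkl(2), of n] E_child[OF jkl(3), of n] by simp
    qed
    show "(\<lambda>n. E (X n (w @ [j]))) \<longlonglongrightarrow> E z" by (intro tendsto_E j)
    have "(\<lambda>n. e n w / \<rho> - E (X n (w @ [k])) - E (X n (w @ [l]))) \<longlonglongrightarrow> E y / \<rho> - E z' - E z''"
      using rho_pos by (intro tendsto_intros tendsto_E ew k l) simp
    also have "E y / \<rho> - E z' - E z'' = E z" using sz rho_pos by simp
    finally show "(\<lambda>n. e n w / \<rho> - E (X n (w @ [k])) - E (X n (w @ [l]))) \<longlonglongrightarrow> E z" .
  qed
  have i: "i = 1 \<or> i = 2 \<or> i = 3" using snoc.prems by (auto simp: alphabet_def)
  have "(\<lambda>n. X n (w @ [i])) \<longlonglongrightarrow> H i y \<and> (\<lambda>n. e n (w @ [i])) \<longlonglongrightarrow> E (H i y)"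
    using i
  proof (elim disjE)
    assume "i = 1" then show ?thesis
      using squeeze[OF lims(1) lims(2) lims(3) eq sum_y] lims by (simp add: alphabet_def)
  next
    assume "i = 2" then show ?thesis
      using squeeze[OF lims(2) lims(1) lims(3)] eq sum_y lims by (simp add: add.commute alphabet_def)
  next
    assume "i = 3" then show ?thesis
      using squeeze[OF lims(3) lims(1) lims(2)] eq sum_y lims by (simp add: algebra_simps alphabet_def)
  qed
  then show ?case by (simp add: y_def)
qed

end

section \<open>Decay of the Hellinger affinity\<close>

context renorm_form
begin

lemma sum_mass_append:
  assumes "finite_energy X" "set v \<subseteq> alphabet"
  shows "(\<Sum>w\<in>words m. mass X (v @ w)) = mass X v"
  using sum_mass[OF finite_energy_subtree[OF assms], of m]
  by (simp add: mass_append sum_distrib_left[symmetric]) (simp add: mass_def)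

lemma sum_fold_H: "(\<Sum>w\<in>words n. \<rho> ^ n * E (fold H w x)) = E x"
proof (induction n)
  case (Suc n)
  have "(\<Sum>w\<in>words (n + 1). \<rho> ^ Suc n * E (fold H w x)) = (\<Sum>w\<in>words n. \<rho> ^ n * E (fold H w x))"
    unfolding sum_words_add
  proof (rule sum.cong[OF refl])
    fix w
    show "(\<Sum>v\<in>words 1. \<rho> ^ Suc n * E (fold H (w @ v) x)) = \<rho> ^ n * E (fold H w x)"
      using E_H_sum[of "fold H w x"] by (simp add: sum_words_1 algebra_simps)
  qed
  then show ?case using Suc by simp
qed simp

text \<open>In a cell that is far from harmonic, a fixed proportion of the energy is not seen at its
  three vertices; hence such cells carry little energy at high levels.\<close>

lemma nonharmonic_mass_le:
  assumes X: "finite_energy X" and \<delta>: "0 < \<delta>"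
  shows "(\<Sum>w | w \<in> words k \<and> \<not> energy (subtree w X) \<le> (1 + \<delta>) * E (X w). mass X w)
    \<le> (1 + \<delta>) / \<delta> * (energy X - level_energy X k)"
proof -
  define B where "B = {w \<in> words k. \<not> energy (subtree w X) \<le> (1 + \<delta>) * E (X w)}"
  \<comment> \<open>In a cell of the sum the vertices see less than 1 / (1 + \<delta>) of the
    energy, so the unseen rest exceeds the fraction \<delta> / (1 + \<delta>).\<close>
  define c where "c = (1 + \<delta>) / \<delta>"
  have alph: "set w \<subseteq> alphabet" "length w = k" if "w \<in> words k" for w using that by (auto simp: words_def)
  have "(\<Sum>w\<in>B. mass X w) \<le> (\<Sum>w\<in>B. c * (mass X w - \<rho> ^ k * E (X w)))"
  proof (rule sum_mono)
    fix w assume w: "w \<in> B"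
    then have "(1 + \<delta>) * E (X w) \<le> energy (subtree w X)" by (simp add: B_def)
    then have "energy (subtree w X) * \<delta> \<le> (1 + \<delta>) * (energy (subtree w X) - E (X w))" by (simp add: algebra_simps)
    then have "energy (subtree w X) \<le> c * (energy (subtree w X) - E (X w))" using \<delta> by (simp add: c_def field_simps)
    then have "\<rho> ^ k * energy (subtree w X) \<le> \<rho> ^ k * (c * (energy (subtree w X) - E (X w)))"
      using rho_pos by (intro mult_left_mono) auto
    then show "mass X w \<le> c * (mass X w - \<rho> ^ k * E (X w))"
      using w alph(2)[of w] by (simp add: mass_def B_def algebra_simps)
  qed
  also have "\<dots> \<le> (\<Sum>w\<in>words k. c * (mass X w - \<rho> ^ k * E (X w)))"
  proof (rule sum_mono2)
    fix w assume w: "w \<in> words k - B"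
    have "E (X w) \<le> energy (subtree w X)" using E_le_energy[OF finite_energy_subtree[OF X alph(1)]] w by simp
    then have "\<rho> ^ k * E (X w) \<le> \<rho> ^ k * energy (subtree w X)" using rho_pos by (intro mult_left_mono) auto
    then show "0 \<le> c * (mass X w - \<rho> ^ k * E (X w))"
      using w alph(2)[of w] \<delta> by (auto simp: mass_def c_def)
  qed (auto simp: B_def)
  also have "\<dots> = c * (energy X - level_energy X k)"
    by (simp add: sum_subtractf sum_mass[OF X] level_energy_def flip: sum_distrib_left)
  finally show ?thesis by (simp add: B_def c_def)
qed

text \<open>Compactness modulo constants and multiples; the convergent subsequence in
  \<open>uniform_affinity_gap\<close> comes from here.\<close>

lemma normalized_bounded: "\<exists>R. \<forall>x. fst x = 0 \<longrightarrow> E x = 1 \<longrightarrow> norm x \<le> R"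
proof -
  obtain C where C: "\<And>x y z L. E (x, y, z) \<le> L \<Longrightarrow>
    \<bar>x - y\<bar> \<le> (C * L) powr (1 / p) \<and> \<bar>x - z\<bar> \<le> (C * L) powr (1 / p) \<and> \<bar>y - z\<bar> \<le> (C * L) powr (1 / p)"
    by (rule E_oscillation) (rule that)
  have "norm x \<le> C powr (1 / p) + C powr (1 / p)" if "fst x = 0" "E x = 1" for x
  proof -
    obtain b c where x: "x = (0, b, c)" using \<open>fst x = 0\<close> by (cases x) auto
    show ?thesis using C[of 0 b c 1] that norm_triple_le[of 0 b c] by (simp add: x)
  qed
  then show ?thesis by blast
qed

definition normalize :: "(nat list \<Rightarrow> real \<times> real \<times> real) \<Rightarrow> nat list \<Rightarrow> real \<times> real \<times> real" where
  "normalize X = (\<lambda>w. ((1 / E (X [])) powr (1 / p)) *\<^sub>R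
     (X w - (fst (X []), fst (X []), fst (X []))))"

lemma compatible_normalize: "compatible X \<Longrightarrow> compatible (normalize X)"
  unfolding normalize_def by (rule compatible_affine)

lemma E_normalize: "E (normalize X w) = E (X w) / E (X [])"
proof -
  have "E (X w - (c, c, c)) = E (X w)" for c using E_shift[of "X w - (c, c, c)" c] by simp
  then show ?thesis using p_gt_1 E_nonneg[of "X []"]
    by (simp add: normalize_def E_scale powr_powr)
qed

lemma fst_normalize: "fst (normalize X []) = 0"
  by (cases "X []") (simp add: normalize_def)

end

section \<open>Hellinger affinity of the two energy distributions\<close>

context two_renorm_forms
begin

definition affinity :: "(nat list \<Rightarrow> real \<times> real \<times> real) \<Rightarrow> (nat list \<Rightarrow> real \<times> real \<times> real) \<Rightarrow> nat \<Rightarrow> real" where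
  "affinity X Y n = (\<Sum>w\<in>words n. sqrt (P.mass X w * Q.mass Y w))"

lemma affinity_nonneg:
  "P.finite_energy X \<Longrightarrow> Q.finite_energy Y \<Longrightarrow> 0 \<le> affinity X Y n"
  unfolding affinity_def
  by (intro sum_nonneg real_sqrt_ge_zero mult_nonneg_nonneg P.mass_nonneg Q.mass_nonneg) (auto simp: words_def)

lemma affinity_local_le:
  assumes "P.finite_energy X" "Q.finite_energy Y" "set v \<subseteq> alphabet"
  shows "(\<Sum>w\<in>words m. sqrt (P.mass X (v @ w) * Q.mass Y (v @ w))) \<le> sqrt (P.mass X v * Q.mass Y v)"
proof -
  have "(\<Sum>w\<in>words m. sqrt (P.mass X (v @ w) * Q.mass Y (v @ w)))
      \<le> sqrt ((\<Sum>w\<in>words m. P.mass X (v @ w)) * (\<Sum>w\<in>words m. Q.mass Y (v @ w)))"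
    using assms by (intro sum_sqrt_le P.mass_nonneg Q.mass_nonneg) (auto simp: words_def)
  then show ?thesis by (simp add: P.sum_mass_append Q.sum_mass_append assms)
qed

lemma affinity_add_le:
  assumes "P.finite_energy X" "Q.finite_energy Y"
  shows "affinity X Y (n + m) \<le> affinity X Y n"
  unfolding affinity_def sum_words_add
  by (intro sum_mono affinity_local_le assms) (auto simp: words_def)

text \<open>Otherwise normalized trees violating the bound at larger and larger levels would converge
  to a pair of harmonic trees with equal energy distributions.\<close>

lemma uniform_affinity_gap:
  "\<exists>N \<delta>. 0 < \<delta> \<and> \<delta> \<le> 1 \<and> (\<forall>X Y. P.finite_energy X \<longrightarrow> Q.finite_energy Y \<longrightarrow>
     P.energy X \<le> (1 + \<delta>) * E (X []) \<longrightarrow> Q.energy Y \<le> (1 + \<delta>) * E' (Y []) \<longrightarrow>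
     affinity X Y N \<le> (1 - \<delta>) * sqrt (P.energy X * Q.energy Y))"
proof (rule ccontr)
  assume contra: "\<not> ?thesis"
  \<comment> \<open>Level and tolerance are coupled: the n-th pair of trees violates the bound at
    level n with tolerance \<open>\<delta> n\<close>.\<close>
  define \<delta> where "\<delta> n = 1 / real (Suc n)" for n
  have \<delta>: "0 < \<delta> n" "\<delta> n \<le> 1" for n by (auto simp: \<delta>_def)
  have \<delta>0: "\<delta> \<longlonglongrightarrow> 0" unfolding \<delta>_def by (rule LIMSEQ_Suc[OF lim_1_over_n])
  have "\<exists>X Y. P.finite_energy X \<and> Q.finite_energy Y \<and>
     P.energy X \<le> (1 + \<delta> n) * E (X []) \<and> Q.energy Y \<le> (1 + \<delta> n) * E' (Y []) \<and>
     (1 - \<delta> n) * sqrt (P.energy X * Q.energy Y) < affinity X Y n" for n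
    using contra \<delta>[of n] by (meson not_le)
  then obtain X Y where fin: "\<And>n. P.finite_energy (X n)" "\<And>n. Q.finite_energy (Y n)"
    and en: "\<And>n. P.energy (X n) \<le> (1 + \<delta> n) * E (X n [])" "\<And>n. Q.energy (Y n) \<le> (1 + \<delta> n) * E' (Y n [])"
    and aff: "\<And>n. (1 - \<delta> n) * sqrt (P.energy (X n) * Q.energy (Y n)) < affinity (X n) (Y n) n"
    by metis
  \<comment> \<open>With zero energy on one side both sides of \<open>aff\<close> would be 0,
    contradicting its strictness; hence the trees can be normalized.\<close>
  have pos: "0 < E (X n [])" "0 < E' (Y n [])" for n
  proof -
    have "affinity (X n) (Y n) n \<le> sqrt (P.energy (X n) * Q.energy (Y n))"
      using affinity_add_le[OF fin(1)[of n] fin(2)[of n], of 0 n] by (simp add: affinity_def P.mass_Nil Q.mass_Nil)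
    moreover have "0 \<le> (1 - \<delta> n) * sqrt (P.energy (X n) * Q.energy (Y n))"
      using \<delta>[of n] P.energy_nonneg[OF fin(1)[of n]] Q.energy_nonneg[OF fin(2)[of n]] by simp
    ultimately have "P.energy (X n) \<noteq> 0" "Q.energy (Y n) \<noteq> 0"
      using aff[of n] by auto
    then have "0 < P.energy (X n)" "0 < Q.energy (Y n)"
      using P.energy_nonneg[OF fin(1)[of n]] Q.energy_nonneg[OF fin(2)[of n]] by simp_all
    then have "0 < (1 + \<delta> n) * E (X n [])" "0 < (1 + \<delta> n) * E' (Y n [])" using en[of n] by linarith+
    then show "0 < E (X n [])" "0 < E' (Y n [])" using \<delta>[of n] by (auto simp: zero_less_mult_iff)
  qed
  define X' where "X' n = P.normalize (X n)" for n
  define Y' where "Y' n = Q.normalize (Y n)" for n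
  define e where "e n w = P.energy (subtree w (X n)) / E (X n [])" for n w
  define f where "f n w = Q.energy (subtree w (Y n)) / E' (Y n [])" for n w
  have E1: "E (X' n []) = 1" "E' (Y' n []) = 1" for n
    using pos[of n] by (simp_all add: X'_def Y'_def P.E_normalize Q.E_normalize)
  obtain R R' where R: "\<And>x. fst x = 0 \<Longrightarrow> E x = 1 \<Longrightarrow> norm x \<le> R"
    and R': "\<And>x. fst x = 0 \<Longrightarrow> E' x = 1 \<Longrightarrow> norm x \<le> R'"
    using P.normalized_bounded Q.normalized_bounded by blast
  have "bounded (range (\<lambda>n. (X' n [], Y' n [])))"
  proof (rule boundedI)
    fix z assume "z \<in> range (\<lambda>n. (X' n [], Y' n []))"
    then obtain n where z: "z = (X' n [], Y' n [])" by auto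
    have "norm (X' n []) \<le> R" "norm (Y' n []) \<le> R'"
      by (intro R R' E1; simp add: X'_def Y'_def P.fst_normalize Q.fst_normalize)+
    then show "norm z \<le> R + R'" using norm_Pair_le[of "X' n []" "Y' n []"] by (simp add: z)
  qed
  then obtain l r where r: "strict_mono (r :: nat \<Rightarrow> nat)" and l: "((\<lambda>n. (X' n [], Y' n [])) \<circ> r) \<longlonglongrightarrow> l"
    using bounded_imp_convergent_subsequence by blast
  have lim: "(\<lambda>n. X' (r n) []) \<longlonglongrightarrow> fst l" "(\<lambda>n. Y' (r n) []) \<longlonglongrightarrow> snd l"
    using tendsto_fst[OF l] tendsto_snd[OF l] by (simp_all add: o_def)
  define x where "x = fst l"
  define y where "y = snd l"
  note lim = lim[folded x_def y_def]
  have "(\<lambda>n. E (X' (r n) [])) \<longlonglongrightarrow> E x" "(\<lambda>n. E' (Y' (r n) [])) \<longlonglongrightarrow> E' y"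
    by (intro P.tendsto_E Q.tendsto_E lim)+
  then have Exy: "E x = 1" "E' y = 1" by (simp_all add: E1 LIMSEQ_const_iff)
  have \<delta>r: "(\<lambda>n. 1 + \<delta> (r n)) \<longlonglongrightarrow> 1 + 0"
    using LIMSEQ_subseq_LIMSEQ[OF \<delta>0 r] by (intro tendsto_intros) (simp add: o_def)
  have ebound: "1 \<le> e n [] \<and> e n [] \<le> 1 + \<delta> n" "1 \<le> f n [] \<and> f n [] \<le> 1 + \<delta> n" for n
    using P.E_le_energy[OF fin(1)[of n]] Q.E_le_energy[OF fin(2)[of n]] en[of n] pos[of n]
    by (simp_all add: e_def f_def field_simps)
  have elim: "(\<lambda>n. e (r n) []) \<longlonglongrightarrow> E x"
    unfolding Exy by (rule tendsto_sandwich[OF _ _ tendsto_const \<delta>r[unfolded add_0_right]]) (simp_all add: ebound)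
  have flim: "(\<lambda>n. f (r n) []) \<longlonglongrightarrow> E' y"
    unfolding Exy by (rule tendsto_sandwich[OF _ _ tendsto_const \<delta>r[unfolded add_0_right]]) (simp_all add: ebound)
  have limX: "(\<lambda>n. e (r n) w) \<longlonglongrightarrow> E (fold P.H w x)" if "set w \<subseteq> alphabet" for w
  proof -
    have "(\<lambda>n. X' (r n) w) \<longlonglongrightarrow> fold P.H w x \<and> (\<lambda>n. e (r n) w) \<longlonglongrightarrow> E (fold P.H w x)"
    proof (rule P.near_harmonic_limit[where X = "\<lambda>n. X' (r n)" and e = "\<lambda>n. e (r n)", OF _ _ _ lim(1) elim that])
      show "compatible (X' (r n))" for n
        using fin(1)[of "r n"] by (simp add: X'_def P.finite_energy_def P.compatible_normalize)
      show "E (X' (r n) w) \<le> e (r n) w" if "set w \<subseteq> alphabet" for n w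
        using P.E_le_energy[OF P.finite_energy_subtree[OF fin(1) that], of "r n"] pos(1)[of "r n"]
        by (simp add: e_def X'_def P.E_normalize divide_right_mono)
      show "e (r n) w = \<rho> * (e (r n) (w @ [1]) + e (r n) (w @ [2]) + e (r n) (w @ [3]))"
        if "set w \<subseteq> alphabet" for n w
        using P.energy_children[OF P.finite_energy_subtree[OF fin(1) that], of "r n"]
        by (simp add: e_def add_divide_distrib[symmetric])
    qed
    then show ?thesis by simp
  qed
  have limY: "(\<lambda>n. f (r n) w) \<longlonglongrightarrow> E' (fold Q.H w y)" if "set w \<subseteq> alphabet" for w
  proof -
    have "(\<lambda>n. Y' (r n) w) \<longlonglongrightarrow> fold Q.H w y \<and> (\<lambda>n. f (r n) w) \<longlonglongrightarrow> E' (fold Q.H w y)"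
    proof (rule Q.near_harmonic_limit[where X = "\<lambda>n. Y' (r n)" and e = "\<lambda>n. f (r n)", OF _ _ _ lim(2) flim that])
      show "compatible (Y' (r n))" for n
        using fin(2)[of "r n"] by (simp add: Y'_def Q.finite_energy_def Q.compatible_normalize)
      show "E' (Y' (r n) w) \<le> f (r n) w" if "set w \<subseteq> alphabet" for n w
        using Q.E_le_energy[OF Q.finite_energy_subtree[OF fin(2) that], of "r n"] pos(2)[of "r n"]
        by (simp add: f_def Y'_def Q.E_normalize divide_right_mono)
      show "f (r n) w = \<rho>' * (f (r n) (w @ [1]) + f (r n) (w @ [2]) + f (r n) (w @ [3]))"
        if "set w \<subseteq> alphabet" for n w
        using Q.energy_children[OF Q.finite_energy_subtree[OF fin(2) that], of "r n"]
        by (simp add: f_def add_divide_distrib[symmetric])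
    qed
    then show ?thesis by simp
  qed
  \<comment> \<open>The affinity is nonincreasing in the level, so the lower bound at level n also
    holds at each fixed level k \<le> n and survives the limit.\<close>
  have lower: "(1 - \<delta> n) * sqrt (e n [] * f n []) \<le> (\<Sum>w\<in>words k. sqrt (\<rho> ^ k * e n w * (\<rho>' ^ k * f n w)))"
    if "k \<le> n" for k n
  proof -
    define c where "c = sqrt (E (X n []) * E' (Y n []))"
    have c: "0 < c" using pos[of n] by (simp add: c_def)
    have "(1 - \<delta> n) * sqrt (P.energy (X n) * Q.energy (Y n)) \<le> affinity (X n) (Y n) k"
      using aff[of n] affinity_add_le[OF fin(1)[of n] fin(2)[of n], of k "n - k"] that by simp
    also have "affinity (X n) (Y n) k = c * (\<Sum>w\<in>words k. sqrt (\<rho> ^ k * e n w * (\<rho>' ^ k * f n w)))"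
      unfolding affinity_def sum_distrib_left
    proof (rule sum.cong[OF refl])
      fix w assume "w \<in> words k"
      then have len: "length w = k" by (simp add: words_def)
      have "P.mass (X n) w * Q.mass (Y n) w = (E (X n []) * E' (Y n [])) * (\<rho> ^ k * e n w * (\<rho>' ^ k * f n w))"
        using pos[of n] by (simp add: P.mass_def Q.mass_def len e_def f_def)
      then show "sqrt (P.mass (X n) w * Q.mass (Y n) w) = c * sqrt (\<rho> ^ k * e n w * (\<rho>' ^ k * f n w))"
        by (simp only: real_sqrt_mult[symmetric] c_def)
    qed
    also have "sqrt (P.energy (X n) * Q.energy (Y n)) = c * sqrt (e n [] * f n [])"
      using pos[of n] by (simp add: c_def e_def f_def flip: real_sqrt_mult)
    finally have "c * ((1 - \<delta> n) * sqrt (e n [] * f n [])) \<le> c * (\<Sum>w\<in>words k. sqrt (\<rho> ^ k * e n w * (\<rho>' ^ k * f n w)))"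
      by (simp add: algebra_simps)
    then show ?thesis using c by simp
  qed
  have "P.frac v x = Q.frac v y" if v: "set v \<subseteq> alphabet" for v
  proof -
    define k where "k = length v"
    have frac: "P.frac w x = \<rho> ^ k * E (fold P.H w x)" "Q.frac w y = \<rho>' ^ k * E' (fold Q.H w y)" if "w \<in> words k" for w
      using that Exy by (simp_all add: P.frac_def Q.frac_def words_def)
    have nn: "0 \<le> P.frac w x" "0 \<le> Q.frac w y" for w
      using P.rho_pos Q.rho_pos Exy by (simp_all add: P.frac_def Q.frac_def P.E_nonneg Q.E_nonneg)
    have "(\<lambda>n. \<Sum>w\<in>words k. sqrt (\<rho> ^ k * e (r n) w * (\<rho>' ^ k * f (r n) w))) \<longlonglongrightarrow>
        (\<Sum>w\<in>words k. sqrt (\<rho> ^ k * E (fold P.H w x) * (\<rho>' ^ k * E' (fold Q.H w y))))"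
      by (intro tendsto_sum tendsto_real_sqrt tendsto_mult tendsto_const limX limY) (auto simp: words_def)
    moreover have "(\<lambda>n. (1 - \<delta> (r n)) * sqrt (e (r n) [] * f (r n) [])) \<longlonglongrightarrow> (1 - 0) * sqrt (E x * E' y)"
      using LIMSEQ_subseq_LIMSEQ[OF \<delta>0 r] by (intro tendsto_intros elim flim) (simp add: o_def)
    moreover have "\<exists>N. \<forall>n\<ge>N. (1 - \<delta> (r n)) * sqrt (e (r n) [] * f (r n) [])
        \<le> (\<Sum>w\<in>words k. sqrt (\<rho> ^ k * e (r n) w * (\<rho>' ^ k * f (r n) w)))"
      using seq_suble[OF r] by (intro exI[of _ k] allI impI lower) (meson order_trans)
    ultimately have "(1 - 0) * sqrt (E x * E' y)
        \<le> (\<Sum>w\<in>words k. sqrt (\<rho> ^ k * E (fold P.H w x) * (\<rho>' ^ k * E' (fold Q.H w y))))"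
      by - (rule LIMSEQ_le)
    then have one: "1 \<le> (\<Sum>w\<in>words k. sqrt (P.frac w x * Q.frac w y))" using Exy by (simp add: frac)
    have sums: "(\<Sum>w\<in>words k. P.frac w x) = 1" "(\<Sum>w\<in>words k. Q.frac w y) = 1"
      using P.sum_fold_H[of k x] Q.sum_fold_H[of k y] Exy by (simp_all add: frac)
    \<comment> \<open>The squared Hellinger distance of two probability vectors is 2 minus twice
      their affinity, so affinity 1 forces equality.\<close>
    have "(\<Sum>w\<in>words k. (sqrt (P.frac w x) - sqrt (Q.frac w y))\<^sup>2) = 2 - 2 * (\<Sum>w\<in>words k. sqrt (P.frac w x * Q.frac w y))"
      using nn by (simp add: power2_diff sum.distrib sum_subtractf sums sum_distrib_left real_sqrt_mult mult.assoc)
    then have "(\<Sum>w\<in>words k. (sqrt (P.frac w x) - sqrt (Q.frac w y))\<^sup>2) \<le> 0" using one by simp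
    then have "(\<Sum>w\<in>words k. (sqrt (P.frac w x) - sqrt (Q.frac w y))\<^sup>2) = 0"
      by (intro antisym sum_nonneg) auto
    moreover have "v \<in> words k" using v by (simp add: words_def k_def)
    ultimately have "(sqrt (P.frac v x) - sqrt (Q.frac v y))\<^sup>2 = 0"
      by (subst (asm) sum_nonneg_eq_0_iff) auto
    then show ?thesis by simp
  qed
  then show False using no_common_frac[of x y] Exy by simp
qed

text \<open>Nearly harmonic cells lose the factor 1 - \<delta>. On the others only Cauchy-Schwarz is
  available, but there one of the two measures has little mass by
  \<open>nonharmonic_mass_le\<close>; these contributions are the two square roots.\<close>

lemma affinity_recursion:
  assumes X: "P.finite_energy X" and Y: "Q.finite_energy Y" and \<delta>: "0 < \<delta>" "\<delta> \<le> 1"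
    and gap: "\<And>X Y. P.finite_energy X \<Longrightarrow> Q.finite_energy Y \<Longrightarrow>
     P.energy X \<le> (1 + \<delta>) * E (X []) \<Longrightarrow> Q.energy Y \<le> (1 + \<delta>) * E' (Y []) \<Longrightarrow>
     affinity X Y N \<le> (1 - \<delta>) * sqrt (P.energy X * Q.energy Y)"
  defines "c \<equiv> (1 + \<delta>) / \<delta>"
  shows "affinity X Y (k + N) \<le> (1 - \<delta>) * affinity X Y k
    + sqrt (c * (P.energy X - P.level_energy X k) * Q.energy Y)
    + sqrt (P.energy X * (c * (Q.energy Y - Q.level_energy Y k)))"
proof -
  define s where "s w = sqrt (P.mass X w * Q.mass Y w)" for w
  define BX where "BX = {w \<in> words k. \<not> P.energy (subtree w X) \<le> (1 + \<delta>) * E (X w)}"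
  define BY where "BY = {w \<in> words k. \<not> Q.energy (subtree w Y) \<le> (1 + \<delta>) * E' (Y w)}"
  have alph: "set w \<subseteq> alphabet" "length w = k" if "w \<in> words k" for w using that by (auto simp: words_def)
  have s0: "0 \<le> s w" if "w \<in> words k" for w
    using P.mass_nonneg[OF X alph(1)[OF that]] Q.mass_nonneg[OF Y alph(1)[OF that]] by (simp add: s_def)
  have local: "(\<Sum>v\<in>words N. sqrt (P.mass X (w @ v) * Q.mass Y (w @ v)))
      \<le> (1 - \<delta>) * s w + (if w \<in> BX then s w else 0) + (if w \<in> BY then s w else 0)" (is "?L \<le> _")
    if w: "w \<in> words k" for w
  proof (cases "w \<in> BX \<or> w \<in> BY")
    case True
    have "?L \<le> s w" unfolding s_def by (rule affinity_local_le[OF X Y alph(1)[OF w]])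
    moreover have "\<delta> * s w \<le> 1 * s w" using \<delta> s0[OF w] by (intro mult_right_mono) auto
    ultimately show ?thesis using True s0[OF w] by (auto simp: algebra_simps)
  next
    case False
    have "affinity (subtree w X) (subtree w Y) N \<le> (1 - \<delta>) * sqrt (P.energy (subtree w X) * Q.energy (subtree w Y))"
      using False w by (intro gap P.finite_energy_subtree Q.finite_energy_subtree X Y alph(1)[OF w]) (auto simp: BX_def BY_def)
    then have "sqrt (\<rho> ^ k * \<rho>' ^ k) * affinity (subtree w X) (subtree w Y) N
        \<le> sqrt (\<rho> ^ k * \<rho>' ^ k) * ((1 - \<delta>) * sqrt (P.energy (subtree w X) * Q.energy (subtree w Y)))"
      using P.rho_pos Q.rho_pos by (intro mult_left_mono) auto
    also have "\<dots> = (1 - \<delta>) * s w"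
      by (simp add: s_def P.mass_def Q.mass_def alph(2)[OF w] mult_ac flip: real_sqrt_mult)
    also have "sqrt (\<rho> ^ k * \<rho>' ^ k) * affinity (subtree w X) (subtree w Y) N = ?L"
      unfolding affinity_def sum_distrib_left
      by (intro sum.cong refl) (simp add: P.mass_append Q.mass_append alph(2)[OF w] mult_ac flip: real_sqrt_mult)
    finally show ?thesis using False by simp
  qed
  have badX: "(\<Sum>w\<in>BX. P.mass X w) \<le> c * (P.energy X - P.level_energy X k)"
    unfolding BX_def c_def by (rule P.nonharmonic_mass_le[OF X \<delta>(1)])
  have badY: "(\<Sum>w\<in>BY. Q.mass Y w) \<le> c * (Q.energy Y - Q.level_energy Y k)"
    unfolding BY_def c_def by (rule Q.nonharmonic_mass_le[OF Y \<delta>(1)])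
  have mass0: "0 \<le> P.mass X w" "0 \<le> Q.mass Y w" if "w \<in> words k" for w
    using P.mass_nonneg[OF X alph(1)[OF that]] Q.mass_nonneg[OF Y alph(1)[OF that]] by auto
  have subs: "BX \<subseteq> words k" "BY \<subseteq> words k" by (auto simp: BX_def BY_def)
  have le_all: "(\<Sum>w\<in>B. P.mass X w) \<le> P.energy X" "(\<Sum>w\<in>B. Q.mass Y w) \<le> Q.energy Y"
    "0 \<le> (\<Sum>w\<in>B. P.mass X w)" "0 \<le> (\<Sum>w\<in>B. Q.mass Y w)" if "B \<subseteq> words k" for B
    using sum_mono2[OF finite_words that, of "P.mass X"] sum_mono2[OF finite_words that, of "Q.mass Y"] mass0 that
    by (auto simp: P.sum_mass[OF X] Q.sum_mass[OF Y] intro!: sum_nonneg)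
  have sX: "(\<Sum>w\<in>BX. s w) \<le> sqrt (c * (P.energy X - P.level_energy X k) * Q.energy Y)"
  proof -
    have "(\<Sum>w\<in>BX. s w) \<le> sqrt ((\<Sum>w\<in>BX. P.mass X w) * (\<Sum>w\<in>BX. Q.mass Y w))"
      unfolding s_def using subs mass0 by (intro sum_sqrt_le) auto
    also have "\<dots> \<le> sqrt (c * (P.energy X - P.level_energy X k) * Q.energy Y)"
      using badX le_all[OF subs(1)] by (intro real_sqrt_le_mono mult_mono) auto
    finally show ?thesis .
  qed
  have sY: "(\<Sum>w\<in>BY. s w) \<le> sqrt (P.energy X * (c * (Q.energy Y - Q.level_energy Y k)))"
  proof -
    have "(\<Sum>w\<in>BY. s w) \<le> sqrt ((\<Sum>w\<in>BY. P.mass X w) * (\<Sum>w\<in>BY. Q.mass Y w))"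
      unfolding s_def using subs mass0 by (intro sum_sqrt_le) auto
    also have "\<dots> \<le> sqrt (P.energy X * (c * (Q.energy Y - Q.level_energy Y k)))"
      using badY le_all[OF subs(2)] by (intro real_sqrt_le_mono mult_mono) auto
    finally show ?thesis .
  qed
  have "affinity X Y (k + N) \<le> (\<Sum>w\<in>words k. (1 - \<delta>) * s w + (if w \<in> BX then s w else 0) + (if w \<in> BY then s w else 0))"
    unfolding affinity_def sum_words_add by (intro sum_mono local)
  also have "\<dots> = (1 - \<delta>) * affinity X Y k + (\<Sum>w\<in>BX. s w) + (\<Sum>w\<in>BY. s w)"
    using subs by (simp add: sum.distrib affinity_def s_def sum_distrib_left sum.inter_restrict[symmetric] Int_absorb1)
  finally show ?thesis using sX sY by linarith
qed

text \<open>The error terms of the recursion vanish as the level energies converge, so the limit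
  satisfies \<open>L \<le> (1 - \<delta>) * L\<close>.\<close>

theorem affinity_tendsto_0:
  assumes X: "P.finite_energy X" and Y: "Q.finite_energy Y"
  shows "affinity X Y \<longlonglongrightarrow> 0"
proof -
  obtain N \<delta> where \<delta>: "0 < \<delta>" "\<delta> \<le> 1"
    and gap: "\<And>X Y. P.finite_energy X \<Longrightarrow> Q.finite_energy Y \<Longrightarrow>
     P.energy X \<le> (1 + \<delta>) * E (X []) \<Longrightarrow> Q.energy Y \<le> (1 + \<delta>) * E' (Y []) \<Longrightarrow>
     affinity X Y N \<le> (1 - \<delta>) * sqrt (P.energy X * Q.energy Y)"
    using uniform_affinity_gap by metis
  have "decseq (affinity X Y)"
    using affinity_add_le[OF X Y, of _ 1] by (intro decseq_SucI) simp
  moreover have "\<And>n. 0 \<le> affinity X Y n" by (rule affinity_nonneg[OF X Y])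
  ultimately obtain L where L: "affinity X Y \<longlonglongrightarrow> L"
    using decseq_convergent[of "affinity X Y" 0] by metis
  define b where "b k = (1 - \<delta>) * affinity X Y k
    + sqrt ((1 + \<delta>) / \<delta> * (P.energy X - P.level_energy X k) * Q.energy Y)
    + sqrt (P.energy X * ((1 + \<delta>) / \<delta> * (Q.energy Y - Q.level_energy Y k)))" for k
  have "b \<longlonglongrightarrow> (1 - \<delta>) * L + sqrt ((1 + \<delta>) / \<delta> * (P.energy X - P.energy X) * Q.energy Y)
      + sqrt (P.energy X * ((1 + \<delta>) / \<delta> * (Q.energy Y - Q.energy Y)))"
    unfolding b_def by (intro tendsto_intros L P.energy_limit[OF X] Q.energy_limit[OF Y])
  then have b: "b \<longlonglongrightarrow> (1 - \<delta>) * L" by simp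
  have "L \<le> (1 - \<delta>) * L"
    by (rule LIMSEQ_le[OF LIMSEQ_ignore_initial_segment[OF L, of N] b])
       (use affinity_recursion[OF X Y \<delta> gap] in \<open>auto simp: b_def\<close>)
  then have "\<delta> * L \<le> 0" by (simp add: algebra_simps)
  then have "L \<le> 0" using \<delta> by (simp add: mult_le_0_iff)
  moreover have "0 \<le> L" using L affinity_nonneg[OF X Y] by (intro LIMSEQ_le_const) auto
  ultimately show ?thesis using L by simp
qed

end

section \<open>Singularity of measures given on cells\<close>

text \<open>Choose at each level the cells on which \<mu> is the smaller measure. As a minimum is at
  most the geometric mean, both \<mu> of their union and \<nu> of its complement are at most the
  affinity; along a summable subsequence the limes superior of these unions separates the measures.
  Cells may overlap at vertices: only subadditivity and covering enter.\<close>

lemma mutually_singular_cells: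
  fixes \<mu> \<nu> :: "'a measure" and W :: "nat \<Rightarrow> 'i set" and cell :: "'i \<Rightarrow> 'a set" and m m' :: "'i \<Rightarrow> real"
  assumes sets: "sets \<mu> = sets \<nu>"
    and fin: "\<And>n. finite (W n)" and meas: "\<And>n w. w \<in> W n \<Longrightarrow> cell w \<in> sets \<mu>"
    and cover: "\<And>n. space \<mu> \<subseteq> (\<Union>w\<in>W n. cell w)"
    and m: "\<And>n w. w \<in> W n \<Longrightarrow> emeasure \<mu> (cell w) = ennreal (m w) \<and> 0 \<le> m w"
    and m': "\<And>n w. w \<in> W n \<Longrightarrow> emeasure \<nu> (cell w) = ennreal (m' w) \<and> 0 \<le> m' w"
    and lim: "(\<lambda>n. \<Sum>w\<in>W n. sqrt (m w * m' w)) \<longlonglongrightarrow> 0"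
  shows "mutually_singular \<mu> \<nu>"
proof -
  define h where "h n = (\<Sum>w\<in>W n. sqrt (m w * m' w))" for n
  define A where "A n = (\<Union>w\<in>{w \<in> W n. m w \<le> m' w}. cell w)" for n
  have sp: "space \<nu> = space \<mu>" using sets by (rule sets_eq_imp_space_eq[symmetric])
  have Am: "A n \<in> sets \<mu>" for n unfolding A_def using fin meas by (intro sets.finite_UN) auto
  have le: "min (m w) (m' w) \<le> sqrt (m w * m' w)" if "w \<in> W n" for w n
  proof (rule real_le_rsqrt)
    show "(min (m w) (m' w))\<^sup>2 \<le> m w * m' w"
      using m[OF that] m'[OF that] by (auto simp: power2_eq_square min_def intro!: mult_mono)
  qed
  have nn: "0 \<le> sqrt (m w * m' w)" if "w \<in> W n" for w n
    using m[OF that] m'[OF that] by simp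
  have muA: "emeasure \<mu> (A n) \<le> ennreal (h n)" for n
  proof -
    have "emeasure \<mu> (A n) \<le> (\<Sum>w\<in>{w \<in> W n. m w \<le> m' w}. emeasure \<mu> (cell w))"
      unfolding A_def using fin meas by (intro emeasure_subadditive_finite) auto
    also have "\<dots> = ennreal (\<Sum>w\<in>{w \<in> W n. m w \<le> m' w}. m w)"
      using m by (subst sum_ennreal[symmetric]) (auto intro!: sum.cong)
    also have "\<dots> \<le> ennreal (\<Sum>w\<in>{w \<in> W n. m w \<le> m' w}. sqrt (m w * m' w))"
    proof (intro ennreal_leI sum_mono)
      fix w assume "w \<in> {w \<in> W n. m w \<le> m' w}"
      then show "m w \<le> sqrt (m w * m' w)" using le[of w n] by (simp add: min_absorb1)
    qed
    also have "\<dots> \<le> ennreal (h n)"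
      unfolding h_def using fin nn by (intro ennreal_leI sum_mono2) auto
    finally show ?thesis .
  qed
  have nuA: "emeasure \<nu> (space \<mu> - A n) \<le> ennreal (h n)" for n
  proof -
    have "emeasure \<nu> (space \<mu> - A n) \<le> emeasure \<nu> (\<Union>w\<in>{w \<in> W n. m' w \<le> m w}. cell w)"
    proof (rule emeasure_mono)
      show "space \<mu> - A n \<subseteq> (\<Union>w\<in>{w \<in> W n. m' w \<le> m w}. cell w)"
        using cover[of n] by (force simp: A_def)
      show "(\<Union>w\<in>{w \<in> W n. m' w \<le> m w}. cell w) \<in> sets \<nu>"
        using fin meas sets by (intro sets.finite_UN) auto
    qed
    also have "\<dots> \<le> (\<Sum>w\<in>{w \<in> W n. m' w \<le> m w}. emeasure \<nu> (cell w))"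
      using fin meas sets by (intro emeasure_subadditive_finite) auto
    also have "\<dots> = ennreal (\<Sum>w\<in>{w \<in> W n. m' w \<le> m w}. m' w)"
      using m' by (subst sum_ennreal[symmetric]) (auto intro!: sum.cong)
    also have "\<dots> \<le> ennreal (\<Sum>w\<in>{w \<in> W n. m' w \<le> m w}. sqrt (m w * m' w))"
    proof (intro ennreal_leI sum_mono)
      fix w assume "w \<in> {w \<in> W n. m' w \<le> m w}"
      then show "m' w \<le> sqrt (m w * m' w)" using le[of w n] by (simp add: min_absorb2)
    qed
    also have "\<dots> \<le> ennreal (h n)"
      unfolding h_def using fin nn by (intro ennreal_leI sum_mono2) auto
    finally show ?thesis .
  qed
  have "\<exists>n. h n \<le> (1 / 2) ^ j" for j
  proof -
    have "\<forall>\<^sub>F n in sequentially. h n < (1 / 2) ^ j"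
      using lim by (intro order_tendstoD(2)[of _ 0]) (auto simp: h_def)
    then show ?thesis by (auto simp: eventually_sequentially intro: less_imp_le)
  qed
  then obtain r where r: "\<And>j. h (r j) \<le> (1 / 2) ^ j" by metis
  define B where "B j = A (r j)" for j
  have Bm: "B j \<in> sets \<mu>" for j by (simp add: B_def Am)
  have muB: "emeasure \<mu> (B j) \<le> ennreal ((1 / 2) ^ j)" for j
    unfolding B_def by (rule order_trans[OF muA ennreal_leI[OF r]])
  have nuB: "emeasure \<nu> (space \<mu> - B j) \<le> ennreal ((1 / 2) ^ j)" for j
    unfolding B_def by (rule order_trans[OF nuA ennreal_leI[OF r]])
  have null: "limsup B \<in> null_sets \<mu>"
  proof (rule borel_cantelli_limsup1)
    show "emeasure \<mu> (B j) < \<infinity>" for j using muB[of j] by (auto intro: le_less_trans)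
    show "summable (\<lambda>j. measure \<mu> (B j))"
    proof (rule summable_comparison_test')
      show "summable (\<lambda>j. (1 / 2 :: real) ^ j)" by (simp add: summable_geometric)
      show "norm (measure \<mu> (B j)) \<le> (1 / 2) ^ j" for j
        using muB[of j] by (simp add: measure_def enn2real_leI)
    qed
  qed (rule Bm)
  \<comment> \<open>A point outside the limes superior lies in all complements from some index i on,
    and such an intersection has \<nu> measure at most (1/2)^(i + j) for every j.\<close>
  have "space \<mu> - limsup B \<subseteq> (\<Union>i. \<Inter>j\<in>{i..}. space \<mu> - B j)"
    by (auto simp: limsup_INF_SUP)
  moreover have "(\<Inter>j\<in>{i..}. space \<mu> - B j) \<in> null_sets \<nu>" for i
  proof (rule null_setsI)
    show m_i: "(\<Inter>j\<in>{i..}. space \<mu> - B j) \<in> sets \<nu>" using Bm sets by (intro sets.countable_INT) auto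
    have "emeasure \<nu> (\<Inter>j\<in>{i..}. space \<mu> - B j) \<le> ennreal ((1 / 2) ^ (i + j))" for j
    proof -
      have "emeasure \<nu> (\<Inter>j\<in>{i..}. space \<mu> - B j) \<le> emeasure \<nu> (space \<mu> - B (i + j))"
        using Bm sets by (intro emeasure_mono) auto
      then show ?thesis using nuB[of "i + j"] by simp
    qed
    moreover have "(\<lambda>j. ennreal ((1 / 2) ^ (i + j))) \<longlonglongrightarrow> ennreal 0"
      by (intro tendsto_ennrealI) (auto intro!: tendsto_eq_intros simp: power_add LIMSEQ_realpow_zero)
    ultimately have "emeasure \<nu> (\<Inter>j\<in>{i..}. space \<mu> - B j) \<le> ennreal 0"
      by (intro LIMSEQ_le_const[of _ "ennreal 0"]) auto
    then show "emeasure \<nu> (\<Inter>j\<in>{i..}. space \<mu> - B j) = 0" by simp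
  qed
  then have "(\<Union>i. \<Inter>j\<in>{i..}. space \<mu> - B j) \<in> null_sets \<nu>" by (intro null_sets_UN)
  moreover have "space \<mu> - limsup B \<in> sets \<nu>"
    unfolding sets[symmetric] by (intro sets.compl_sets null_setsD2[OF null])
  ultimately have "emeasure \<nu> (space \<mu> - limsup B) = 0"
    by (intro null_setsD1[OF null_sets_subset])
  then show ?thesis using sets null sp unfolding mutually_singular_def
    by (intro conjI bexI[of _ "limsup B"]) auto
qed

section \<open>Geometry of the gasket\<close>

lemma word_map_simps [simp]: "word_map a [] = id" "word_map a (i # w) = contraction a i \<circ> word_map a w"
  by (simp_all add: word_map_def)

lemma word_map_append: "word_map a (v @ w) = word_map a v \<circ> word_map a w"
  by (induction v) auto

lemma contraction_eq: "contraction a i x = (1 / 2) *\<^sub>R (a i + x)"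
proof -
  have "(1 / 2) *\<^sub>R a i + (1 / 2) *\<^sub>R a i = a i" by (simp flip: scaleR_add_left)
  then show ?thesis by (simp add: contraction_def scaleR_diff_right scaleR_add_right algebra_simps)
qed

lemma dist_contraction: "dist (contraction a i x) (contraction a i y) = dist x y / 2"
  by (simp add: contraction_def dist_norm flip: scaleR_diff_right)

lemma continuous_on_word_map: "continuous_on S (word_map a w)"
proof (induction w arbitrary: S)
  case (Cons i w)
  have "continuous_on (word_map a w ` S) (contraction a i)"
    unfolding contraction_def by (intro continuous_intros)
  then show ?case using continuous_on_compose[OF Cons] by simp
qed (simp add: id_def)

text \<open>A point of K farthest from K' is the image of a point of K under a contraction that also
  maps K' into itself. Its distance from K' is therefore at most half the maximal one, which must be
  0.\<close>

lemma gasket_subset: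
  assumes K: "is_gasket a K" and K': "is_gasket a K'"
  shows "K \<subseteq> K'"
proof -
  have c: "compact K" "K \<noteq> {}" "closed K'" "K' \<noteq> {}"
    using K K' by (auto simp: is_gasket_def compact_imp_closed)
  have "continuous_on K (\<lambda>x. infdist x K')" by (intro continuous_intros)
  from continuous_attains_sup[OF c(1,2) this]
  obtain x where x: "x \<in> K" "\<And>y. y \<in> K \<Longrightarrow> infdist y K' \<le> infdist x K'" by blast
  obtain i y where i: "i \<in> alphabet" "y \<in> K" "x = contraction a i y"
    using x(1) K unfolding is_gasket_def by blast
  have "infdist x K' \<le> infdist y K' / 2"
  proof -
    obtain z where z: "z \<in> K'" "infdist y K' = dist y z" using infdist_attains_inf[OF c(3,4)] by blast
    have "contraction a i z \<in> K'" using z i K' unfolding is_gasket_def by blast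
    then have "infdist x K' \<le> dist x (contraction a i z)" by (rule infdist_le)
    then show ?thesis using z i by (simp add: dist_contraction)
  qed
  also have "\<dots> \<le> infdist x K' / 2" using x(2)[OF i(2)] by simp
  finally have "infdist x K' \<le> 0" by simp
  then have "infdist y K' = 0" if "y \<in> K" for y using x(2)[OF that] infdist_nonneg[of y K'] by simp
  then show ?thesis using in_closed_iff_infdist_zero[OF c(3,4)] by blast
qed

lemma gasket_unique: "is_gasket a K \<Longrightarrow> is_gasket a K' \<Longrightarrow> K = K'"
  using gasket_subset by blast

lemma word_map_gasket:
  assumes "is_gasket a K" "set w \<subseteq> alphabet"
  shows "word_map a w ` K \<subseteq> K"
  using assms(2)
proof (induction w)
  case (Cons i w)
  then have "contraction a i ` (word_map a w ` K) \<subseteq> contraction a i ` K" by auto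
  also have "\<dots> \<subseteq> K" using assms(1) Cons.prems unfolding is_gasket_def by auto
  finally show ?case by (simp add: image_comp)
qed simp

lemma gasket_cells:
  assumes "is_gasket a K"
  shows "K \<subseteq> (\<Union>w\<in>words n. word_map a w ` K)"
proof (induction n)
  case (Suc n)
  show ?case
  proof
    fix x assume "x \<in> K"
    then obtain i y where i: "i \<in> alphabet" "y \<in> K" "x = contraction a i y"
      using assms unfolding is_gasket_def by blast
    then obtain w z where w: "w \<in> words n" "z \<in> K" "y = word_map a w z" using Suc by blast
    have "i # w \<in> words (Suc n)" using w i by (auto simp: words_def)
    moreover have "x = word_map a (i # w) z" using i w by simp
    ultimately show "x \<in> (\<Union>w\<in>words (Suc n). word_map a w ` K)" using w(2) by blast
  qed
qed simp

text \<open>Iterating one contraction from any point of K stays in the closed set K and converges to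
  the fixed point of the contraction.\<close>

lemma vertex_in_gasket:
  assumes K: "is_gasket a K" and i: "i \<in> alphabet"
  shows "a i \<in> K"
proof -
  obtain x where x: "x \<in> K" using K by (auto simp: is_gasket_def)
  have "(contraction a i ^^ n) x \<in> K \<and> dist ((contraction a i ^^ n) x) (a i) = dist x (a i) * (1 / 2) ^ n" for n
  proof (induction n)
    case (Suc n)
    have "contraction a i (a i) = a i" by (simp add: contraction_def)
    then have "dist ((contraction a i ^^ Suc n) x) (a i) = dist ((contraction a i ^^ n) x) (a i) / 2"
      using dist_contraction[of a i "(contraction a i ^^ n) x" "a i"] by simp
    moreover have "(contraction a i ^^ Suc n) x \<in> K" using Suc K i unfolding is_gasket_def by auto
    ultimately show ?case using Suc by simp
  qed (use x in simp)
  note * = this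
  have "(\<lambda>n. dist ((contraction a i ^^ n) x) (a i)) \<longlonglongrightarrow> dist x (a i) * 0"
    unfolding conjunct2[OF *] by (intro tendsto_intros LIMSEQ_realpow_zero) auto
  then have "(\<lambda>n. dist ((contraction a i ^^ n) x) (a i)) \<longlonglongrightarrow> 0" by simp
  then have "(\<lambda>n. (contraction a i ^^ n) x) \<longlonglongrightarrow> a i" by (rule tendsto_dist_iff[THEN iffD2])
  then show ?thesis
    using * K closed_sequentially[of K "\<lambda>n. (contraction a i ^^ n) x" "a i"]
    by (auto simp: is_gasket_def compact_imp_closed)
qed

text \<open>The reflection in the perpendicular bisector of b and c; for \<open>b = c\<close> it is
  the identity.\<close>

definition reflect :: "'a::real_inner \<Rightarrow> 'a \<Rightarrow> 'a \<Rightarrow> 'a" where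
  "reflect b c x = x - (2 * ((x - (1 / 2) *\<^sub>R (b + c)) \<bullet> (b - c)) / ((b - c) \<bullet> (b - c))) *\<^sub>R (b - c)"

lemma reflect_left: "b \<noteq> c \<Longrightarrow> reflect b c b = c"
proof -
  assume "b \<noteq> c"
  have "b - (1 / 2) *\<^sub>R (b + c) = (1 / 2) *\<^sub>R (b - c)"
  proof -
    have "(1 / 2) *\<^sub>R b + (1 / 2) *\<^sub>R b = b" by (simp flip: scaleR_add_left)
    then show ?thesis by (simp add: scaleR_diff_right scaleR_add_right algebra_simps)
  qed
  then show ?thesis using \<open>b \<noteq> c\<close> by (simp add: reflect_def)
qed

lemma reflect_right: "b \<noteq> c \<Longrightarrow> reflect b c c = b"
proof -
  assume "b \<noteq> c"
  have "c - (1 / 2) *\<^sub>R (b + c) = (- 1 / 2) *\<^sub>R (b - c)"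
  proof -
    have "(1 / 2) *\<^sub>R c + (1 / 2) *\<^sub>R c = c" by (simp flip: scaleR_add_left)
    then show ?thesis by (simp add: scaleR_diff_right scaleR_add_right algebra_simps)
  qed
  then show ?thesis using \<open>b \<noteq> c\<close> by (simp add: reflect_def)
qed

lemma reflect_fixed:
  assumes "dist x b = dist x c"
  shows "reflect b c x = x"
proof -
  have "(x - b) \<bullet> (x - b) = (x - c) \<bullet> (x - c)"
    using assms by (simp add: dist_norm norm_eq_sqrt_inner)
  then have "(x - (1 / 2) *\<^sub>R (b + c)) \<bullet> (b - c) = 0"
    by (simp add: inner_diff_left inner_diff_right inner_add_left inner_add_right inner_commute algebra_simps)
  then show ?thesis by (simp add: reflect_def)
qed

lemma dist_reflect: "dist (reflect b c x) (reflect b c y) = dist x y"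
proof -
  define d where "d = b - c"
  define k where "k = 2 * ((x - y) \<bullet> d) / (d \<bullet> d)"
  define m where "m = (1 / 2) *\<^sub>R (b + c)"
  have *: "reflect b c z = z - (2 * ((z - m) \<bullet> d) / (d \<bullet> d)) *\<^sub>R d" for z by (simp add: reflect_def d_def m_def)
  have "k = 2 * ((x - m) \<bullet> d) / (d \<bullet> d) - 2 * ((y - m) \<bullet> d) / (d \<bullet> d)"
    by (simp add: k_def inner_diff_left diff_divide_distrib[symmetric] algebra_simps)
  then have "reflect b c x - reflect b c y = (x - y) - k *\<^sub>R d"
    unfolding * by (simp add: scaleR_diff_left)
  moreover have "((x - y) - k *\<^sub>R d) \<bullet> ((x - y) - k *\<^sub>R d) = (x - y) \<bullet> (x - y)"
  proof (cases "d = 0")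
    case False
    have "((x - y) - k *\<^sub>R d) \<bullet> ((x - y) - k *\<^sub>R d) = (x - y) \<bullet> (x - y) - 2 * k * ((x - y) \<bullet> d) + k * (k * (d \<bullet> d))"
      by (simp add: inner_diff_left inner_diff_right inner_commute algebra_simps)
    also have "k * (d \<bullet> d) = 2 * ((x - y) \<bullet> d)" using False by (simp add: k_def)
    finally show ?thesis by simp
  qed simp
  ultimately show ?thesis by (simp add: dist_norm norm_eq_sqrt_inner)
qed

lemma reflect_midpoint: "reflect b c ((1 / 2) *\<^sub>R (x + y)) = (1 / 2) *\<^sub>R (reflect b c x + reflect b c y)"
proof -
  define d where "d = b - c"
  define m where "m = (1 / 2) *\<^sub>R (b + c)"
  have *: "reflect b c z = z - (2 * ((z - m) \<bullet> d) / (d \<bullet> d)) *\<^sub>R d" for z by (simp add: reflect_def d_def m_def)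
  define f where "f z = 2 * ((z - m) \<bullet> d) / (d \<bullet> d)" for z
  have "f ((1 / 2) *\<^sub>R (x + y)) = (1 / 2) * (f x + f y)"
    by (simp add: f_def inner_diff_left inner_add_left add_divide_distrib diff_divide_distrib algebra_simps)
  then show ?thesis unfolding * f_def[symmetric]
    by (simp add: scaleR_diff_right scaleR_add_right scaleR_add_left add_divide_distrib)
qed

lemma reflect_involution: "b \<noteq> c \<Longrightarrow> reflect b c (reflect b c x) = x"
proof -
  assume "b \<noteq> c"
  define d where "d = b - c"
  define m where "m = (1 / 2) *\<^sub>R (b + c)"
  have *: "reflect b c z = z - (2 * ((z - m) \<bullet> d) / (d \<bullet> d)) *\<^sub>R d" for z by (simp add: reflect_def d_def m_def)
  have d: "d \<bullet> d \<noteq> 0" using \<open>b \<noteq> c\<close> by (simp add: d_def)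
  have "(reflect b c x - m) \<bullet> d = - ((x - m) \<bullet> d)"
    using d by (simp add: * inner_diff_left)
  then show ?thesis unfolding *[of "reflect b c x"] by (simp add: *)
qed

text \<open>A reflection that permutes the vertices conjugates the three contractions into one
  another, so the image of K is again a gasket for the same triangle and equals K by
  uniqueness.\<close>

lemma reflect_isometry_group:
  assumes K: "is_gasket a K" and bc: "b \<noteq> c"
    and perm: "(\<lambda>i. reflect b c (a i)) ` alphabet = a ` alphabet"
  shows "reflect b c \<in> isometry_group K"
proof -
  let ?g = "reflect b c"
  have img: "?g ` (contraction a i ` K) = (\<lambda>x. (1 / 2) *\<^sub>R (?g (a i) + x)) ` (?g ` K)" for i
    by (simp add: image_comp o_def contraction_eq reflect_midpoint)
  have "is_gasket a (?g ` K)"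
    unfolding is_gasket_def
  proof (intro conjI)
    show "?g ` K \<noteq> {}" using K by (auto simp: is_gasket_def)
    have "continuous_on K ?g" unfolding reflect_def by (intro continuous_intros) (use bc in auto)
    then show "compact (?g ` K)" using K by (intro compact_continuous_image) (auto simp: is_gasket_def)
    have "?g ` K = ?g ` (\<Union>i\<in>alphabet. contraction a i ` K)" using K unfolding is_gasket_def by simp
    also have "\<dots> = (\<Union>i\<in>alphabet. (\<lambda>x. (1 / 2) *\<^sub>R (?g (a i) + x)) ` (?g ` K))" by (simp only: image_UN img)
    also have "\<dots> = (\<Union>y\<in>(\<lambda>i. ?g (a i)) ` alphabet. (\<lambda>x. (1 / 2) *\<^sub>R (y + x)) ` (?g ` K))" by simp
    also have "\<dots> = (\<Union>i\<in>alphabet. contraction a i ` (?g ` K))" by (simp add: perm contraction_eq)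
    finally show "?g ` K = (\<Union>i\<in>alphabet. contraction a i ` ?g ` K)" .
  qed
  then have gK: "?g ` K = K" using gasket_unique K by blast
  have "bij_betw ?g K K"
    by (rule bij_betwI[of _ _ _ ?g]) (use gK reflect_involution[OF bc] in auto)
  then show ?thesis by (simp add: isometry_group_def dist_reflect)
qed

lemma reflect_gasket:
  assumes tri: "equilateral_triangle a" and K: "is_gasket a K"
  shows reflect12: "reflect (a 1) (a 2) \<in> isometry_group K" "reflect (a 1) (a 2) (a 1) = a 2"
      "reflect (a 1) (a 2) (a 2) = a 1" "reflect (a 1) (a 2) (a 3) = a 3"
    and reflect23: "reflect (a 2) (a 3) \<in> isometry_group K" "reflect (a 2) (a 3) (a 2) = a 3"
      "reflect (a 2) (a 3) (a 3) = a 2" "reflect (a 2) (a 3) (a 1) = a 1"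
    and vertices_distinct: "a 1 \<noteq> a 2" "a 1 \<noteq> a 3" "a 2 \<noteq> a 3"
proof -
  have ne: "a 1 \<noteq> a 2" "a 1 \<noteq> a 3" "a 2 \<noteq> a 3"
    using tri unfolding equilateral_triangle_def by (metis dist_eq_0_iff)+
  then show "a 1 \<noteq> a 2" "a 1 \<noteq> a 3" "a 2 \<noteq> a 3" by auto
  have d: "dist (a 3) (a 1) = dist (a 3) (a 2)" "dist (a 1) (a 2) = dist (a 1) (a 3)"
    using tri by (auto simp: equilateral_triangle_def dist_commute)
  show 12: "reflect (a 1) (a 2) (a 1) = a 2" "reflect (a 1) (a 2) (a 2) = a 1" "reflect (a 1) (a 2) (a 3) = a 3"
    using reflect_left[OF ne(1)] reflect_right[OF ne(1)] reflect_fixed[OF d(1)]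
    by simp_all
  show 23: "reflect (a 2) (a 3) (a 2) = a 3" "reflect (a 2) (a 3) (a 3) = a 2" "reflect (a 2) (a 3) (a 1) = a 1"
    using reflect_left[OF ne(3)] reflect_right[OF ne(3)] reflect_fixed[OF d(2)]
    by simp_all
  show "reflect (a 1) (a 2) \<in> isometry_group K"
    using 12 by (intro reflect_isometry_group[OF K ne(1)]) (auto simp: alphabet_def)
  show "reflect (a 2) (a 3) \<in> isometry_group K"
    using 23 by (intro reflect_isometry_group[OF K ne(3)]) (auto simp: alphabet_def)
qed

section \<open>The canonical form on the vertices\<close>

lemma powr_le_cancel_base:
  fixes x y c :: real
  assumes "0 < c" "0 \<le> y" "x powr c \<le> y powr c"
  shows "x \<le> y"
  using powr_less_mono2[of c y x] assms by (meson not_le)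

text \<open>The contraction property for m = n = 2 and finite r. Three maps of the plane will be fed
  into it: (min, max), the smoothness pair and the convexity pair.\<close>

lemma generalized_contraction_two:
  assumes gcp: "generalized_contraction_property p X F E"
    and s: "0 < s" "s \<le> p" and r: "p \<le> r"
    and zero: "f 0 0 = 0" "g 0 0 = 0"
    and contr: "\<And>x y x' y'. (\<bar>f x y - f x' y'\<bar> powr r + \<bar>g x y - g x' y'\<bar> powr r) powr (1 / r)
      \<le> (\<bar>x - x'\<bar> powr s + \<bar>y - y'\<bar> powr s) powr (1 / s)"
    and uv: "u \<in> F" "v \<in> F"
  shows "(E (\<lambda>x\<in>X. f (u x) (v x)) powr (r / p) + E (\<lambda>x\<in>X. g (u x) (v x)) powr (r / p)) powr (1 / r)
    \<le> (E u powr (s / p) + E v powr (s / p)) powr (1 / s)"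
proof -
  define T where "T z = (\<lambda>k\<in>{..<2::nat}. if k = 0 then f (z 0) (z 1) else g (z 0) (z 1))" for z :: "nat \<Rightarrow> real"
  define w where "w j = (if j = 0 then u else v)" for j :: nat
  have two: "{..<2::nat} = {0, 1}" by auto
  have ln: "lnorm (ereal t) 2 z = (\<bar>z 0\<bar> powr t + \<bar>z 1\<bar> powr t) powr (1 / t)" for t z
    by (simp add: lnorm_def two)
  have "let Tu = (\<lambda>k. \<lambda>x\<in>X. T (\<lambda>j\<in>{..<2}. w j x) k) in
      (\<forall>k<2. Tu k \<in> F) \<and>
      lnorm (ereal r) 2 (\<lambda>k. E (Tu k) powr (1 / p)) \<le> lnorm (ereal s) 2 (\<lambda>j. E (w j) powr (1 / p))"
  proof (rule gcp[unfolded generalized_contraction_property_def, rule_format])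
    show "0 < s \<and> s \<le> p \<and> ereal p \<le> ereal r \<and> (1::nat) \<le> 2 \<and> (1::nat) \<le> 2 \<and>
        T \<in> real_funs {..<2} \<rightarrow> real_funs {..<2} \<and>
        T (\<lambda>j\<in>{..<2}. 0) = (\<lambda>k\<in>{..<2}. 0) \<and>
        (\<forall>x\<in>real_funs {..<2}. \<forall>y\<in>real_funs {..<2}.
           lnorm (ereal r) 2 (\<lambda>k. T x k - T y k) \<le> lnorm (ereal s) 2 (\<lambda>j. x j - y j))"
      using s r contr zero by (auto simp: T_def ln fun_eq_iff)
  qed (use uv in \<open>auto simp: w_def\<close>)
  then show ?thesis
    by (simp add: Let_def ln T_def w_def powr_powr)
qed

definition vfun :: "(nat \<Rightarrow> real^2) \<Rightarrow> real \<times> real \<times> real \<Rightarrow> real^2 \<Rightarrow> real" where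
  "vfun a t = (\<lambda>x\<in>vertices a 0. if x = a 1 then fst t else if x = a 2 then fst (snd t) else snd (snd t))"

lemma vertices_0: "vertices a 0 = {a 1, a 2, a 3}"
  by (auto simp: vertices_def alphabet_def)

locale gasket_form =
  fixes a :: "nat \<Rightarrow> real^2" and K :: "(real^2) set" and p \<rho> :: real and E0 :: "(real^2 \<Rightarrow> real) \<Rightarrow> real"
  assumes triangle: "equilateral_triangle a" and gasket: "is_gasket a K"
    and p: "1 < p" and data: "canonical_data a K p \<rho> E0"
begin

abbreviation "V0 \<equiv> vertices a 0"

definition form :: "real \<times> real \<times> real \<Rightarrow> real" where "form t = E0 (vfun a t)"

lemmas distinct = vertices_distinct[OF triangle gasket]

lemma resistance: "resistance_form p V0 (real_funs V0) E0"
  using data by (simp add: canonical_data_def)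

lemma vfun_in: "vfun a t \<in> real_funs V0"
  by (simp add: vfun_def)

lemma restrict_V0: "restrict f V0 = vfun a (f (a 1), f (a 2), f (a 3))"
  by (auto simp: vfun_def vertices_0 fun_eq_iff)

lemma vfun_values: "vfun a (x1, x2, x3) (a 1) = x1" "vfun a (x1, x2, x3) (a (Suc 0)) = x1" "vfun a (x1, x2, x3) (a 2) = x2" "vfun a (x1, x2, x3) (a 3) = x3"
  using distinct by (auto simp: vfun_def vertices_0)

lemma vfun_map2: "(\<lambda>x\<in>V0. f (vfun a (x1, x2, x3) x) (vfun a (y1, y2, y3) x)) = vfun a (f x1 y1, f x2 y2, f x3 y3)"
  using restrict_V0[of "\<lambda>x. f (vfun a (x1, x2, x3) x) (vfun a (y1, y2, y3) x)"] by (simp add: vfun_values)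

lemma vfun_scale: "(\<lambda>x\<in>V0. c * vfun a t x) = vfun a (c *\<^sub>R t)"
  by (cases t) (use vfun_map2[of "\<lambda>x y. c * x"] in simp)

lemma vfun_add: "(\<lambda>x\<in>V0. vfun a s x + vfun a t x) = vfun a (s + t)"
  by (cases s; cases t) (use vfun_map2[of "(+)"] in simp)

lemma vfun_const: "vfun a (c, c, c) \<in> const_funs V0"
  using restrict_V0[of "\<lambda>_. c"] unfolding const_funs_def by (metis rangeI)

lemma form_nonneg: "0 \<le> form t"
  using resistance vfun_in by (simp add: resistance_form_def form_def)

definition N :: "real \<times> real \<times> real \<Rightarrow> real" where "N t = form t powr (1 / p)"

lemma seminorm: "fun_seminorm V0 (real_funs V0) (\<lambda>u. E0 u powr (1 / p))"
  using resistance by (simp add: resistance_form_def)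

lemma N_scale: "N (c *\<^sub>R t) = \<bar>c\<bar> * N t"
proof -
  have "E0 (\<lambda>x\<in>V0. c * vfun a t x) powr (1 / p) = \<bar>c\<bar> * E0 (vfun a t) powr (1 / p)"
    using seminorm vfun_in[of t] unfolding fun_seminorm_def by blast
  then show ?thesis by (simp only: vfun_scale N_def form_def)
qed

lemma N_add: "N (s + t) \<le> N s + N t"
proof -
  have "E0 (\<lambda>x\<in>V0. vfun a s x + vfun a t x) powr (1 / p) \<le> E0 (vfun a s) powr (1 / p) + E0 (vfun a t) powr (1 / p)"
    using seminorm vfun_in[of s] vfun_in[of t] unfolding fun_seminorm_def by blast
  then show ?thesis by (simp only: vfun_add N_def form_def)
qed

lemma form_N: "form t = N t powr p"
  using form_nonneg p by (simp add: N_def powr_powr)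

lemma N_nonneg: "0 \<le> N t" by (simp add: N_def)

lemma form_const: "form (c, c, c) = 0"
proof -
  have "{u \<in> real_funs V0. E0 u = 0} = const_funs V0" using resistance by (simp add: resistance_form_def)
  then show ?thesis using vfun_const by (auto simp: form_def)
qed

lemma form_shift: "form (t + (c, c, c)) = form t"
proof -
  have z: "N (d, d, d) = 0" for d using form_const by (simp add: N_def)
  have "N (t + (c, c, c)) \<le> N t" using N_add[of t "(c, c, c)"] z by simp
  moreover have "N t \<le> N (t + (c, c, c))" using N_add[of "t + (c, c, c)" "(- c, - c, - c)"] z[of "- c"] by (cases t) simp
  ultimately show ?thesis by (simp add: form_N)
qed

lemma form_scale: "form (c *\<^sub>R t) = \<bar>c\<bar> powr p * form t"
  by (simp add: form_N N_scale powr_mult)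

lemma form_convex: "convex_on UNIV form"
proof (rule convex_onI)
  fix t x y assume t: "(0::real) < t" "t < 1"
  have "N ((1 - t) *\<^sub>R x + t *\<^sub>R y) \<le> (1 - t) * N x + t * N y"
    using N_add[of "(1 - t) *\<^sub>R x" "t *\<^sub>R y"] t by (simp add: N_scale)
  then have "N ((1 - t) *\<^sub>R x + t *\<^sub>R y) powr p \<le> ((1 - t) * N x + t * N y) powr p"
    using p N_nonneg by (intro powr_mono2) auto
  also have "\<dots> \<le> (1 - t) * N x powr p + t * N y powr p"
    using convex_onD[OF powr_convex_nonneg[of p], of t "N x" "N y"] t p N_nonneg by simp
  finally show "form ((1 - t) *\<^sub>R x + t *\<^sub>R y) \<le> (1 - t) * form x + t * form y" by (simp add: form_N)
qed simp

lemma form_bound: "\<exists>C. \<forall>x y z. \<bar>x - y\<bar> powr p \<le> C * form (x, y, z)"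
proof -
  have "bdd_above ((\<lambda>u. \<bar>u (a 1) - u (a 2)\<bar> powr p / E0 u) ` (real_funs V0 - const_funs V0))"
    using resistance unfolding resistance_form_def by (simp add: vertices_0)
  then obtain C where C: "\<And>u. u \<in> real_funs V0 - const_funs V0 \<Longrightarrow> \<bar>u (a 1) - u (a 2)\<bar> powr p / E0 u \<le> C"
    by (auto simp: bdd_above_def)
  have "\<bar>x - y\<bar> powr p \<le> C * form (x, y, z)" for x y z
  proof (cases "vfun a (x, y, z) \<in> const_funs V0")
    case True
    then obtain c where "vfun a (x, y, z) = (\<lambda>x\<in>V0. c)" by (auto simp: const_funs_def)
    from fun_cong[OF this, of "a 1"] fun_cong[OF this, of "a 2"] have "x = c" "y = c"
      by (auto simp: vfun_values vertices_0)
    moreover have "form (x, y, z) = 0"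
      using True resistance by (auto simp: resistance_form_def form_def)
    ultimately show ?thesis by simp
  next
    case False
    have "{u \<in> real_funs V0. E0 u = 0} = const_funs V0" using resistance by (simp add: resistance_form_def)
    then have "form (x, y, z) \<noteq> 0" using False vfun_in[of "(x, y, z)"] by (auto simp: form_def)
    then have "0 < form (x, y, z)" using form_nonneg[of "(x, y, z)"] by simp
    then show ?thesis using C[of "vfun a (x, y, z)"] False vfun_in[of "(x, y, z)"]
      by (simp add: vfun_values form_def field_simps)
  qed
  then show ?thesis by blast
qed

lemma form_contraction:
  assumes "0 < s" "s \<le> p" "p \<le> r" "f 0 0 = 0" "g 0 0 = 0"
    and "\<And>x y x' y'. (\<bar>f x y - f x' y'\<bar> powr r + \<bar>g x y - g x' y'\<bar> powr r) powr (1 / r)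
      \<le> (\<bar>x - x'\<bar> powr s + \<bar>y - y'\<bar> powr s) powr (1 / s)"
  shows "(form (f x1 y1, f x2 y2, f x3 y3) powr (r / p) + form (g x1 y1, g x2 y2, g x3 y3) powr (r / p)) powr (1 / r)
    \<le> (form (x1, x2, x3) powr (s / p) + form (y1, y2, y3) powr (s / p)) powr (1 / s)"
proof -
  have "generalized_contraction_property p V0 (real_funs V0) E0"
    using resistance by (simp add: resistance_form_def)
  from generalized_contraction_two[OF this assms vfun_in[of "(x1, x2, x3)"] vfun_in[of "(y1, y2, y3)"]]
  show ?thesis by (simp add: vfun_map2 form_def)
qed

lemma form_submodular:
  "form (min x1 y1, min x2 y2, min x3 y3) + form (max x1 y1, max x2 y2, max x3 y3)
      \<le> form (x1, x2, x3) + form (y1, y2, y3)"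
proof -
  have "(form (min x1 y1, min x2 y2, min x3 y3) powr (p / p) + form (max x1 y1, max x2 y2, max x3 y3) powr (p / p)) powr (1 / p)
    \<le> (form (x1, x2, x3) powr (p / p) + form (y1, y2, y3) powr (p / p)) powr (1 / p)"
    using p by (intro form_contraction powr_mono2 min_max_powr_contraction) auto
  then have "(form (min x1 y1, min x2 y2, min x3 y3) + form (max x1 y1, max x2 y2, max x3 y3)) powr (1 / p)
    \<le> (form (x1, x2, x3) + form (y1, y2, y3)) powr (1 / p)"
    using p form_nonneg by simp
  then show ?thesis by (rule powr_le_cancel_base[rotated 2]) (use p form_nonneg in auto)
qed

text \<open>The smoothness pair bounds the two energies by 2 (form x^(1/\<kappa>) + form
  z^(1/\<kappa>))^\<kappa>. For z = (t / \<epsilon>) y the second summand is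
  \<open>\<tau> * B\<close> with \<tau> = t^s, and s > 1 is the gain.\<close>

lemma form_smooth:
  "\<exists>M s. 1 < s \<and> (\<forall>t\<in>{0..1}. form (x + t *\<^sub>R y) + form (x - t *\<^sub>R y) \<le> 2 * form x + M * t powr s)"
proof -
  define s where "s = min p 2"
  define \<kappa> where "\<kappa> = p / s"
  have s: "1 < s" "s \<le> p" "1 \<le> \<kappa>" using p by (auto simp: s_def \<kappa>_def)
  obtain \<epsilon> where \<epsilon>: "0 < \<epsilon>"
    and sm: "\<And>x y. \<bar>x + \<epsilon> * y\<bar> powr p + \<bar>x - \<epsilon> * y\<bar> powr p
       \<le> 2 * (\<bar>x\<bar> powr s + \<bar>y\<bar> powr s) powr \<kappa>"
    using two_point_smoothness[OF p] unfolding s_def \<kappa>_def by metis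
  \<comment> \<open>Since k^p = 1/2, this absorbs the factor 2 of the two-point inequality.\<close>
  define k where "k = (1 / 2) powr (1 / p)"
  have k: "0 < k" "k powr p = 1 / 2" using p by (auto simp: k_def powr_powr)
  have main: "form (x + \<epsilon> *\<^sub>R z) + form (x - \<epsilon> *\<^sub>R z) \<le> 2 * (form x powr (1 / \<kappa>) + form z powr (1 / \<kappa>)) powr \<kappa>" for z
  proof -
    obtain x1 x2 x3 z1 z2 z3 where xz: "x = (x1, x2, x3)" "z = (z1, z2, z3)" by (cases x; cases z) auto
    define f where "f u v = k * (u + \<epsilon> * v)" for u v
    define g where "g u v = k * (u - \<epsilon> * v)" for u v
    have "(form (f x1 z1, f x2 z2, f x3 z3) powr (p / p) + form (g x1 z1, g x2 z2, g x3 z3) powr (p / p)) powr (1 / p)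
      \<le> (form (x1, x2, x3) powr (s / p) + form (z1, z2, z3) powr (s / p)) powr (1 / s)"
    proof (rule form_contraction)
      fix u v u' v' :: real
      have "\<bar>f u v - f u' v'\<bar> = k * \<bar>(u - u') + \<epsilon> * (v - v')\<bar>" "\<bar>g u v - g u' v'\<bar> = k * \<bar>(u - u') - \<epsilon> * (v - v')\<bar>"
        using k by (simp_all add: f_def g_def abs_mult_pos' algebra_simps flip: abs_mult_pos)
      then have "\<bar>f u v - f u' v'\<bar> powr p + \<bar>g u v - g u' v'\<bar> powr p
          = (\<bar>(u - u') + \<epsilon> * (v - v')\<bar> powr p + \<bar>(u - u') - \<epsilon> * (v - v')\<bar> powr p) / 2"
        by (simp only: powr_mult k(2)) simp
      also have "\<dots> \<le> (\<bar>u - u'\<bar> powr s + \<bar>v - v'\<bar> powr s) powr \<kappa>" using sm[of "u - u'" "v - v'"] by simp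
      finally have "(\<bar>f u v - f u' v'\<bar> powr p + \<bar>g u v - g u' v'\<bar> powr p) powr (1 / p)
          \<le> ((\<bar>u - u'\<bar> powr s + \<bar>v - v'\<bar> powr s) powr \<kappa>) powr (1 / p)"
        using p by (intro powr_mono2) auto
      also have "\<dots> = (\<bar>u - u'\<bar> powr s + \<bar>v - v'\<bar> powr s) powr (1 / s)" using p s by (simp add: powr_powr \<kappa>_def)
      finally show "(\<bar>f u v - f u' v'\<bar> powr p + \<bar>g u v - g u' v'\<bar> powr p) powr (1 / p)
          \<le> (\<bar>u - u'\<bar> powr s + \<bar>v - v'\<bar> powr s) powr (1 / s)" .
    qed (use s in \<open>auto simp: f_def g_def\<close>)
    moreover have "(f x1 z1, f x2 z2, f x3 z3) = k *\<^sub>R (x + \<epsilon> *\<^sub>R z)" "(g x1 z1, g x2 z2, g x3 z3) = k *\<^sub>R (x - \<epsilon> *\<^sub>R z)"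
      by (simp_all add: f_def g_def xz)
    then have "form (f x1 z1, f x2 z2, f x3 z3) = form (x + \<epsilon> *\<^sub>R z) / 2" "form (g x1 z1, g x2 z2, g x3 z3) = form (x - \<epsilon> *\<^sub>R z) / 2"
      using k by (simp_all only: form_scale) simp_all
    ultimately have "((form (x + \<epsilon> *\<^sub>R z) + form (x - \<epsilon> *\<^sub>R z)) / 2) powr (1 / p)
        \<le> (form x powr (1 / \<kappa>) + form z powr (1 / \<kappa>)) powr (1 / s)"
      using p form_nonneg by (simp add: xz[symmetric] \<kappa>_def add_divide_distrib)
    then have "(((form (x + \<epsilon> *\<^sub>R z) + form (x - \<epsilon> *\<^sub>R z)) / 2) powr (1 / p)) powr p
        \<le> ((form x powr (1 / \<kappa>) + form z powr (1 / \<kappa>)) powr (1 / s)) powr p"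
      using p by (intro powr_mono2) auto
    then show ?thesis using p form_nonneg by (simp add: powr_powr \<kappa>_def)
  qed
  define A where "A = form x powr (1 / \<kappa>)"
  define B where "B = form ((1 / \<epsilon>) *\<^sub>R y) powr (1 / \<kappa>)"
  \<comment> \<open>M is the slope of the chord over [0, 1] of the convex function 2 (A + \<tau>
    B)^\<kappa> of \<tau>.\<close>
  define M where "M = 2 * ((A + B) powr \<kappa> - A powr \<kappa>)"
  have AB: "0 \<le> A" "0 \<le> B" by (simp_all add: A_def B_def)
  have "form (x + t *\<^sub>R y) + form (x - t *\<^sub>R y) \<le> 2 * form x + M * t powr s" if t: "0 \<le> t" "t \<le> 1" for t
  proof -
    define \<tau> where "\<tau> = t powr s"
    have \<tau>: "0 \<le> \<tau>" "\<tau> \<le> 1" using t s by (auto simp: \<tau>_def powr_le1)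
    have "form ((t / \<epsilon>) *\<^sub>R y) = t powr p * form ((1 / \<epsilon>) *\<^sub>R y)"
      using form_scale[of t "(1 / \<epsilon>) *\<^sub>R y"] t by simp
    then have "form ((t / \<epsilon>) *\<^sub>R y) powr (1 / \<kappa>) = \<tau> * B"
      using p s t by (simp add: powr_mult powr_powr B_def \<tau>_def \<kappa>_def)
    then have "form (x + t *\<^sub>R y) + form (x - t *\<^sub>R y) \<le> 2 * (A + \<tau> * B) powr \<kappa>"
      using main[of "(t / \<epsilon>) *\<^sub>R y"] \<epsilon> by (simp add: A_def)
    also have "A + \<tau> * B = (1 - \<tau>) *\<^sub>R A + \<tau> *\<^sub>R (A + B)" by (simp add: algebra_simps)
    also have "\<dots> powr \<kappa> \<le> (1 - \<tau>) * A powr \<kappa> + \<tau> * (A + B) powr \<kappa>"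
      by (rule convex_onD[OF powr_convex_nonneg[OF s(3)] \<tau>]) (use AB in auto)
    finally have "form (x + t *\<^sub>R y) + form (x - t *\<^sub>R y) \<le> 2 * A powr \<kappa> + M * \<tau>"
      by (simp add: M_def algebra_simps)
    also have "A powr \<kappa> = form x" using s form_nonneg by (simp add: A_def powr_powr)
    finally show ?thesis by (simp add: \<tau>_def)
  qed
  then show ?thesis using s by (intro exI[of _ M] exI[of _ s]) auto
qed

text \<open>The convexity pair gives more than midpoint convexity: the energy of a multiple of x - y
  enters as an additional summand, and where it is positive the inequality is strict.\<close>

lemma form_strict:
  assumes "form (x - y) \<noteq> 0"
  shows "form ((1 / 2) *\<^sub>R (x + y)) < (form x + form y) / 2"
proof -
  define r where "r = max p 2"
  have r: "p \<le> r" "0 < p / r" "1 < r" using p by (auto simp: r_def)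
  obtain \<epsilon> where \<epsilon>: "0 < \<epsilon>"
    and cv: "\<And>a b. (\<bar>a\<bar> powr r + \<epsilon> * \<bar>b\<bar> powr r) powr (p / r) \<le> (\<bar>a + b\<bar> powr p + \<bar>a - b\<bar> powr p) / 2"
    using two_point_convexity[OF p] unfolding r_def by metis
  \<comment> \<open>Here k^p = 2 clears the denominator of the two-point inequality, and below
    \<eta>^r = \<epsilon> moves its constant into the map.\<close>
  define k where "k = 2 powr (1 / p)"
  have k: "0 < k" "k powr p = 2" "k powr r = 2 powr (r / p)" using p by (auto simp: k_def powr_powr)
  define \<eta> where "\<eta> = \<epsilon> powr (1 / r)"
  have \<eta>: "0 < \<eta>" "\<eta> powr r = \<epsilon>" using \<epsilon> r by (auto simp: \<eta>_def powr_powr)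
  obtain x1 x2 x3 y1 y2 y3 where xy: "x = (x1, x2, x3)" "y = (y1, y2, y3)" by (cases x; cases y) auto
  define f where "f u v = k * ((u + v) / 2)" for u v
  define g where "g u v = k * \<eta> * ((u - v) / 2)" for u v
  have "(form (f x1 y1, f x2 y2, f x3 y3) powr (r / p) + form (g x1 y1, g x2 y2, g x3 y3) powr (r / p)) powr (1 / r)
      \<le> (form (x1, x2, x3) powr (p / p) + form (y1, y2, y3) powr (p / p)) powr (1 / p)"
  proof (rule form_contraction)
    fix u v u' v' :: real
    define b where "b = ((u - u') + (v - v')) / 2"
    define c where "c = ((u - u') - (v - v')) / 2"
    have "f u v - f u' v' = k * b" "g u v - g u' v' = k * \<eta> * c"
      by (simp_all add: f_def g_def b_def c_def algebra_simps add_divide_distrib diff_divide_distrib)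
    then have "\<bar>f u v - f u' v'\<bar> powr r + \<bar>g u v - g u' v'\<bar> powr r = k powr r * (\<bar>b\<bar> powr r + \<epsilon> * \<bar>c\<bar> powr r)"
      using k \<eta> by (simp add: abs_mult powr_mult algebra_simps)
    then have "(\<bar>f u v - f u' v'\<bar> powr r + \<bar>g u v - g u' v'\<bar> powr r) powr (1 / r)
        = (2 * (\<bar>b\<bar> powr r + \<epsilon> * \<bar>c\<bar> powr r) powr (p / r)) powr (1 / p)"
      using r p by (simp add: k powr_mult powr_powr)
    also have "\<dots> \<le> (\<bar>u - u'\<bar> powr p + \<bar>v - v'\<bar> powr p) powr (1 / p)"
    proof (rule powr_mono2)
      have "b + c = u - u'" "b - c = v - v'" by (simp_all add: b_def c_def field_simps)
      then show "2 * (\<bar>b\<bar> powr r + \<epsilon> * \<bar>c\<bar> powr r) powr (p / r) \<le> \<bar>u - u'\<bar> powr p + \<bar>v - v'\<bar> powr p"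
        using cv[of b c] by simp
    qed (use p in auto)
    finally show "(\<bar>f u v - f u' v'\<bar> powr r + \<bar>g u v - g u' v'\<bar> powr r) powr (1 / r)
        \<le> (\<bar>u - u'\<bar> powr p + \<bar>v - v'\<bar> powr p) powr (1 / p)" .
  qed (use p r in \<open>auto simp: f_def g_def\<close>)
  moreover have "(f x1 y1, f x2 y2, f x3 y3) = k *\<^sub>R ((1 / 2) *\<^sub>R (x + y))" "(g x1 y1, g x2 y2, g x3 y3) = (k * \<eta> / 2) *\<^sub>R (x - y)"
    by (simp_all add: f_def g_def xy)
  moreover have "form (k *\<^sub>R ((1 / 2) *\<^sub>R (x + y))) = 2 * form ((1 / 2) *\<^sub>R (x + y))"
    using k by (simp only: form_scale[of k]) simp
  ultimately have "((2 * form ((1 / 2) *\<^sub>R (x + y))) powr (r / p) + form ((k * \<eta> / 2) *\<^sub>R (x - y)) powr (r / p)) powr (1 / r)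
      \<le> (form x + form y) powr (1 / p)"
    using p form_nonneg by (simp add: xy[symmetric])
  then have "(((2 * form ((1 / 2) *\<^sub>R (x + y))) powr (r / p) + form ((k * \<eta> / 2) *\<^sub>R (x - y)) powr (r / p)) powr (1 / r)) powr p
      \<le> ((form x + form y) powr (1 / p)) powr p"
    using p by (intro powr_mono2) auto
  then have le: "((2 * form ((1 / 2) *\<^sub>R (x + y))) powr (r / p) + form ((k * \<eta> / 2) *\<^sub>R (x - y)) powr (r / p)) powr (p / r)
      \<le> form x + form y"
    using p form_nonneg by (simp add: powr_powr)
  have "form ((k * \<eta> / 2) *\<^sub>R (x - y)) \<noteq> 0" using assms k \<eta> by (simp add: form_scale)
  then have "0 < form ((k * \<eta> / 2) *\<^sub>R (x - y)) powr (r / p)" by simp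
  then have "((2 * form ((1 / 2) *\<^sub>R (x + y))) powr (r / p)) powr (p / r)
      < ((2 * form ((1 / 2) *\<^sub>R (x + y))) powr (r / p) + form ((k * \<eta> / 2) *\<^sub>R (x - y)) powr (r / p)) powr (p / r)"
    using r by (intro powr_less_mono2) auto
  moreover have "((2 * form ((1 / 2) *\<^sub>R (x + y))) powr (r / p)) powr (p / r) = 2 * form ((1 / 2) *\<^sub>R (x + y))"
    using r p form_nonneg by (simp add: powr_powr)
  ultimately show ?thesis using le by simp
qed

lemma form_symmetric:
  assumes "g \<in> isometry_group K" and "g (a 1) = a i" "g (a 2) = a j" "g (a 3) = a k"
  shows "form (vfun a t (a i), vfun a t (a j), vfun a t (a k)) = form t"
proof -
  have "E0 (restrict (vfun a t \<circ> g) V0) = E0 (vfun a t)"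
    using data assms(1) vfun_in by (auto simp: canonical_data_def)
  then show ?thesis by (simp add: restrict_V0 form_def assms del: One_nat_def)
qed

lemma form_swap12: "form (x2, x1, x3) = form (x1, x2, x3)"
  using form_symmetric[OF reflect12[OF triangle gasket], of "(x1, x2, x3)"] by (simp only: vfun_values)

lemma form_swap23: "form (x1, x3, x2) = form (x1, x2, x3)"
  using form_symmetric[OF reflect23(1)[OF triangle gasket] reflect23(4)[OF triangle gasket]
      reflect23(2)[OF triangle gasket] reflect23(3)[OF triangle gasket], of "(x1, x2, x3)"]
  by (simp only: vfun_values)

section \<open>The graph of level 1 and the renormalization equation\<close>

definition midpt :: "nat \<Rightarrow> nat \<Rightarrow> real^2" where "midpt i j = contraction a i (a j)"

lemma midpt_eq: "midpt i j = (1 / 2) *\<^sub>R (a i + a j)"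
  by (simp add: midpt_def contraction_eq)

lemma midpt_commute: "midpt j i = midpt i j"
  by (simp add: midpt_eq add.commute)

lemma contraction_vertex: "contraction a i (a i) = a i"
  by (simp add: contraction_def)

lemma contraction_vertices:
  "contraction a 1 (a 1) = a 1" "contraction a 1 (a 2) = midpt 1 2" "contraction a 1 (a 3) = midpt 1 3"
  "contraction a 2 (a 1) = midpt 1 2" "contraction a 2 (a 2) = a 2" "contraction a 2 (a 3) = midpt 2 3"
  "contraction a 3 (a 1) = midpt 1 3" "contraction a 3 (a 2) = midpt 2 3" "contraction a 3 (a 3) = a 3"
  by (simp_all only: contraction_vertex midpt_def[symmetric]) (simp_all only: midpt_eq add.commute)

lemma words_1: "words 1 = {[1], [2], [3]}"
  by (auto simp: words_def alphabet_def length_Suc_conv)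

lemma vertices_1: "vertices a 1 = {a 1, a 2, a 3, midpt 1 2, midpt 1 3, midpt 2 3}"
proof -
  have "vertices a 1 = contraction a 1 ` {a 1, a 2, a 3} \<union> contraction a 2 ` {a 1, a 2, a 3} \<union> contraction a 3 ` {a 1, a 2, a 3}"
    unfolding vertices_def words_1 by (simp add: alphabet_def Un_assoc)
  also have "\<dots> = {a 1, midpt 1 2, midpt 1 3} \<union> {midpt 1 2, a 2, midpt 2 3} \<union> {midpt 1 3, midpt 2 3, a 3}"
    by (simp only: image_insert image_empty contraction_vertices)
  also have "\<dots> = {a 1, a 2, a 3, midpt 1 2, midpt 1 3, midpt 2 3}" by blast
  finally show ?thesis .
qed

text \<open>A midpoint is half a side away from its two endpoints, whereas vertices are a full side
  apart. Distinctness is what allows \<open>extension\<close> to prescribe the midpoint values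
  independently.\<close>

lemma midpt_distinct:
  "midpt 1 2 \<notin> {a 1, a 2, a 3}" "midpt 1 3 \<notin> {a 1, a 2, a 3}" "midpt 2 3 \<notin> {a 1, a 2, a 3}"
  "midpt 1 2 \<noteq> midpt 1 3" "midpt 1 2 \<noteq> midpt 2 3" "midpt 1 3 \<noteq> midpt 2 3"
proof -
  have half: "dist (midpt i j) (a i) = dist (a i) (a j) / 2" for i j
    using dist_contraction[of a i "a j" "a i"] by (simp add: contraction_vertex midpt_def dist_commute)
  have d: "dist (a 1) (a 2) = dist (a 2) (a 3)" "dist (a 2) (a 3) = dist (a 3) (a 1)"
    using triangle by (auto simp: equilateral_triangle_def)
  have pos: "0 < dist (a 1) (a 2)" using distinct by simp
  show "midpt 1 2 \<notin> {a 1, a 2, a 3}" "midpt 1 3 \<notin> {a 1, a 2, a 3}" "midpt 2 3 \<notin> {a 1, a 2, a 3}"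
  proof -
    have ne: "midpt i j \<noteq> a k" if "dist (a k) (a i) = dist (a i) (a j)" "a i \<noteq> a j" for i j k
      using half[of i j] that by auto
    have ne': "midpt i j \<noteq> a i" "midpt i j \<noteq> a j" if "a i \<noteq> a j" for i j
      using half[of i j] half[of j i] that by (auto simp: midpt_commute[of i j])
    show "midpt 1 2 \<notin> {a 1, a 2, a 3}" "midpt 1 3 \<notin> {a 1, a 2, a 3}" "midpt 2 3 \<notin> {a 1, a 2, a 3}"
      using ne[of 3 1 2] ne[of 2 1 3] ne[of 1 2 3] ne'[of 1 2] ne'[of 1 3] ne'[of 2 3] distinct d
      by (simp_all add: dist_commute del: One_nat_def)
  qed
  show "midpt 1 2 \<noteq> midpt 1 3" "midpt 1 2 \<noteq> midpt 2 3" "midpt 1 3 \<noteq> midpt 2 3"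
    using distinct by (auto simp: midpt_eq)
qed

lemma renorm_1: "renorm a \<rho> 1 E0 v = \<rho> *
   (form (v (a 1), v (midpt 1 2), v (midpt 1 3)) + form (v (midpt 1 2), v (a 2), v (midpt 2 3))
    + form (v (midpt 1 3), v (midpt 2 3), v (a 3)))"
proof -
  have "renorm a \<rho> 1 E0 v = \<rho> * E0 (restrict (v \<circ> contraction a 1) V0)
      + \<rho> * E0 (restrict (v \<circ> contraction a 2) V0) + \<rho> * E0 (restrict (v \<circ> contraction a 3) V0)"
    unfolding renorm_def words_1 by simp
  then show ?thesis
    by (simp add: restrict_V0 form_def contraction_vertices distrib_left del: One_nat_def)
qed

lemma rho_pos: "0 < \<rho>" using data by (simp add: canonical_data_def)

lemma trace_eq:
  "Inf {renorm a \<rho> 1 E0 v | v. v \<in> real_funs (vertices a 1) \<and> restrict v V0 = vfun a t} = form t"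
  using data vfun_in unfolding canonical_data_def trace_form_def form_def by simp

lemma renorm_bdd: "bdd_below {renorm a \<rho> 1 E0 v | v. v \<in> real_funs (vertices a 1) \<and> restrict v V0 = vfun a t}"
  using rho_pos by (intro bdd_belowI[of _ 0]) (auto simp: renorm_1 form_nonneg simp del: One_nat_def)

lemma extension:
  "\<exists>v. v \<in> real_funs (vertices a 1) \<and> restrict v V0 = vfun a (x1, x2, x3) \<and>
     renorm a \<rho> 1 E0 v = \<rho> * (form (x1, b, c) + form (b, x2, d) + form (c, d, x3))"
proof -
  define v where "v = (\<lambda>x\<in>vertices a 1. if x = a 1 then x1 else if x = a 2 then x2 else if x = a 3 then x3
     else if x = midpt 1 2 then b else if x = midpt 1 3 then c else d)"
  have v: "v (a 1) = x1" "v (a 2) = x2" "v (a 3) = x3" "v (midpt 1 2) = b" "v (midpt 1 3) = c" "v (midpt 2 3) = d"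
    using distinct midpt_distinct by (simp_all add: v_def vertices_1 del: One_nat_def)
  have "restrict v V0 = vfun a (x1, x2, x3)" unfolding restrict_V0 v ..
  moreover have "renorm a \<rho> 1 E0 v = \<rho> * (form (x1, b, c) + form (b, x2, d) + form (c, d, x3))" unfolding renorm_1 v ..
  moreover have "v \<in> real_funs (vertices a 1)" by (simp add: v_def)
  ultimately show ?thesis by blast
qed

lemma form_renorm_le: "form (x1, x2, x3) \<le> \<rho> * (form (x1, b, c) + form (b, x2, d) + form (c, d, x3))"
proof -
  obtain v where v: "v \<in> real_funs (vertices a 1)" "restrict v V0 = vfun a (x1, x2, x3)"
    "renorm a \<rho> 1 E0 v = \<rho> * (form (x1, b, c) + form (b, x2, d) + form (c, d, x3))"
    using extension[of x1 x2 x3 b c d] by (elim exE conjE)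
  have "form (x1, x2, x3) \<le> renorm a \<rho> 1 E0 v"
    unfolding trace_eq[symmetric] by (rule cInf_lower[OF _ renorm_bdd]) (use v in blast)
  then show ?thesis by (simp only: v)
qed

lemma form_renorm_approx:
  assumes "0 < \<epsilon>"
  shows "\<exists>b c d. \<rho> * (form (x1, b, c) + form (b, x2, d) + form (c, d, x3)) < form (x1, x2, x3) + \<epsilon>"
proof -
  let ?S = "{renorm a \<rho> 1 E0 v | v. v \<in> real_funs (vertices a 1) \<and> restrict v V0 = vfun a (x1, x2, x3)}"
  have "?S \<noteq> {}" using extension[of x1 x2 x3 0 0 0] by blast
  moreover have "Inf ?S < form (x1, x2, x3) + \<epsilon>" using assms by (simp only: trace_eq)
  ultimately obtain y where "y \<in> ?S" "y < form (x1, x2, x3) + \<epsilon>" using cInf_lessD by meson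
  then obtain v where v: "restrict v V0 = vfun a (x1, x2, x3)" "renorm a \<rho> 1 E0 v < form (x1, x2, x3) + \<epsilon>"
    by blast
  have "v (a 1) = x1" "v (a 2) = x2" "v (a 3) = x3"
    using fun_cong[OF v(1), of "a 1"] fun_cong[OF v(1), of "a 2"] fun_cong[OF v(1), of "a 3"]
    by (simp_all add: vfun_values vertices_0)
  then have "\<rho> * (form (x1, v (midpt 1 2), v (midpt 1 3)) + form (v (midpt 1 2), x2, v (midpt 2 3))
      + form (v (midpt 1 3), v (midpt 2 3), x3)) < form (x1, x2, x3) + \<epsilon>"
    using v(2) by (simp only: renorm_1)
  then show ?thesis by blast
qed

end

sublocale gasket_form \<subseteq> renorm_form p form \<rho>
  by unfold_locales (rule p form_nonneg form_scale form_convex form_shift form_bound form_strict form_smooth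
    form_submodular form_swap12 form_swap23 rho_pos form_renorm_le form_renorm_approx | assumption)+

section \<open>From functions on the gasket to trees of vertex values\<close>

context gasket_form
begin

definition tree :: "(real^2 \<Rightarrow> real) \<Rightarrow> nat list \<Rightarrow> real \<times> real \<times> real" where
  "tree u w = (u (word_map a w (a 1)), u (word_map a w (a 2)), u (word_map a w (a 3)))"

lemma compatible_tree: "compatible (tree u)"
  unfolding compatible_def tree_def
  by (simp add: word_map_append contraction_vertices del: One_nat_def)

lemma level_energy_tree: "level_energy (tree u) n = renorm a \<rho> n E0 (restrict u (vertices a n))"
  unfolding level_energy_def renorm_def
proof (rule sum.cong[OF refl])
  fix w assume w: "w \<in> words n"
  have "word_map a w (a i) \<in> vertices a n" if "i \<in> alphabet" for i
    using w that unfolding vertices_def by blast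
  then have "form (tree u w) = E0 (restrict (restrict u (vertices a n) \<circ> word_map a w) V0)"
    by (simp add: restrict_V0 form_def tree_def alphabet_def)
  then show "\<rho> ^ n * form (tree u w) = \<rho> ^ n * E0 (restrict (restrict u (vertices a n) \<circ> word_map a w) V0)"
    by simp
qed

lemma energy_tree: "energy (tree u) = canonical_form a \<rho> E0 u"
  unfolding energy_def canonical_form_def level_energy_tree[abs_def] ..

lemma finite_energy_tree:
  assumes "u \<in> canonical_domain a K \<rho> E0"
  shows "finite_energy (tree u)"
  using assms by (simp add: finite_energy_def compatible_tree canonical_domain_def level_energy_tree[abs_def])

text \<open>Word maps send the vertices into K, so the level energies do not see the restriction to
  K. This makes \<open>mass\<close> of the tree the value of the energy measure on a cell.\<close>

lemma energy_subtree:
  assumes "set w \<subseteq> alphabet"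
  shows "canonical_form a \<rho> E0 (restrict (u \<circ> word_map a w) K) = energy (subtree w (tree u))"
proof -
  have "level_energy (tree (restrict (u \<circ> word_map a w) K)) n = level_energy (subtree w (tree u)) n" for n
    unfolding level_energy_def
  proof (rule sum.cong[OF refl])
    fix v assume v: "v \<in> words n"
    have "word_map a v (a i) \<in> K" if "i \<in> alphabet" for i
      using word_map_gasket[OF gasket, of v] vertex_in_gasket[OF gasket that] v by (auto simp: words_def)
    then show "\<rho> ^ n * form (tree (restrict (u \<circ> word_map a w) K) v) = \<rho> ^ n * form (subtree w (tree u) v)"
      by (simp add: tree_def word_map_append alphabet_def)
  qed
  then have "energy (tree (restrict (u \<circ> word_map a w) K)) = energy (subtree w (tree u))"
    unfolding energy_def by (metis ext)
  then show ?thesis by (simp only: energy_tree)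
qed

lemma energy_measure_cell:
  assumes "is_energy_measure a K \<rho> E0 u \<mu>" "w \<in> words n"
  shows "emeasure \<mu> (word_map a w ` K) = ennreal (mass (tree u) w)"
  using assms energy_subtree[of w u] by (auto simp: is_energy_measure_def mass_def words_def)

end

theorem theorem4p8:
  fixes a :: "nat \<Rightarrow> real^2" and K :: "(real^2) set"
    and p q \<rho>\<^sub>p \<rho>\<^sub>q :: real
    and E0\<^sub>p E0\<^sub>q :: "(real^2 \<Rightarrow> real) \<Rightarrow> real"
    and u v :: "real^2 \<Rightarrow> real"
    and \<mu> \<nu> :: "(real^2) measure"
  assumes "equilateral_triangle a" and "is_gasket a K"
    and "1 < p" and "1 < q" and "p \<noteq> q"
    and "canonical_data a K p \<rho>\<^sub>p E0\<^sub>p" and "canonical_data a K q \<rho>\<^sub>q E0\<^sub>q"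
    and "u \<in> canonical_domain a K \<rho>\<^sub>p E0\<^sub>p" and "v \<in> canonical_domain a K \<rho>\<^sub>q E0\<^sub>q"
    and "is_energy_measure a K \<rho>\<^sub>p E0\<^sub>p u \<mu>" and "is_energy_measure a K \<rho>\<^sub>q E0\<^sub>q v \<nu>"
  shows "mutually_singular \<mu> \<nu>"
proof -
  interpret P: gasket_form a K p \<rho>\<^sub>p E0\<^sub>p by unfold_locales (use assms in auto)
  interpret Q: gasket_form a K q \<rho>\<^sub>q E0\<^sub>q by unfold_locales (use assms in auto)
  interpret two_renorm_forms p P.form \<rho>\<^sub>p q Q.form \<rho>\<^sub>q by unfold_locales (use assms in auto)
  have fin: "P.finite_energy (P.tree u)" "Q.finite_energy (Q.tree v)"
    using assms P.finite_energy_tree Q.finite_energy_tree by auto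
  have sets: "sets \<mu> = sets (restrict_space borel K)" "sets \<nu> = sets (restrict_space borel K)"
    using assms by (auto simp: is_energy_measure_def)
  have K: "compact K" using assms by (simp add: is_gasket_def)
  show ?thesis
  proof (rule mutually_singular_cells[where W = words and cell = "\<lambda>w. word_map a w ` K"
        and m = "P.mass (P.tree u)" and m' = "Q.mass (Q.tree v)"])
    show "sets \<mu> = sets \<nu>" by (simp only: sets)
    show "finite (words n)" for n by simp
    show "word_map a w ` K \<in> sets \<mu>" if "w \<in> words n" for n w
    proof -
      have "compact (word_map a w ` K)" by (rule compact_continuous_image[OF continuous_on_word_map K])
      then have "word_map a w ` K \<in> sets borel" by (simp add: borel_compact)
      moreover have "word_map a w ` K \<subseteq> K" using that assms word_map_gasket by (auto simp: words_def)
      moreover have "K \<in> sets borel" using K by (simp add: borel_compact)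
      ultimately show ?thesis by (simp add: sets sets_restrict_space_iff)
    qed
    have "space \<mu> = K" using sets_eq_imp_space_eq[OF sets(1)] by (simp add: space_restrict_space)
    then show "space \<mu> \<subseteq> (\<Union>w\<in>words n. word_map a w ` K)" for n using gasket_cells assms by simp
    show "emeasure \<mu> (word_map a w ` K) = ennreal (P.mass (P.tree u) w) \<and> 0 \<le> P.mass (P.tree u) w" if "w \<in> words n" for n w
      using that assms P.energy_measure_cell P.mass_nonneg[OF fin(1)] by (auto simp: words_def)
    show "emeasure \<nu> (word_map a w ` K) = ennreal (Q.mass (Q.tree v) w) \<and> 0 \<le> Q.mass (Q.tree v) w" if "w \<in> words n" for n w
      using that assms Q.energy_measure_cell Q.mass_nonneg[OF fin(2)] by (auto simp: words_def)
    show "(\<lambda>n. \<Sum>w\<in>words n. sqrt (P.mass (P.tree u) w * Q.mass (Q.tree v) w)) \<longlonglongrightarrow> 0"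
      using affinity_tendsto_0[OF fin] unfolding affinity_def[abs_def] .
  qed
qed

end
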